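(* Let $r\ge 2$ and let $\{f_i\}_{i=1}^m$ be a family of $C^r$-expanding maps of the circle $\mathbb{S}^1$ with degrees $\{d_i\}_{i=1}^m\subseteq\mathbb{N}_{\ge 2}$. Let $\mu_{\rm SRB}$ be the unique stationary SRB-measure of the random walk generated by $\{f_i\}_{i=1}^m$ (each $f_i$ chosen i.i.d. with probability $1/m$). Then the Lyapunov exponent of $\mu_{\rm SRB}$ satisfies $$\lambda(\mu_{\rm SRB})\le \frac1m\sum_{i=1}^m\log|d_i| .$$ Moreover, equality holds if and only if there exist $h\in\operatorname{Diff}^r(\mathbb{S}^1)$ and $\{\rho_i\}_{i=1}^m\subseteq\mathbb{S}^1$ such that $$h\circ f_i\circ h^{-1}(x)=d_i\cdot x+\rho_i\qquad\text{for all }x\in\mathbb S^1,\ i=1,\dots,m .$$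
   Context: $\mathbb{S}^1=\mathbb{R}/\mathbb{Z}$. A $C^r$ map $f:\mathbb{S}^1\to\mathbb{S}^1$ is expanding if $|f'(x)|>1$ for all $x\in\mathbb S^1$. A Borel probability measure $\mu$ on $\mathbb{S}^1$ is stationary for the random walk if $\frac1m\sum_{i=1}^m\mu(f_i^{-1}(B))=\mu(B)$ for every Borel set $B$. The stationary SRB-measure $\mu_{\rm SRB}$ is the unique stationary probability measure that is absolutely continuous with respect to arc-length; it exists, is ergodic and is equivalent to Lebesgue measure (known fact). Its Lyapunov exponent $\lambda(\mu_{\rm SRB})$ is the a.s. limit $\lim_{n\to\infty}\frac1n\log|(f_{\omega_{n-1}}\circ\cdots\circ f_{\omega_0})'(x)|$ for $\mu_{\rm SRB}$-a.e. $x$ and a.e. i.i.d. uniformly distributed sequence $(\omega_n)_{n\ge0}$ in $\{1,\dots,m\}$, i.e. $\lambda(\mu_{\rm SRB})=\frac1m\sum_{i=1}^m\int\log|f_i'|\,d\mu_{\rm SRB}$. *)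

theory Defs
  imports "HOL-Probability.Probability"
begin

section \<open>The circle as the quotient of the reals by the integers\<close>

definition circle_rel :: "real \<Rightarrow> real \<Rightarrow> bool" where
  "circle_rel x y \<longleftrightarrow> x - y \<in> \<int>"

lemma equivp_circle_rel: "equivp circle_rel"
proof (rule equivpI)
  show "reflp circle_rel" by (auto simp: circle_rel_def reflp_def)
  show "symp circle_rel"
    by (auto simp: circle_rel_def symp_def) (metis Ints_minus minus_diff_eq)
  show "transp circle_rel"
    by (auto simp: circle_rel_def transp_def) (metis Ints_add diff_add_cancel add_diff_eq)
qed

quotient_type circle = real / circle_rel
  by (rule equivp_circle_rel)

lift_definition circle_of :: "real \<Rightarrow> circle" is "\<lambda>t. t" .

lemma circle_of_eq_iff: "circle_of s = circle_of t \<longleftrightarrow> s - t \<in> \<int>"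
  by transfer (simp add: circle_rel_def)

lemma circle_of_surj: "\<exists>t. circle_of t = x"
proof -
  have "\<exists>t. circle_rel t y" for y
    by (rule exI[of _ y]) (simp add: circle_rel_def)
  then show ?thesis by transfer
qed

instantiation circle :: ab_group_add
begin

lift_definition zero_circle :: circle is 0 .

lift_definition plus_circle :: "circle \<Rightarrow> circle \<Rightarrow> circle" is "(+)"
  unfolding circle_rel_def by (metis Ints_add add_diff_add)

lift_definition uminus_circle :: "circle \<Rightarrow> circle" is uminus
  unfolding circle_rel_def by (metis Ints_minus minus_diff_minus)

lift_definition minus_circle :: "circle \<Rightarrow> circle \<Rightarrow> circle" is "(-)"
  unfolding circle_rel_def by (metis Ints_diff diff_diff_add diff_add_eq diff_diff_eq2 diff_add_eq_diff_diff_swap)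

instance
  by standard (transfer; simp add: circle_rel_def algebra_simps)+

end

lift_definition circle_scale :: "int \<Rightarrow> circle \<Rightarrow> circle" is "\<lambda>d t. of_int d * t"
  unfolding circle_rel_def by (metis Ints_mult Ints_of_int right_diff_distrib)

instantiation circle :: topological_space
begin

definition open_circle :: "circle set \<Rightarrow> bool" where
  "open_circle U \<longleftrightarrow> open (circle_of -` U)"

instance
proof
  show "open (UNIV :: circle set)" by (simp add: open_circle_def)
  show "open (S \<inter> T)" if "open S" "open T" for S T :: "circle set"
    using that by (auto simp: open_circle_def)
  show "open (\<Union>K)" if "\<forall>S\<in>K. open S" for K :: "circle set set"
    using that by (auto simp: open_circle_def vimage_Union)
qed

end

lemma continuous_circle_of: "continuous_on UNIV circle_of"
  by (simp add: continuous_on_open_vimage open_circle_def)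

definition circle_lebesgue :: "circle measure" where
  "circle_lebesgue = distr (restrict_space lborel {0..<1}) borel circle_of"


section \<open>Smooth maps of the circle\<close>

definition is_lift :: "(real \<Rightarrow> real) \<Rightarrow> (circle \<Rightarrow> circle) \<Rightarrow> bool" where
  "is_lift F f \<longleftrightarrow> continuous_on UNIV F \<and> (\<forall>t. f (circle_of t) = circle_of (F t))"

definition C_real :: "nat \<Rightarrow> (real \<Rightarrow> real) \<Rightarrow> bool" where
  "C_real r F \<longleftrightarrow>
     (\<forall>k<r. \<forall>t. (deriv ^^ k) F differentiable (at t)) \<and> continuous_on UNIV ((deriv ^^ r) F)"

definition C_circle :: "nat \<Rightarrow> (circle \<Rightarrow> circle) \<Rightarrow> bool" where
  "C_circle r f \<longleftrightarrow> (\<exists>F. is_lift F f \<and> C_real r F)"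

definition Diff_circle :: "nat \<Rightarrow> (circle \<Rightarrow> circle) set" where
  "Diff_circle r = {h. bij h \<and> C_circle r h \<and> C_circle r (inv h)}"

text \<open>Two continuous lifts of the same map differ by an integer constant, so neither of the
  following depends on the lift (nor, for the derivative, on the representative of the point); see
  \<open>circle_deriv_eq\<close> and \<open>is_lift_degree\<close> below.\<close>

definition circle_deriv :: "(circle \<Rightarrow> circle) \<Rightarrow> circle \<Rightarrow> real" where
  "circle_deriv f x =
     (THE D. \<exists>F t. is_lift F f \<and> circle_of t = x \<and> (F has_real_derivative D) (at t))"

definition circle_degree :: "(circle \<Rightarrow> circle) \<Rightarrow> int" where
  "circle_degree f = (THE d. \<exists>F. is_lift F f \<and> (\<forall>t. F (t + 1) = F t + of_int d))"

definition expanding :: "(circle \<Rightarrow> circle) \<Rightarrow> bool" where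
  "expanding f \<longleftrightarrow> (\<forall>x. \<bar>circle_deriv f x\<bar> > 1)"


section \<open>The random walk\<close>

definition stationary :: "nat \<Rightarrow> (nat \<Rightarrow> circle \<Rightarrow> circle) \<Rightarrow> circle measure \<Rightarrow> bool" where
  "stationary m f \<mu> \<longleftrightarrow>
     prob_space \<mu> \<and> sets \<mu> = sets borel \<and>
     (\<forall>B \<in> sets borel. (1 / real m) * (\<Sum>i = 1..m. measure \<mu> (f i -` B)) = measure \<mu> B)"

definition stationary_SRB :: "nat \<Rightarrow> (nat \<Rightarrow> circle \<Rightarrow> circle) \<Rightarrow> circle measure \<Rightarrow> bool" where
  "stationary_SRB m f \<mu> \<longleftrightarrow> stationary m f \<mu> \<and> absolutely_continuous circle_lebesgue \<mu>"

text \<open>The Lyapunov exponent is given by its integral formula. The pathwise description as the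
  almost sure limit is \<open>lyapunov_limit\<close> below; \<open>lyapunov_limit_imp_eq\<close> shows that whenever the
  almost sure limit is a constant, that constant is \<open>lyapunov_exponent\<close>.\<close>

definition lyapunov_exponent :: "nat \<Rightarrow> (nat \<Rightarrow> circle \<Rightarrow> circle) \<Rightarrow> circle measure \<Rightarrow> real" where
  "lyapunov_exponent m f \<mu> =
     (1 / real m) * (\<Sum>i = 1..m. \<integral>x. ln \<bar>circle_deriv (f i) x\<bar> \<partial>\<mu>)"

primrec random_comp :: "(nat \<Rightarrow> circle \<Rightarrow> circle) \<Rightarrow> (nat \<Rightarrow> nat) \<Rightarrow> nat \<Rightarrow> circle \<Rightarrow> circle" where
  "random_comp f \<omega> 0 = id"
| "random_comp f \<omega> (Suc n) = f (\<omega> n) \<circ> random_comp f \<omega> n"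

definition iid_uniform :: "nat \<Rightarrow> (nat \<Rightarrow> nat) measure" where
  "iid_uniform m = PiM UNIV (\<lambda>_. uniform_count_measure {1..m})"

definition lyapunov_limit ::
    "nat \<Rightarrow> (nat \<Rightarrow> circle \<Rightarrow> circle) \<Rightarrow> circle measure \<Rightarrow> real \<Rightarrow> bool" where
  "lyapunov_limit m f \<mu> l \<longleftrightarrow>
     (AE (\<omega>, x) in iid_uniform m \<Otimes>\<^sub>M \<mu>.
        (\<lambda>n. ln \<bar>circle_deriv (random_comp f \<omega> n) x\<bar> / real n) \<longlonglongrightarrow> l)"


section \<open>Well-definedness of derivative and degree\<close>

lemma circle_of_add_int: "circle_of (t + of_int n) = circle_of t"
  by (simp add: circle_of_eq_iff)

lemma is_lift_unique:
  assumes F: "is_lift F f" and G: "is_lift G f"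
  shows "\<exists>n::int. \<forall>t. G t = F t + of_int n"
proof -
  let ?g = "\<lambda>t. G t - F t"
  have int: "?g t \<in> \<int>" for t
  proof -
    have "circle_of (G t) = circle_of (F t)" using F G by (simp add: is_lift_def)
    then show ?thesis by (simp add: circle_of_eq_iff)
  qed
  have "?g constant_on UNIV"
  proof (rule continuous_discrete_range_constant)
    show "continuous_on UNIV ?g"
      using F G by (auto simp: is_lift_def intro!: continuous_intros)
    show "\<exists>e>0. \<forall>y. y \<in> UNIV \<and> ?g y \<noteq> ?g x \<longrightarrow> e \<le> norm (?g y - ?g x)" for x
    proof (intro exI[of _ 1] conjI allI impI)
      fix y assume "y \<in> UNIV \<and> ?g y \<noteq> ?g x"
      then have "?g y - ?g x \<noteq> 0" "?g y - ?g x \<in> \<int>" using int by auto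
      then show "1 \<le> norm (?g y - ?g x)" 
        by (metis Ints_nonzero_abs_ge1 real_norm_def)
    qed simp
  qed simp
  then obtain c where c: "\<And>t. ?g t = c" by (auto simp: constant_on_def)
  have "c \<in> \<int>" using int[of 0] c[of 0] by simp
  then obtain n :: int where "c = of_int n" by (rule Ints_cases)
  then have "G t = F t + of_int n" for t using c[of t] by (simp add: algebra_simps)
  then show ?thesis by blast
qed

lemma is_lift_shift: "is_lift F f \<Longrightarrow> is_lift (\<lambda>t. F (t + of_int n)) f"
proof -
  assume F: "is_lift F f"
  have "continuous_on UNIV (\<lambda>t. F (t + of_int n))"
    using F by (auto simp: is_lift_def intro!: continuous_intros continuous_on_compose2[of UNIV F])
  moreover have "f (circle_of t) = circle_of (F (t + of_int n))" for t
  proof -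
    have "f (circle_of (t + of_int n)) = circle_of (F (t + of_int n))"
      using F by (simp only: is_lift_def)
    then show ?thesis by (simp only: circle_of_add_int)
  qed
  ultimately show ?thesis by (simp add: is_lift_def)
qed

lemma circle_deriv_eq:
  assumes F: "is_lift F f" and D: "(F has_real_derivative D) (at t)"
  shows "circle_deriv f (circle_of t) = D"
  unfolding circle_deriv_def
proof (rule the_equality)
  show "\<exists>G s. is_lift G f \<and> circle_of s = circle_of t \<and> (G has_real_derivative D) (at s)"
    using F D by blast
next
  fix D' assume "\<exists>G s. is_lift G f \<and> circle_of s = circle_of t \<and> (G has_real_derivative D') (at s)"
  then obtain G s where G: "is_lift G f" "circle_of s = circle_of t" "(G has_real_derivative D') (at s)"
    by blast
  then have "s - t \<in> \<int>" by (simp add: circle_of_eq_iff)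
  then obtain k :: int where "s - t = of_int k" by (rule Ints_cases)
  then have k: "s = t + of_int k" by simp
  obtain n :: int where n: "\<And>u. G (u + of_int k) = F u + of_int n"
    using is_lift_unique[OF F is_lift_shift[OF G(1), of k]] by blast
  have "((\<lambda>u. G (u + of_int k)) has_real_derivative D') (at t)"
    using G(3) unfolding k by (subst (asm) DERIV_shift) (simp add: add.commute)
  then have "((\<lambda>u. F u + of_int n) has_real_derivative D') (at t)" by (simp add: n)
  moreover have "((\<lambda>u. F u + of_int n) has_real_derivative D) (at t)"
    using D by (auto intro!: derivative_eq_intros)
  ultimately show "D' = D" by (rule DERIV_unique)
qed

lemma is_lift_degree:
  assumes F: "is_lift F f"
  shows "F (t + 1) = F t + of_int (circle_degree f)"
proof -
  obtain d :: int where d: "\<And>u. F (u + 1) = F u + of_int d"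
    using is_lift_unique[OF F is_lift_shift[OF F, of 1]] by auto
  have "circle_degree f = d"
    unfolding circle_degree_def
  proof (rule the_equality)
    fix d' assume "\<exists>G. is_lift G f \<and> (\<forall>t. G (t + 1) = G t + of_int d')"
    then obtain G where G: "is_lift G f" "\<And>t. G (t + 1) = G t + of_int d'" by blast
    obtain n :: int where n: "\<And>u. G u = F u + of_int n" using is_lift_unique[OF F G(1)] by blast
    have "of_int d' = (of_int d :: real)" using G(2)[of 0] n[of 0] n[of 1] d[of 0] by simp
    then show "d' = d" by simp
  qed (use F d in blast)
  with d show ?thesis by simp
qed

lemma is_lift_comp: "is_lift F f \<Longrightarrow> is_lift G g \<Longrightarrow> is_lift (F \<circ> G) (f \<circ> g)"
  unfolding is_lift_def by (auto simp: o_def intro: continuous_on_compose2[of UNIV F])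

lemma is_lift_id: "is_lift id id"
  by (auto simp: is_lift_def)

lemma is_lift_continuous:
  assumes "is_lift F f" shows "continuous_on UNIV f"
proof -
  have "open (f -` U)" if "open U" for U
  proof -
    have "circle_of -` (f -` U) = F -` (circle_of -` U)"
      using assms by (auto simp: is_lift_def)
    moreover have "open (F -` (circle_of -` U))"
      using assms that by (auto simp: is_lift_def open_circle_def intro!: open_vimage)
    ultimately show ?thesis by (simp add: open_circle_def)
  qed
  then show ?thesis by (simp add: continuous_on_open_vimage)
qed

lemma C_circle_lift:
  assumes "C_circle r f" "1 \<le> r"
  obtains F where "is_lift F f" "\<And>t. (F has_real_derivative circle_deriv f (circle_of t)) (at t)"
    "continuous_on UNIV (\<lambda>t. circle_deriv f (circle_of t))"
proof -
  obtain F where F: "is_lift F f" "C_real r F" using assms by (auto simp: C_circle_def)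
  have d: "(F has_real_derivative deriv F t) (at t)" for t
  proof -
    have "\<forall>k<r. \<forall>t. (deriv ^^ k) F differentiable (at t)" using F(2) by (simp add: C_real_def)
    from this[rule_format, of 0 t] have "F differentiable (at t)" using assms(2) by simp
    then show ?thesis by (simp add: DERIV_deriv_iff_real_differentiable)
  qed
  have eq: "circle_deriv f (circle_of t) = deriv F t" for t
    by (rule circle_deriv_eq[OF F(1) d])
  have "continuous_on UNIV (deriv F)"
  proof (cases "r = 1")
    case True then show ?thesis using F(2) by (simp add: C_real_def)
  next
    case False
    then have "1 < r" using assms by simp
    then have "deriv F differentiable (at t)" for t
      using F(2)[unfolded C_real_def, THEN conjunct1, rule_format, of 1 t] by simp
    then show ?thesis
      by (meson continuous_at_imp_continuous_on differentiable_imp_continuous_within)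
  qed
  with that F d eq show ?thesis by simp
qed

lemma C_circle_measurable:
  assumes "C_circle r f" "1 \<le> r" shows "f \<in> borel_measurable borel"
proof -
  obtain F where "is_lift F f" using assms by (auto simp: C_circle_def)
  then show ?thesis by (intro borel_measurable_continuous_onI is_lift_continuous)
qed

lemma circle_deriv_continuous:
  assumes "C_circle r f" "1 \<le> r" shows "continuous_on UNIV (circle_deriv f)"
proof -
  have "open (circle_deriv f -` U)" if "open U" for U
  proof -
    have "circle_of -` (circle_deriv f -` U) = (\<lambda>t. circle_deriv f (circle_of t)) -` U" by auto
    moreover have "open \<dots>"
      using C_circle_lift[OF assms] that by (auto intro!: open_vimage)
    ultimately show ?thesis by (simp add: open_circle_def)
  qed
  then show ?thesis by (simp add: continuous_on_open_vimage)
qed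

lemma circle_deriv_bounded:
  assumes "C_circle r f" "1 \<le> r" shows "\<exists>C. \<forall>x. \<bar>circle_deriv f x\<bar> \<le> C"
proof -
  have "continuous_on {0..1} (\<lambda>t. circle_deriv f (circle_of t))"
    using C_circle_lift[OF assms] by (meson continuous_on_subset subset_UNIV)
  then have "bounded ((\<lambda>t. circle_deriv f (circle_of t)) ` {0..1})"
    by (intro compact_imp_bounded compact_continuous_image) auto
  then obtain C where C: "\<And>t. t \<in> {0..1} \<Longrightarrow> \<bar>circle_deriv f (circle_of t)\<bar> \<le> C"
    unfolding bounded_iff by (metis imageI real_norm_def)
  have "\<bar>circle_deriv f x\<bar> \<le> C" for x
  proof -
    obtain t where "x = circle_of t" using circle_of_surj by metis
    then have "x = circle_of (frac t)" by (simp add: circle_of_eq_iff frac_def)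
    then show ?thesis using C[of "frac t"] frac_lt_1[of t] by (simp add: less_imp_le)
  qed
  then show ?thesis by blast
qed

lemma random_comp_lift:
  assumes f: "\<And>i. i \<in> I \<Longrightarrow> C_circle r (f i)" and "1 \<le> r" and \<omega>: "\<And>k. \<omega> k \<in> I"
  shows "\<exists>F. is_lift F (random_comp f \<omega> n) \<and> (\<forall>t. (F has_real_derivative
    (\<Prod>k<n. circle_deriv (f (\<omega> k)) (random_comp f \<omega> k (circle_of t)))) (at t))"
proof (induction n)
  case 0
  have "((id::real\<Rightarrow>real) has_real_derivative 1) (at t)" for t
    by (simp add: id_def)
  then show ?case using is_lift_id by (intro exI[of _ id]) (simp add: id_def)
next
  case (Suc n)
  then obtain G where G: "is_lift G (random_comp f \<omega> n)" "\<And>t. (G has_real_derivative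
    (\<Prod>k<n. circle_deriv (f (\<omega> k)) (random_comp f \<omega> k (circle_of t)))) (at t)" by blast
  obtain F where F: "is_lift F (f (\<omega> n))" 
      "\<And>t. (F has_real_derivative circle_deriv (f (\<omega> n)) (circle_of t)) (at t)"
    using C_circle_lift[OF f[OF \<omega>] \<open>1 \<le> r\<close>] by blast
  have "((F \<circ> G) has_real_derivative (circle_deriv (f (\<omega> n)) (circle_of (G t)) *
      (\<Prod>k<n. circle_deriv (f (\<omega> k)) (random_comp f \<omega> k (circle_of t))))) (at t)" for t
    by (rule DERIV_chain[OF F(2) G(2)])
  moreover have "circle_of (G t) = random_comp f \<omega> n (circle_of t)" for t
    using G(1) by (simp add: is_lift_def)
  ultimately show ?case using is_lift_comp[OF F(1) G(1)]
    by (intro exI[of _ "F \<circ> G"]) (simp add: mult.commute comp_def)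
qed

lemma random_comp_deriv:
  assumes "\<And>i. i \<in> I \<Longrightarrow> C_circle r (f i)" and "1 \<le> r" and "\<And>k. \<omega> k \<in> I"
  shows "circle_deriv (random_comp f \<omega> n) x
    = (\<Prod>k<n. circle_deriv (f (\<omega> k)) (random_comp f \<omega> k x))"
proof -
  obtain t where t: "x = circle_of t" using circle_of_surj[of x] by auto
  show ?thesis
    using random_comp_lift[where f = f and \<omega> = \<omega> and n = n, OF assms] circle_deriv_eq
    unfolding t by blast
qed

lemma random_comp_shift:
  "random_comp f \<omega> (Suc n) x = random_comp f (\<omega> \<circ> Suc) n (f (\<omega> 0) x)"
  by (induction n) auto


section \<open>Almost sure limit and integral formula for the Lyapunov exponent\<close>

definition walk_shift :: "(nat \<Rightarrow> circle \<Rightarrow> circle) \<Rightarrow> (nat \<Rightarrow> nat) \<times> circle \<Rightarrow> (nat \<Rightarrow> nat) \<times> circle" where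
  "walk_shift f p = (\<lambda>n. fst p (Suc n), f (fst p 0) (snd p))"

lemma walk_shift_iterate:
  "(walk_shift f ^^ k) (\<omega>, x) = (\<lambda>n. \<omega> (n + k), random_comp f \<omega> k x)"
  by (induction k) (auto simp: walk_shift_def)

lemma walk_shift_invariant:
  assumes m: "1 \<le> m" and f: "\<And>i. i \<in> {1..m} \<Longrightarrow> f i \<in> borel_measurable borel"
    and st: "stationary m f \<mu>"
  shows "walk_shift f \<in> (iid_uniform m \<Otimes>\<^sub>M \<mu>) \<rightarrow>\<^sub>M (iid_uniform m \<Otimes>\<^sub>M \<mu>)" (is ?meas)
    and "distr (iid_uniform m \<Otimes>\<^sub>M \<mu>) (iid_uniform m \<Otimes>\<^sub>M \<mu>) (walk_shift f) = iid_uniform m \<Otimes>\<^sub>M \<mu>"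
proof -
  let ?N = "uniform_count_measure {1..m} :: nat measure"
  let ?S = "iid_uniform m"
  have setsmu [measurable_cong]: "sets \<mu> = sets borel" using st by (simp add: stationary_def)
  have spmu: "space \<mu> = UNIV" using sets_eq_imp_space_eq[OF setsmu] by simp
  interpret mu: prob_space \<mu> using st by (simp add: stationary_def)
  interpret N: prob_space ?N using m by (intro prob_space_uniform_count_measure) auto
  interpret Sq: sequence_space ?N by unfold_locales
  have S_def: "?S = PiM UNIV (\<lambda>_. ?N)" by (simp add: iid_uniform_def)
  interpret S: prob_space ?S unfolding S_def by (rule Sq.P.prob_space_axioms)
  have setsS [measurable_cong]: "sets ?S = sets (PiM UNIV (\<lambda>_. ?N))" by (simp add: S_def)
  have fs: "f s \<in> \<mu> \<rightarrow>\<^sub>M \<mu>" if "s \<in> {1..m}" for s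
    using f[OF that] by (simp cong: measurable_cong_sets add: setsmu)
  have fm [measurable]: "(\<lambda>p. f (fst p) (snd p)) \<in> ?N \<Otimes>\<^sub>M \<mu> \<rightarrow>\<^sub>M \<mu>"
  proof -
    have "(\<lambda>p. f (fst p) (snd p)) \<in> count_space {1..m} \<Otimes>\<^sub>M \<mu> \<rightarrow>\<^sub>M \<mu>"
      by (rule measurable_pair_measure_countable1) (auto simp: fs)
    moreover have "sets (?N \<Otimes>\<^sub>M \<mu>) = sets (count_space {1..m} \<Otimes>\<^sub>M \<mu>)"
      by (intro sets_pair_measure_cong sets_uniform_count_measure_count_space refl)
    ultimately show ?thesis by (simp cong: measurable_cong_sets)
  qed
  have [measurable]: "(\<lambda>\<omega>. \<omega> i) \<in> ?S \<rightarrow>\<^sub>M ?N" for i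
    unfolding S_def by (rule measurable_component_singleton) simp
  have sh [measurable]: "(\<lambda>\<omega> n. \<omega> (Suc n)) \<in> ?S \<rightarrow>\<^sub>M ?S"
    unfolding S_def by (rule measurable_PiM_single') (auto simp: space_PiM PiE_iff)
  have fc [measurable]: "(\<lambda>p. f (fst p 0) (snd p)) \<in> ?S \<Otimes>\<^sub>M \<mu> \<rightarrow>\<^sub>M \<mu>"
  proof -
    have "(\<lambda>p. (fst p 0, snd p)) \<in> ?S \<Otimes>\<^sub>M \<mu> \<rightarrow>\<^sub>M ?N \<Otimes>\<^sub>M \<mu>" by measurable
    from measurable_compose[OF this fm] show ?thesis by simp
  qed
  have T [measurable]: "walk_shift f \<in> ?S \<Otimes>\<^sub>M \<mu> \<rightarrow>\<^sub>M ?S \<Otimes>\<^sub>M \<mu>"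
    unfolding walk_shift_def by measurable
  then show ?meas .
  have avg: "(\<integral>\<^sup>+ s. emeasure \<mu> (f s -` B) \<partial>?N) = emeasure \<mu> B" if B: "B \<in> sets \<mu>" for B
  proof -
    have "(\<integral>\<^sup>+ s. emeasure \<mu> (f s -` B) \<partial>?N) = (\<Sum>s = 1..m. ennreal (1 / real m) * emeasure \<mu> (f s -` B))"
      unfolding uniform_count_measure_def by (subst nn_integral_point_measure_finite) auto
    also have "\<dots> = (\<Sum>s = 1..m. ennreal (1 / real m * measure \<mu> (f s -` B)))"
      unfolding mu.emeasure_eq_measure by (intro sum.cong refl ennreal_mult'[symmetric]) simp
    also have "\<dots> = ennreal (\<Sum>s = 1..m. 1 / real m * measure \<mu> (f s -` B))"
      by (intro sum_ennreal) auto
    also have "(\<Sum>s = 1..m. 1 / real m * measure \<mu> (f s -` B)) = measure \<mu> B"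
      using st B by (simp add: stationary_def setsmu sum_distrib_left)
    finally show ?thesis by (simp add: mu.emeasure_eq_measure)
  qed
  show "distr (?S \<Otimes>\<^sub>M \<mu>) (?S \<Otimes>\<^sub>M \<mu>) (walk_shift f) = ?S \<Otimes>\<^sub>M \<mu>"
  proof (rule pair_measure_eqI[symmetric])
    show "sigma_finite_measure ?S" "sigma_finite_measure \<mu>" by unfold_locales
    show "sets (?S \<Otimes>\<^sub>M \<mu>) = sets (distr (?S \<Otimes>\<^sub>M \<mu>) (?S \<Otimes>\<^sub>M \<mu>) (walk_shift f))" by simp
    fix A B assume A [measurable]: "A \<in> sets ?S" and B [measurable]: "B \<in> sets \<mu>"
    define g where "g s = emeasure \<mu> (f s -` B)" for s
    have gm [measurable]: "g \<in> borel_measurable ?N" by (simp add: uniform_count_measure_def point_measure_def measurable_def space_PiM)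
    have "emeasure (distr (?S \<Otimes>\<^sub>M \<mu>) (?S \<Otimes>\<^sub>M \<mu>) (walk_shift f)) (A \<times> B)
        = emeasure (?S \<Otimes>\<^sub>M \<mu>) (walk_shift f -` (A \<times> B) \<inter> space (?S \<Otimes>\<^sub>M \<mu>))"
      by (intro emeasure_distr T) measurable
    also have "\<dots> = (\<integral>\<^sup>+ \<omega>. emeasure \<mu> (Pair \<omega> -` (walk_shift f -` (A \<times> B) \<inter> space (?S \<Otimes>\<^sub>M \<mu>))) \<partial>?S)"
      by (intro mu.emeasure_pair_measure_alt measurable_sets[OF T]) measurable
    also have "\<dots> = (\<integral>\<^sup>+ \<omega>. indicator A (\<lambda>n. \<omega> (Suc n)) * g (\<omega> 0) \<partial>?S)"
    proof (rule nn_integral_cong)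
      fix \<omega> assume "\<omega> \<in> space ?S"
      then have "Pair \<omega> -` (walk_shift f -` (A \<times> B) \<inter> space (?S \<Otimes>\<^sub>M \<mu>))
          = (if (\<lambda>n. \<omega> (Suc n)) \<in> A then f (\<omega> 0) -` B else {})"
        by (auto simp: walk_shift_def space_pair_measure spmu)
      then show "emeasure \<mu> (Pair \<omega> -` (walk_shift f -` (A \<times> B) \<inter> space (?S \<Otimes>\<^sub>M \<mu>)))
          = indicator A (\<lambda>n. \<omega> (Suc n)) * g (\<omega> 0)"
        by (auto simp: g_def)
    qed
    also have "\<dots> = (\<integral>\<^sup>+ \<omega>. indicator A (\<lambda>n. \<omega> (Suc n)) * g (\<omega> 0)
          \<partial>distr (?N \<Otimes>\<^sub>M ?S) ?S (\<lambda>(s, \<omega>). case_nat s \<omega>))"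
      using Sq.PiM_iter unfolding S_def by simp
    also have "\<dots> = (\<integral>\<^sup>+ p. indicator A (snd p) * g (fst p) \<partial>(?N \<Otimes>\<^sub>M ?S))"
    proof -
      have a: "(\<lambda>(s, \<omega>). case_nat s \<omega>) \<in> ?N \<Otimes>\<^sub>M ?S \<rightarrow>\<^sub>M ?S"
        unfolding S_def by measurable
      have b: "(\<lambda>\<omega>. indicator A (\<lambda>n. \<omega> (Suc n)) * g (\<omega> 0))
          \<in> borel_measurable (distr (?N \<Otimes>\<^sub>M ?S) ?S (\<lambda>(s, \<omega>). case_nat s \<omega>))"
        by measurable
      show ?thesis unfolding nn_integral_distr[OF a b] by (simp add: split_beta)
    qed
    also have "\<dots> = (\<integral>\<^sup>+ s. \<integral>\<^sup>+ \<omega>. indicator A \<omega> * g s \<partial>?S \<partial>?N)"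
    proof -
      have "(\<lambda>p. indicator A (snd p) * g (fst p)) \<in> borel_measurable (?N \<Otimes>\<^sub>M ?S)" by measurable
      from S.nn_integral_fst[OF this] show ?thesis by (simp only: fst_conv snd_conv)
    qed
    also have "\<dots> = (\<integral>\<^sup>+ s. emeasure ?S A * g s \<partial>?N)"
      by (intro nn_integral_cong) (simp add: nn_integral_multc[OF borel_measurable_indicator[OF A]] A)
    also have "\<dots> = emeasure ?S A * (\<integral>\<^sup>+ s. g s \<partial>?N)"
      by (rule nn_integral_cmult) measurable
    also have "\<dots> = emeasure ?S A * emeasure \<mu> B"
      unfolding g_def using avg[OF B] by simp
    finally show "emeasure ?S A * emeasure \<mu> B
      = emeasure (distr (?S \<Otimes>\<^sub>M \<mu>) (?S \<Otimes>\<^sub>M \<mu>) (walk_shift f)) (A \<times> B)" by simp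
  qed
qed

lemma lyapunov_limit_imp_eq:
  assumes m: "1 \<le> m" and r: "1 \<le> r"
    and f: "\<And>i. i \<in> {1..m} \<Longrightarrow> C_circle r (f i)" and e: "\<And>i. i \<in> {1..m} \<Longrightarrow> expanding (f i)"
    and st: "stationary m f \<mu>" and lim: "lyapunov_limit m f \<mu> l"
  shows "l = lyapunov_exponent m f \<mu>"
proof -
  let ?N = "uniform_count_measure {1..m} :: nat measure"
  let ?S = "iid_uniform m"
  let ?P = "?S \<Otimes>\<^sub>M \<mu>"
  let ?T = "walk_shift f"
  have setsmu [measurable_cong]: "sets \<mu> = sets borel" using st by (simp add: stationary_def)
  interpret mu: prob_space \<mu> using st by (simp add: stationary_def)
  interpret N: prob_space ?N using m by (intro prob_space_uniform_count_measure) auto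
  interpret Sq: sequence_space ?N by unfold_locales
  have S_def: "?S = PiM UNIV (\<lambda>_. ?N)" by (simp add: iid_uniform_def)
  interpret S: prob_space ?S unfolding S_def by (rule Sq.P.prob_space_axioms)
  interpret P: pair_prob_space ?S \<mu> by unfold_locales
  have T [measurable]: "?T \<in> ?P \<rightarrow>\<^sub>M ?P" and inv: "distr ?P ?P ?T = ?P"
    using walk_shift_invariant[OF m C_circle_measurable[OF f r] st] by auto
  define h where "h s x = ln \<bar>circle_deriv (f s) x\<bar>" for s x
  define \<phi> where "\<phi> p = h (fst p 0) (snd p)" for p :: "(nat \<Rightarrow> nat) \<times> circle"
  have hs: "h s \<in> borel_measurable borel" if "s \<in> {1..m}" for s
  proof -
    have [measurable]: "circle_deriv (f s) \<in> borel_measurable borel"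
      by (rule borel_measurable_continuous_onI[OF circle_deriv_continuous[OF f[OF that] r]])
    show ?thesis unfolding h_def by measurable
  qed
  have hm: "(\<lambda>p. h (fst p) (snd p)) \<in> borel_measurable (?N \<Otimes>\<^sub>M \<mu>)"
  proof -
    have "(\<lambda>p. h (fst p) (snd p)) \<in> borel_measurable (count_space {1..m} \<Otimes>\<^sub>M \<mu>)"
    proof (rule measurable_pair_measure_countable1)
      fix s assume "s \<in> {1..m}"
      then show "(\<lambda>y. h (fst (s, y)) (snd (s, y))) \<in> borel_measurable \<mu>"
        using hs[of s] by (simp cong: measurable_cong_sets add: setsmu)
    qed simp
    moreover have "sets (?N \<Otimes>\<^sub>M \<mu>) = sets (count_space {1..m} \<Otimes>\<^sub>M \<mu>)"
      by (intro sets_pair_measure_cong sets_uniform_count_measure_count_space refl)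
    ultimately show ?thesis by (simp cong: measurable_cong_sets)
  qed
  have [measurable]: "(\<lambda>\<omega>. \<omega> i) \<in> ?S \<rightarrow>\<^sub>M ?N" for i
    unfolding S_def by (rule measurable_component_singleton) simp
  have \<phi> [measurable]: "\<phi> \<in> borel_measurable ?P"
  proof -
    have "(\<lambda>p. (fst p 0, snd p)) \<in> ?P \<rightarrow>\<^sub>M ?N \<Otimes>\<^sub>M \<mu>" by measurable
    from measurable_compose[OF this hm] show ?thesis by (simp add: \<phi>_def[abs_def])
  qed
  obtain C where C: "\<And>s x. s \<in> {1..m} \<Longrightarrow> \<bar>h s x\<bar> \<le> C"
  proof -
    have "\<exists>c. \<forall>x. \<bar>h s x\<bar> \<le> c" if s: "s \<in> {1..m}" for s
    proof -
      obtain c where c: "\<And>x. \<bar>circle_deriv (f s) x\<bar> \<le> c"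
        using circle_deriv_bounded[OF f[OF s] r] by blast
      have "\<bar>h s x\<bar> \<le> ln c" for x
        using c[of x] e[OF s] unfolding h_def expanding_def
        by (smt (verit) ln_ge_zero ln_le_cancel_iff)
      then show ?thesis by blast
    qed
    then obtain c where c: "\<And>s x. s \<in> {1..m} \<Longrightarrow> \<bar>h s x\<bar> \<le> c s" by metis
    have "\<bar>h s x\<bar> \<le> (\<Sum>s = 1..m. \<bar>c s\<bar>)" if s: "s \<in> {1..m}" for s x
    proof -
      have "\<bar>c s\<bar> \<le> (\<Sum>s = 1..m. \<bar>c s\<bar>)" using s by (intro member_le_sum) auto
      then show ?thesis using c[OF s, of x] by linarith
    qed
    then show ?thesis using that by blast
  qed
  have sp: "\<omega> k \<in> {1..m}" if "\<omega> \<in> space ?S" for \<omega> k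
  proof -
    have "\<omega> k \<in> space ?N" using that unfolding S_def by (simp add: space_PiM PiE_iff)
    also have "space ?N = {1..m}" by (rule space_uniform_count_measure)
    finally show ?thesis .
  qed
  have \<phi>C: "\<bar>\<phi> p\<bar> \<le> C" if "p \<in> space ?P" for p
    using that C[OF sp] by (auto simp: \<phi>_def space_pair_measure)
  have Tk [measurable]: "?T ^^ k \<in> ?P \<rightarrow>\<^sub>M ?P" for k
  proof (induction k)
    case (Suc k)
    then show ?case using measurable_comp[OF Suc T] by simp
  qed (simp add: id_def)
  have Tsp: "(?T ^^ k) p \<in> space ?P" if "p \<in> space ?P" for k p
    using measurable_space[OF Tk that] .
  have int: "integrable ?P (\<lambda>p. \<phi> ((?T ^^ k) p))" for k
    by (rule P.integrable_const_bound[of _ C]) (use \<phi>C Tsp in \<open>auto intro!: AE_I2\<close>)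
  have Ik: "(\<integral>p. \<phi> ((?T ^^ k) p) \<partial>?P) = (\<integral>p. \<phi> p \<partial>?P)" for k
  proof (induction k)
    case (Suc k)
    have "(\<integral>p. \<phi> ((?T ^^ k) p) \<partial>?P) = (\<integral>p. \<phi> ((?T ^^ k) p) \<partial>distr ?P ?P ?T)"
      by (simp add: inv)
    also have "\<dots> = (\<integral>p. \<phi> ((?T ^^ k) (?T p)) \<partial>?P)"
      by (rule integral_distr) measurable
    finally show ?case using Suc by (simp add: funpow_swap1)
  qed simp
  define \<psi> where "\<psi> n p = (\<Sum>k<n. \<phi> ((?T ^^ k) p)) / real n" for n p
  have \<psi>eq: "ln \<bar>circle_deriv (random_comp f \<omega> n) x\<bar> / real n = \<psi> n (\<omega>, x)"
    if "\<omega> \<in> space ?S" for \<omega> x n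
  proof -
    have nz: "\<bar>circle_deriv (f (\<omega> k)) y\<bar> > 1" for k y
      using e[OF sp[OF that]] by (simp add: expanding_def)
    have "\<bar>circle_deriv (random_comp f \<omega> n) x\<bar>
        = (\<Prod>k<n. \<bar>circle_deriv (f (\<omega> k)) (random_comp f \<omega> k x)\<bar>)"
      by (subst random_comp_deriv[of "{1..m}", OF f r sp[OF that]]) (auto simp: abs_prod)
    also have "ln \<dots> = (\<Sum>k<n. ln \<bar>circle_deriv (f (\<omega> k)) (random_comp f \<omega> k x)\<bar>)"
    proof (rule ln_prod)
      fix k
      show "\<bar>circle_deriv (f (\<omega> k)) (random_comp f \<omega> k x)\<bar> \<noteq> 0"
        using nz[of k "random_comp f \<omega> k x"] by linarith
    qed simp
    finally show ?thesis by (simp add: \<psi>_def walk_shift_iterate \<phi>_def h_def)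
  qed
  have conv: "AE p in ?P. (\<lambda>n. \<psi> n p) \<longlonglongrightarrow> l"
    using lim unfolding lyapunov_limit_def
  proof (rule AE_mp, intro AE_I2 impI)
    fix p assume "p \<in> space ?P" and
      "case p of (\<omega>, x) \<Rightarrow> (\<lambda>n. ln \<bar>circle_deriv (random_comp f \<omega> n) x\<bar> / real n) \<longlonglongrightarrow> l"
    then show "(\<lambda>n. \<psi> n p) \<longlonglongrightarrow> l" by (cases p) (simp add: \<psi>eq space_pair_measure)
  qed
  have "(\<lambda>n. \<integral>p. \<psi> n p \<partial>?P) \<longlonglongrightarrow> (\<integral>p. l \<partial>?P)"
  proof (rule integral_dominated_convergence[where w = "\<lambda>_. \<bar>C\<bar>"])
    show "AE p in ?P. norm (\<psi> n p) \<le> \<bar>C\<bar>" for n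
    proof (rule AE_I2)
      fix p assume p: "p \<in> space ?P"
      have "\<bar>\<Sum>k<n. \<phi> ((?T ^^ k) p)\<bar> \<le> (\<Sum>k<n. \<bar>\<phi> ((?T ^^ k) p)\<bar>)" by (rule sum_abs)
      also have "\<dots> \<le> (\<Sum>k<n. \<bar>C\<bar>)"
        using \<phi>C[OF Tsp[OF p]] by (intro sum_mono) (meson abs_ge_self order_trans)
      finally show "norm (\<psi> n p) \<le> \<bar>C\<bar>"
        by (cases "n = 0") (auto simp: \<psi>_def field_simps)
    qed
  next
    show "AE p in ?P. (\<lambda>n. \<psi> n p) \<longlonglongrightarrow> l" by (rule conv)
    show "\<psi> n \<in> borel_measurable ?P" for n
      unfolding \<psi>_def[abs_def] by measurable
  qed simp_all
  moreover have "(\<integral>p. \<psi> n p \<partial>?P) = (\<integral>p. \<phi> p \<partial>?P)" if "n \<ge> 1" for n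
  proof -
    have "(\<integral>p. \<psi> n p \<partial>?P) = (\<integral>p. (\<Sum>k<n. \<phi> ((?T ^^ k) p)) \<partial>?P) / real n"
      unfolding \<psi>_def by simp
    also have "(\<integral>p. (\<Sum>k<n. \<phi> ((?T ^^ k) p)) \<partial>?P) = (\<Sum>k<n. (\<integral>p. \<phi> ((?T ^^ k) p) \<partial>?P))"
      by (rule Bochner_Integration.integral_sum) (rule int)
    also have "\<dots> = (\<Sum>k<n. (\<integral>p. \<phi> p \<partial>?P))" by (rule sum.cong[OF refl Ik])
    finally show ?thesis using that by simp
  qed
  then have "(\<lambda>n. \<integral>p. \<psi> n p \<partial>?P) \<longlonglongrightarrow> (\<integral>p. \<phi> p \<partial>?P)"
    by (intro tendsto_eventually eventually_sequentiallyI[of 1])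
  ultimately have "l = (\<integral>p. \<phi> p \<partial>?P)"
    using LIMSEQ_unique[of "\<lambda>n. \<integral>p. \<psi> n p \<partial>?P" "\<integral>p. l \<partial>?P" "\<integral>p. \<phi> p \<partial>?P"]
    by (simp add: P.prob_space)
  also have "\<dots> = (\<integral>\<omega>. \<integral>x. \<phi> (\<omega>, x) \<partial>\<mu> \<partial>?S)"
    using int[of 0] by (intro P.integral_fst'[symmetric]) simp
  also have "\<dots> = (\<integral>\<omega>. (\<lambda>s. \<integral>x. h s x \<partial>\<mu>) (\<omega> 0) \<partial>?S)"
    by (simp add: \<phi>_def)
  also have "\<dots> = (\<integral>s. (\<integral>x. h s x \<partial>\<mu>) \<partial>distr ?S ?N (\<lambda>\<omega>. \<omega> 0))"
  proof (rule integral_distr[symmetric])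
    show "(\<lambda>\<omega>. \<omega> 0) \<in> ?S \<rightarrow>\<^sub>M ?N" by measurable
    show "(\<lambda>s. \<integral>x. h s x \<partial>\<mu>) \<in> borel_measurable ?N"
      by (simp add: uniform_count_measure_def point_measure_def measurable_def)
  qed
  also have "distr ?S ?N (\<lambda>\<omega>. \<omega> 0) = ?N"
    unfolding S_def by (rule Sq.PiM_component) simp
  also have "(\<integral>s. (\<integral>x. h s x \<partial>\<mu>) \<partial>?N) = lyapunov_exponent m f \<mu>"
    by (simp add: integral_uniform_count_measure lyapunov_exponent_def h_def)
  finally show ?thesis .
qed

end

theory Submission
  imports Defs "HOL-Complex_Analysis.Great_Picard"
begin

text \<open>Write \<open>\<mu> = \<phi> dt\<close> and let \<open>F\<^sub>i\<close> be a lift of \<open>f\<^sub>i\<close>. If \<open>\<phi>\<close> is continuous and positive, put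
  \<open>w\<^sub>i = F\<^sub>i' (\<phi> \<circ> F\<^sub>i) / (d\<^sub>i \<phi>)\<close>, so that
  \<open>ln F\<^sub>i' = ln d\<^sub>i + ln \<phi> - ln \<phi> \<circ> F\<^sub>i + ln w\<^sub>i\<close>. Averaged over \<open>i\<close> and integrated against \<open>\<mu>\<close>, the
  coboundary \<open>ln \<phi> - ln \<phi> \<circ> F\<^sub>i\<close> vanishes because \<open>\<mu>\<close> is stationary. Moreover \<open>\<integral> w\<^sub>i d\<mu> = 1\<close>, because
  \<open>F\<^sub>i\<close> wraps the circle \<open>d\<^sub>i\<close> times around itself. Hence \<open>ln w \<le> w - 1\<close> gives the inequality, and equality
  means \<open>w\<^sub>i = 1\<close>, that is \<open>d\<^sub>i \<phi> = F\<^sub>i' (\<phi> \<circ> F\<^sub>i)\<close>, for all \<open>i\<close> (\<open>exponent_formula\<close>, \<open>exponent_eq_imp\<close>).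
  In that case the primitive \<open>H\<close> of \<open>\<phi>\<close> satisfies \<open>H \<circ> F\<^sub>i = d\<^sub>i H + c\<^sub>i\<close> and is a lift of the conjugacy
  (\<open>conjugacy_of_equality\<close>). Conversely, a conjugacy with lift \<open>H\<close> makes \<open>ln F\<^sub>i' - ln d\<^sub>i\<close> the coboundary of
  \<open>ln \<bar>H'\<bar>\<close> (\<open>equality_of_conjugacy\<close>).\<close>

text \<open>Two facts remain. The first is that an absolutely continuous stationary measure has a positive
  continuous density (\<open>stationary_density\<close>). Approximate the Radon-Nikodym density in mean by positive
  Lipschitz functions and push these forward with the averaged transfer operator. The distance in
  total variation to \<open>\<mu>\<close> does not grow, whereas expansion and bounded distortion push the Lipschitz
  constants of the logarithms below a universal bound. By the Arzela-Ascoli theorem the densities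
  so obtained have a uniform limit, which is positive and represents \<open>\<mu>\<close>.\<close>

text \<open>The second is that \<open>\<phi>\<close> is of class \<open>C\<^bsup>r-1\<^esup>\<close> in the case of equality (\<open>density_regularity\<close>). Here
  \<open>w = ln \<phi>\<close> solves an equation \<open>w = A (w \<circ> g) + B\<close> with \<open>A = 1\<close>, in which \<open>g\<close> is the inverse of a single
  lift. Differentiating it produces the contracting factor \<open>g'\<close>, so that the derivative exists as the
  solution of a fixed point equation. In the coordinate \<open>H\<close> the map \<open>g\<close> is affine, hence the
  derivative of \<open>w\<close> with respect to \<open>H\<close> solves an equation of the same form with \<open>A / d\<close> instead of \<open>A\<close>,
  and the argument can be repeated until the differentiability of \<open>B\<close> is used up.\<close>

section \<open>Continuous periodic functions\<close>

definition cts_periodic :: "(real \<Rightarrow> real) \<Rightarrow> bool" where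
  "cts_periodic v \<longleftrightarrow> continuous_on UNIV v \<and> (\<forall>t. v (t + 1) = v t)"

lemma cts_periodicI: "continuous_on UNIV v \<Longrightarrow> (\<And>t. v (t + 1) = v t) \<Longrightarrow> cts_periodic v"
  by (simp add: cts_periodic_def)

lemma cts_periodic_continuous: "cts_periodic v \<Longrightarrow> continuous_on A v"
  unfolding cts_periodic_def by (meson continuous_on_subset subset_UNIV)

lemma periodic_add_int:
  fixes v :: "real \<Rightarrow> 'a"
  assumes "\<And>t. v (t + 1) = v t"
  shows "v (t + of_int k) = v t"
proof (induction k rule: int_induct[where k = 0])
  case (step1 i)
  then show ?case using assms[of "t + of_int i"] by (simp add: add.assoc)
next
  case (step2 i)
  then show ?case using assms[of "t + of_int (i - 1)"] by (simp add: algebra_simps)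
qed simp

lemma cts_periodic_add_int: "cts_periodic v \<Longrightarrow> v (t + of_int k) = v t"
  unfolding cts_periodic_def by (blast intro: periodic_add_int)

lemma cts_periodic_frac: "cts_periodic v \<Longrightarrow> v (frac t) = v t"
  using cts_periodic_add_int[of v "frac t" "\<lfloor>t\<rfloor>"] by (simp add: frac_def)

lemma continuous_periodic_bounded:
  fixes v :: "real \<Rightarrow> real"
  assumes cont: "continuous_on UNIV v" and "p > 0" and per: "\<And>t. v (t + p) = v t"
  shows "\<exists>B. \<forall>t. \<bar>v t\<bar> \<le> B"
proof -
  \<comment> \<open>Rescale to period one, so that \<open>frac\<close> moves every point into \<open>{0..1}\<close>.\<close>
  have cont': "continuous_on UNIV (\<lambda>s. v (p * s))"
    by (intro continuous_on_compose2[OF cont] continuous_intros) auto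
  have per': "v (p * (s + 1)) = v (p * s)" for s using per[of "p * s"] by (simp add: algebra_simps)
  have "bounded ((\<lambda>s. v (p * s)) ` {0..1})"
    using cont' by (intro compact_imp_bounded compact_continuous_image) (auto intro: continuous_on_subset)
  then obtain B where B: "\<And>s. s \<in> {0..1} \<Longrightarrow> \<bar>v (p * s)\<bar> \<le> B"
    unfolding bounded_iff by (metis imageI real_norm_def)
  have "\<bar>v t\<bar> \<le> B" for t
  proof -
    have "v (p * (frac (t / p) + of_int \<lfloor>t / p\<rfloor>)) = v (p * frac (t / p))"
      by (rule periodic_add_int[of "\<lambda>s. v (p * s)"]) (rule per')
    moreover have "p * (frac (t / p) + of_int \<lfloor>t / p\<rfloor>) = t" using \<open>p > 0\<close> by (simp add: frac_def)
    ultimately show ?thesis using B[of "frac (t / p)"] frac_lt_1[of "t / p"] by (simp add: less_imp_le)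
  qed
  then show ?thesis by blast
qed

lemma cts_periodic_bounded: "cts_periodic v \<Longrightarrow> \<exists>B. \<forall>t. \<bar>v t\<bar> \<le> B"
  using continuous_periodic_bounded[of v 1] by (auto simp: cts_periodic_def)

lemma cts_periodic_positive_lower_bound:
  assumes v: "cts_periodic v" and pos: "\<And>t. v t > 0"
  shows "\<exists>b>0. \<forall>t. b \<le> v t"
proof -
  have "continuous_on UNIV (\<lambda>t. 1 / v t)" "\<And>t. 1 / v (t + 1) = 1 / v t"
    using v pos unfolding cts_periodic_def
    by (auto intro!: continuous_intros simp: less_imp_neq[THEN not_sym])
  then obtain B where B: "\<And>t. \<bar>1 / v t\<bar> \<le> B" using continuous_periodic_bounded[of "\<lambda>t. 1 / v t" 1] by auto
  have "0 < \<bar>1 / v 0\<bar>" using pos[of 0] by simp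
  then have "B > 0" using B[of 0] by linarith
  moreover have "1 / B \<le> v t" for t
    using B[of t] pos[of t] \<open>B > 0\<close> by (simp add: field_simps)
  ultimately show ?thesis by (intro exI[of _ "1 / B"]) auto
qed

lemma cts_periodic_const: "cts_periodic (\<lambda>_. c)"
  by (simp add: cts_periodic_def)

lemma cts_periodic_mult: "cts_periodic u \<Longrightarrow> cts_periodic v \<Longrightarrow> cts_periodic (\<lambda>t. u t * v t)"
  by (auto simp: cts_periodic_def intro: continuous_intros)

lemma cts_periodic_diff: "cts_periodic u \<Longrightarrow> cts_periodic v \<Longrightarrow> cts_periodic (\<lambda>t. u t - v t)"
  by (auto simp: cts_periodic_def intro: continuous_intros)

lemma cts_periodic_divide:
  assumes "cts_periodic u" "cts_periodic v" "\<And>t. v t \<noteq> 0"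
  shows "cts_periodic (\<lambda>t. u t / v t)"
  using assms by (auto simp: cts_periodic_def intro!: continuous_intros)

lemma cts_periodic_ln:
  assumes "cts_periodic u" "\<And>t. u t > 0"
  shows "cts_periodic (\<lambda>t. ln (u t))"
  using assms by (auto simp: cts_periodic_def intro!: continuous_intros) (metis less_irrefl)

text \<open>Integrals over intervals are computed from an antiderivative on the whole line, so that
  periodicity and substitution become statements about increments of that antiderivative.\<close>

lemma continuous_antiderivative:
  fixes v :: "real \<Rightarrow> real"
  assumes "continuous_on UNIV v"
  obtains V where "\<And>x. (V has_real_derivative v x) (at x)"
proof -
  have "\<exists>F. \<forall>x::real. -\<infinity> < ereal x \<longrightarrow> ereal x < \<infinity> \<longrightarrow> (F has_vector_derivative v x) (at x)"
    using assms by (intro einterval_antiderivative) (auto simp: continuous_on_eq_continuous_at)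
  then show ?thesis using that by (auto simp: has_real_derivative_iff_has_vector_derivative)
qed

lemma integral_antiderivative:
  fixes v :: "real \<Rightarrow> real"
  assumes "\<And>x. (V has_real_derivative v x) (at x)" "a \<le> b"
  shows "integral {a..b} v = V b - V a"
proof -
  have "(v has_integral (V b - V a)) {a..b}"
    using assms by (intro fundamental_theorem_of_calculus)
      (auto simp: has_real_derivative_iff_has_vector_derivative[symmetric] intro: DERIV_subset)
  then show ?thesis by (rule integral_unique)
qed

lemma integrable_cts_periodic: "cts_periodic v \<Longrightarrow> v integrable_on {a..b}"
  by (intro integrable_continuous_real cts_periodic_continuous)

lemma constant_if_derivative_zero:
  fixes E :: "real \<Rightarrow> real"
  assumes "\<And>x. (E has_real_derivative 0) (at x)"
  shows "E x = E y"
  using DERIV_isconst_all[of E x y] assms by blast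

lemma integral_period:
  assumes v: "cts_periodic v"
  shows "integral {a..a+1} v = integral {0..1} v"
proof -
  obtain V where V: "\<And>x. (V has_real_derivative v x) (at x)"
    using continuous_antiderivative cts_periodic_continuous[OF v] by blast
  have "((\<lambda>x. V (x + 1) - V x) has_real_derivative 0) (at x)" for x
  proof -
    have "((\<lambda>x. V (x + 1)) has_real_derivative v (x + 1)) (at x)"
      using V[of "x + 1"] by (simp add: DERIV_shift)
    then have "((\<lambda>x. V (x + 1) - V x) has_real_derivative v (x + 1) - v x) (at x)"
      by (intro DERIV_diff V)
    then show ?thesis using v by (simp add: cts_periodic_def)
  qed
  from constant_if_derivative_zero[OF this, of a 0] show ?thesis
    using integral_antiderivative[OF V, of a "a + 1"] integral_antiderivative[OF V, of 0 1] by simp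
qed

lemma integral_periods:
  assumes v: "cts_periodic v"
  shows "integral {a..a + real n} v = real n * integral {0..1} v"
proof -
  obtain V where V: "\<And>x. (V has_real_derivative v x) (at x)"
    using continuous_antiderivative cts_periodic_continuous[OF v] by blast
  have "V (a + real n) - V a = real n * integral {0..1} v"
  proof (induction n)
    case (Suc n)
    have "V (a + real n + 1) - V (a + real n) = integral {0..1} v"
      using integral_antiderivative[OF V, of "a + real n" "a + real n + 1"] integral_period[OF v, of "a + real n"]
      by simp
    with Suc show ?case by (simp add: algebra_simps)
  qed simp
  then show ?thesis using integral_antiderivative[OF V, of a "a + real n"] by simp
qed

lemma integral_nonneg_eq_0:
  fixes v :: "real \<Rightarrow> real"
  assumes v: "cts_periodic v" and nn: "\<And>t. v t \<ge> 0" and int: "integral {0..1} v = 0"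
  shows "v t = 0"
proof -
  have "\<forall>x\<in>{0..1}. v x = 0"
    using integral_eq_0_iff[of 0 1 v] nn int cts_periodic_continuous[OF v] by simp
  then have "v (frac t) = 0" using frac_lt_1[of t] by (auto simp: less_imp_le)
  then show ?thesis using cts_periodic_frac[OF v] by simp
qed

text \<open>The constant comes from \<open>1 + x \<le> exp x\<close>. Bounds of this multiplicative form pass to sums of
  positive functions with the same constant.\<close>

lemma lipschitz_imp_log_lipschitz:
  fixes \<psi> :: "real \<Rightarrow> real"
  assumes b: "b > 0" "\<And>t. b \<le> \<psi> t" and lip: "\<bar>\<psi> s - \<psi> t\<bar> \<le> C * \<bar>s - t\<bar>" and C: "0 \<le> C"
  shows "\<psi> s \<le> exp (C / b * \<bar>s - t\<bar>) * \<psi> t"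
proof -
  have "\<psi> s \<le> \<psi> t + C * \<bar>s - t\<bar>" using lip by linarith
  also have "C * \<bar>s - t\<bar> = C / b * \<bar>s - t\<bar> * b" using b by simp
  also have "\<dots> \<le> C / b * \<bar>s - t\<bar> * \<psi> t" using b C by (intro mult_left_mono) auto
  also have "\<psi> t + C / b * \<bar>s - t\<bar> * \<psi> t = (1 + C / b * \<bar>s - t\<bar>) * \<psi> t" by (simp add: algebra_simps)
  also have "\<dots> \<le> exp (C / b * \<bar>s - t\<bar>) * \<psi> t"
    using b(1) b(2)[of t] by (intro mult_right_mono exp_ge_add_one_self) auto
  finally show ?thesis by simp
qed

section \<open>Lifts of increasing circle maps\<close>

text \<open>Lifts of orientation preserving local diffeomorphisms of degree \<open>d\<close>. Besides the lifts of the
  given maps, the primitive of a positive density is an instance with \<open>d = 1\<close>.\<close>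

locale increasing_lift =
  fixes F F' :: "real \<Rightarrow> real" and d :: nat
  assumes deriv: "\<And>t. (F has_real_derivative F' t) (at t)"
    and cont_deriv: "continuous_on UNIV F'"
    and deriv_pos: "\<And>t. 0 < F' t"
    and degree: "\<And>t. F (t + 1) = F t + real d"
    and degree_pos: "0 < d"
begin

lemma deriv_periodic: "F' (t + 1) = F' t"
proof -
  have "((\<lambda>t. F (t + 1)) has_real_derivative F' (t + 1)) (at t)"
    using deriv[of "t + 1"] by (simp add: DERIV_shift)
  moreover have "((\<lambda>t. F (t + 1)) has_real_derivative F' t) (at t)"
    unfolding degree using deriv[of t] by (auto intro!: derivative_eq_intros)
  ultimately show ?thesis by (rule DERIV_unique)
qed

lemma cts_periodic_deriv: "cts_periodic F'"
  using cont_deriv deriv_periodic by (rule cts_periodicI)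

lemma strict_mono: "strict_mono F"
  by (rule strict_monoI) (use DERIV_pos_imp_increasing deriv deriv_pos in blast)

lemma continuous_lift: "continuous_on A F"
  using deriv by (meson DERIV_isCont continuous_at_imp_continuous_on)

lemma lift_add_nat: "F (t + real k) = F t + real d * real k"
proof (induction k)
  case (Suc k)
  then show ?case using degree[of "t + real k"] by (simp add: algebra_simps)
qed simp

text \<open>Over \<open>k\<close> periods the lift rises by at least \<open>k\<close>, so the intermediate value theorem applies on
  \<open>{-k..k}\<close>.\<close>

lemma lift_surj: "\<exists>t. F t = y"
proof -
  obtain k :: nat where k: "\<bar>y - F 0\<bar> \<le> real k" using real_arch_simple by blast
  have "real k \<le> real d * real k" using degree_pos by (cases d) (auto simp: algebra_simps)
  then have "F (- real k) \<le> y" "y \<le> F (real k)"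
    using lift_add_nat[of "- real k" k] lift_add_nat[of 0 k] k by auto
  then show ?thesis using IVT'[of F "- real k" y "real k"] continuous_lift by auto
qed

lemma bij_lift: "bij F"
  using lift_surj strict_mono by (metis bijI strict_mono_imp_inj_on surjI surj_def)

abbreviation g :: "real \<Rightarrow> real" where "g \<equiv> inv F"

lemma F_g [simp]: "F (g y) = y"
  using bij_lift by (simp add: bij_is_surj surj_f_inv_f)

lemma g_F [simp]: "g (F t) = t"
  using bij_lift by (simp add: bij_is_inj)

lemma deriv_g: "(g has_real_derivative 1 / F' (g y)) (at y)"
proof -
  have "isCont g (F (g y))"
    by (rule isCont_inverse_function[of 1]) (use deriv DERIV_isCont in auto)
  then have "(g has_real_derivative inverse (F' (g y))) (at y)"
    by (intro DERIV_inverse_function[where f = F and a = "y - 1" and b = "y + 1"])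
       (use deriv[of "g y"] deriv_pos[of "g y"] in auto)
  then show ?thesis by (simp add: inverse_eq_divide)
qed

lemma continuous_g: "continuous_on A g"
  using deriv_g by (meson DERIV_isCont continuous_at_imp_continuous_on)

lemma g_add_degree: "g (y + real d) = g y + 1"
proof -
  have "g (F (g y + 1)) = g y + 1" by (rule g_F)
  then show ?thesis by (simp add: degree)
qed

lemma cts_periodic_comp_lift: "cts_periodic v \<Longrightarrow> cts_periodic (\<lambda>t. v (F t))"
proof (rule cts_periodicI)
  assume v: "cts_periodic v"
  show "continuous_on UNIV (\<lambda>t. v (F t))"
    by (rule continuous_on_compose2[OF cts_periodic_continuous[OF v, of UNIV] continuous_lift]) auto
  show "v (F (t + 1)) = v (F t)" for t
    using cts_periodic_add_int[OF v, of "F t" "int d"] by (simp add: degree)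
qed

lemma integral_comp_lift:
  assumes q: "continuous_on UNIV q" and "a \<le> b"
  shows "integral {a..b} (\<lambda>x. q (F x) * F' x) = integral {F a..F b} q"
proof -
  obtain Q where Q: "\<And>x. (Q has_real_derivative q x) (at x)"
    using continuous_antiderivative[OF q] by blast
  have "F a \<le> F b" using strict_mono \<open>a \<le> b\<close> by (simp add: strict_mono_less_eq)
  have "((\<lambda>x. Q (F x)) has_real_derivative q (F x) * F' x) (at x)" for x
    by (rule DERIV_chain2[OF Q deriv])
  from integral_antiderivative[OF this \<open>a \<le> b\<close>] integral_antiderivative[OF Q \<open>F a \<le> F b\<close>]
  show ?thesis by simp
qed

end

section \<open>Expanding lifts and their transfer operators\<close>

text \<open>The constant \<open>D\<close> bounds the distortion: it is a Lipschitz constant of \<open>ln \<circ> F'\<close>.\<close>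

locale expanding_lift = increasing_lift +
  fixes \<kappa> D :: real
  assumes lam: "0 < \<kappa>" "\<kappa> < 1"
    and expand: "\<And>t. 1 / \<kappa> \<le> F' t"
    and D_nonneg: "0 \<le> D"
    and distortion: "\<And>s t. F' s \<le> exp (D * \<bar>s - t\<bar>) * F' t"
begin

lemma deriv_g_bounds: "0 < 1 / F' t" "1 / F' t \<le> \<kappa>"
  using deriv_pos[of t] expand[of t] lam by (auto simp: field_simps)

lemma g_contraction: "\<bar>g x - g y\<bar> \<le> \<kappa> * \<bar>x - y\<bar>"
proof -
  have "norm (g x - g y) \<le> \<kappa> * norm (x - y)"
    by (rule field_differentiable_bound[of UNIV g "\<lambda>y. 1 / F' (g y)"])
       (use deriv_g deriv_g_bounds in \<open>auto simp: abs_of_pos\<close>)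
  then show ?thesis by simp
qed

text \<open>If \<open>\<psi>\<close> is the density of a measure on the circle, this is the density of its image under the
  circle map: the summands belong to the \<open>d\<close> inverse branches of that map.\<close>

definition transfer :: "(real \<Rightarrow> real) \<Rightarrow> real \<Rightarrow> real" where
  "transfer \<psi> x = (\<Sum>k<d. \<psi> (g (x + real k)) / F' (g (x + real k)))"

text \<open>A shift by one permutes the inverse branches cyclically; the branch pushed out at the upper end
  agrees with the first one because \<open>g (y + d) = g y + 1\<close>.\<close>

lemma transfer_cts_periodic:
  assumes \<psi>: "cts_periodic \<psi>"
  shows "cts_periodic (transfer \<psi>)"
proof (rule cts_periodicI)
  have "continuous_on UNIV (\<lambda>x. \<psi> (g (x + real k)) / F' (g (x + real k)))" for k
    using deriv_pos
    by (intro continuous_on_divide continuous_on_compose2[OF cts_periodic_continuous[OF \<psi>, of UNIV]]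
      continuous_on_compose2[OF cont_deriv] continuous_on_compose2[OF continuous_g[of UNIV]]
      continuous_intros) (auto simp: less_imp_neq[THEN not_sym])
  then show "continuous_on UNIV (transfer \<psi>)"
    unfolding transfer_def by (rule continuous_on_sum)
next
  fix x
  define q where "q k = \<psi> (g (x + real k)) / F' (g (x + real k))" for k
  have "q d = q 0"
    using \<psi> by (simp add: q_def g_add_degree deriv_periodic cts_periodic_def)
  have "transfer \<psi> (x + 1) = (\<Sum>k<d. q (Suc k))"
    by (simp add: transfer_def q_def algebra_simps)
  also have "\<dots> = (\<Sum>k<Suc d. q k) - q 0"
    using sum.lessThan_Suc_shift[of q d] by simp
  also have "\<dots> = (\<Sum>k<d. q k)" using \<open>q d = q 0\<close> by simp
  finally show "transfer \<psi> (x + 1) = transfer \<psi> x" by (simp add: transfer_def q_def)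
qed

lemma transfer_pos: "(\<And>t. \<psi> t > 0) \<Longrightarrow> transfer \<psi> x > 0"
  unfolding transfer_def using degree_pos deriv_pos
  by (intro sum_pos) (auto simp: lessThan_empty_iff)

text \<open>Inverse branches contract by \<open>\<kappa>\<close>, so the transfer operator trades a Lipschitz constant
  \<open>L\<close> of \<open>ln \<circ> \<psi>\<close> for \<open>\<kappa> (L + D)\<close>; sums of functions obeying such a bound obey it again.\<close>

lemma transfer_log_lipschitz:
  assumes pos: "\<And>t. \<psi> t > 0" and L: "0 \<le> L" and lip: "\<And>s t. \<psi> s \<le> exp (L * \<bar>s - t\<bar>) * \<psi> t"
  shows "transfer \<psi> x \<le> exp (\<kappa> * (L + D) * \<bar>x - y\<bar>) * transfer \<psi> y"
  unfolding transfer_def sum_distrib_left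
proof (rule sum_mono)
  fix k
  define s t where "s = g (x + real k)" and "t = g (y + real k)"
  have st: "\<bar>s - t\<bar> \<le> \<kappa> * \<bar>x - y\<bar>"
    using g_contraction[of "x + real k" "y + real k"] by (simp add: s_def t_def)
  have "\<psi> s / F' s \<le> (exp (L * \<bar>s - t\<bar>) * \<psi> t) * (exp (D * \<bar>s - t\<bar>) / F' t)"
  proof -
    have "1 / F' s \<le> exp (D * \<bar>s - t\<bar>) / F' t"
      using distortion[of t s] deriv_pos[of s] deriv_pos[of t] by (simp add: field_simps abs_minus_commute)
    moreover have "0 \<le> exp (L * \<bar>s - t\<bar>) * \<psi> t" using pos[of t] by simp
    ultimately have "\<psi> s * (1 / F' s) \<le> (exp (L * \<bar>s - t\<bar>) * \<psi> t) * (exp (D * \<bar>s - t\<bar>) / F' t)"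
      using lip[of s t] deriv_pos[of s] by (intro mult_mono) auto
    then show ?thesis by simp
  qed
  also have "\<dots> = exp ((L + D) * \<bar>s - t\<bar>) * (\<psi> t / F' t)"
    by (simp add: distrib_right exp_add)
  also have "\<dots> \<le> exp (\<kappa> * (L + D) * \<bar>x - y\<bar>) * (\<psi> t / F' t)"
  proof (rule mult_right_mono)
    have "(L + D) * \<bar>s - t\<bar> \<le> (L + D) * (\<kappa> * \<bar>x - y\<bar>)"
      using st L D_nonneg by (intro mult_left_mono) auto
    then show "exp ((L + D) * \<bar>s - t\<bar>) \<le> exp (\<kappa> * (L + D) * \<bar>x - y\<bar>)" by (simp add: mult_ac)
    show "0 \<le> \<psi> t / F' t" using pos[of t] deriv_pos[of t] by simp
  qed
  finally show "\<psi> (g (x + real k)) / F' (g (x + real k))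
    \<le> exp (\<kappa> * (L + D) * \<bar>x - y\<bar>) * (\<psi> (g (y + real k)) / F' (g (y + real k)))"
    by (simp add: s_def t_def)
qed

text \<open>Substituting \<open>y = F t\<close> maps one period onto \<open>d\<close> periods, which are then folded back onto one.
  Starting at \<open>g 0\<close> rather than \<open>0\<close> lets the image start at \<open>0\<close>.\<close>

lemma transfer_duality:
  assumes v: "cts_periodic v" and \<psi>: "cts_periodic \<psi>"
  shows "integral {0..1} (\<lambda>x. v x * transfer \<psi> x) = integral {0..1} (\<lambda>t. v (F t) * \<psi> t)"
proof -
  define q where "q y = v y * (\<psi> (g y) / F' (g y))" for y
  have q: "continuous_on UNIV q"
    unfolding q_def using deriv_pos
    by (intro continuous_on_divide continuous_on_mult continuous_on_compose2[OF cts_periodic_continuous[OF \<psi>, of UNIV]]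
      continuous_on_compose2[OF cont_deriv] cts_periodic_continuous[OF v] continuous_g) (auto simp: less_imp_neq[THEN not_sym])
  have "integral {0..1} (\<lambda>t. v (F t) * \<psi> t) = integral {g 0..g 0 + 1} (\<lambda>t. v (F t) * \<psi> t)"
    by (rule integral_period[symmetric]) (intro cts_periodic_mult cts_periodic_comp_lift v \<psi>)
  also have "\<dots> = integral {g 0..g 0 + 1} (\<lambda>t. q (F t) * F' t)"
    using deriv_pos by (simp add: q_def less_imp_neq[THEN not_sym])
  also have "\<dots> = integral {0..real d} q"
    by (subst integral_comp_lift[OF q]) (auto simp: degree)
  also have "\<dots> = (\<Sum>k<d. integral {0..1} (\<lambda>x. q (x + real k)))"
  proof -
    obtain Q where Q: "\<And>x. (Q has_real_derivative q x) (at x)"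
      using continuous_antiderivative[OF q] by blast
    have "((\<lambda>x. Q (x + real k)) has_real_derivative q (x + real k)) (at x)" for k x
      using Q[of "x + real k"] by (simp add: DERIV_shift)
    then have "integral {0..1} (\<lambda>x. q (x + real k)) = Q (1 + real k) - Q (0 + real k)" for k
      by (intro integral_antiderivative) auto
    then have "(\<Sum>k<d. integral {0..1} (\<lambda>x. q (x + real k))) = (\<Sum>k<d. Q (real (Suc k)) - Q (real k))"
      by (simp add: add.commute)
    also have "\<dots> = Q (real d) - Q (real 0)" by (rule sum_lessThan_telescope)
    finally show ?thesis using integral_antiderivative[OF Q, of 0 "real d"] by simp
  qed
  also have "\<dots> = integral {0..1} (\<lambda>x. \<Sum>k<d. q (x + real k))"
    by (rule integral_sum[symmetric])
       (auto intro!: integrable_continuous_real continuous_on_compose2[OF q] continuous_intros)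
  also have "\<dots> = integral {0..1} (\<lambda>x. v x * transfer \<psi> x)"
    using cts_periodic_add_int[OF v, of _ "int _"] by (simp add: q_def transfer_def sum_distrib_left)
  finally show ?thesis by simp
qed

end

section \<open>A positive continuous density\<close>

locale random_lifts =
  fixes m :: nat and F F' :: "nat \<Rightarrow> real \<Rightarrow> real" and d :: "nat \<Rightarrow> nat" and \<kappa> D :: real
  assumes m_pos: "1 \<le> m"
    and lift: "\<And>i. i \<in> {1..m} \<Longrightarrow> expanding_lift (F i) (F' i) (d i) \<kappa> D"
begin

lemma increasing: "i \<in> {1..m} \<Longrightarrow> increasing_lift (F i) (F' i) (d i)"
  using lift expanding_lift.axioms(1) by blast

lemma constants: "0 < \<kappa>" "\<kappa> < 1" "0 \<le> D"
  using expanding_lift.lam[OF lift[of 1]] expanding_lift.D_nonneg[OF lift[of 1]] m_pos by auto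

definition mean_transfer :: "(real \<Rightarrow> real) \<Rightarrow> real \<Rightarrow> real" where
  "mean_transfer \<psi> x = (1 / real m) * (\<Sum>i=1..m. expanding_lift.transfer (F i) (F' i) (d i) \<psi> x)"

lemma mean_transfer_cts_periodic:
  assumes "cts_periodic \<psi>" shows "cts_periodic (mean_transfer \<psi>)"
proof -
  have "cts_periodic (expanding_lift.transfer (F i) (F' i) (d i) \<psi>)" if "i \<in> {1..m}" for i
    by (rule expanding_lift.transfer_cts_periodic[OF lift[OF that] assms])
  then show ?thesis
    unfolding cts_periodic_def mean_transfer_def
    using m_pos by (auto intro!: continuous_intros simp del: One_nat_def)
qed

lemma mean_transfer_pos:
  assumes "\<And>t. \<psi> t > 0" shows "mean_transfer \<psi> x > 0"
  unfolding mean_transfer_def using m_pos expanding_lift.transfer_pos[OF lift assms]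
  by (intro mult_pos_pos sum_pos) auto

lemma mean_transfer_log_lipschitz:
  assumes "\<And>t. \<psi> t > 0" "0 \<le> L" "\<And>s t. \<psi> s \<le> exp (L * \<bar>s - t\<bar>) * \<psi> t"
  shows "mean_transfer \<psi> x \<le> exp (\<kappa> * (L + D) * \<bar>x - y\<bar>) * mean_transfer \<psi> y"
proof -
  have "(\<Sum>i=1..m. expanding_lift.transfer (F i) (F' i) (d i) \<psi> x)
     \<le> exp (\<kappa> * (L + D) * \<bar>x - y\<bar>) * (\<Sum>i=1..m. expanding_lift.transfer (F i) (F' i) (d i) \<psi> y)"
    unfolding sum_distrib_left
    by (intro sum_mono expanding_lift.transfer_log_lipschitz[OF lift] assms)
  then have "(1 / real m) * (\<Sum>i=1..m. expanding_lift.transfer (F i) (F' i) (d i) \<psi> x)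
     \<le> (1 / real m) * (exp (\<kappa> * (L + D) * \<bar>x - y\<bar>) * (\<Sum>i=1..m. expanding_lift.transfer (F i) (F' i) (d i) \<psi> y))"
    by (rule mult_left_mono) simp
  then show ?thesis by (simp add: mean_transfer_def)
qed

lemma mean_transfer_duality:
  assumes v: "cts_periodic v" and \<psi>: "cts_periodic \<psi>"
  shows "integral {0..1} (\<lambda>x. v x * mean_transfer \<psi> x)
    = (1 / real m) * (\<Sum>i=1..m. integral {0..1} (\<lambda>t. v (F i t) * \<psi> t))"
proof -
  have "integral {0..1} (\<lambda>x. v x * mean_transfer \<psi> x)
     = integral {0..1} (\<lambda>x. (1 / real m) * (\<Sum>i=1..m. v x * expanding_lift.transfer (F i) (F' i) (d i) \<psi> x))"
    by (simp add: mean_transfer_def sum_distrib_left mult_ac)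
  also have "\<dots> = (1 / real m) * integral {0..1} (\<lambda>x. \<Sum>i=1..m. v x * expanding_lift.transfer (F i) (F' i) (d i) \<psi> x)"
    by (rule integral_mult_right)
  also have "integral {0..1} (\<lambda>x. \<Sum>i=1..m. v x * expanding_lift.transfer (F i) (F' i) (d i) \<psi> x)
    = (\<Sum>i=1..m. integral {0..1} (\<lambda>x. v x * expanding_lift.transfer (F i) (F' i) (d i) \<psi> x))"
    by (rule integral_sum)
       (auto intro!: integrable_cts_periodic cts_periodic_mult v expanding_lift.transfer_cts_periodic[OF lift] \<psi>)
  also have "\<dots> = (\<Sum>i=1..m. integral {0..1} (\<lambda>t. v (F i t) * \<psi> t))"
    by (intro sum.cong refl expanding_lift.transfer_duality[OF lift] v \<psi>)
  finally show ?thesis .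
qed

text \<open>The map \<open>L \<mapsto> \<kappa> (L + D)\<close> on Lipschitz constants contracts towards its fixed point
  \<open>\<kappa> D / (1 - \<kappa>)\<close>.\<close>

lemma mean_transfer_iterates:
  assumes \<psi>: "cts_periodic \<psi>" "\<And>t. \<psi> t > 0"
    and L: "0 \<le> L" "\<And>s t. \<psi> s \<le> exp (L * \<bar>s - t\<bar>) * \<psi> t"
  shows "cts_periodic ((mean_transfer ^^ n) \<psi>) \<and> (\<forall>t. (mean_transfer ^^ n) \<psi> t > 0) \<and>
    (\<forall>s t. (mean_transfer ^^ n) \<psi> s
       \<le> exp ((\<kappa> * D / (1 - \<kappa>) + \<kappa> ^ n * L) * \<bar>s - t\<bar>) * (mean_transfer ^^ n) \<psi> t)"
proof (induction n)
  case 0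
  have "exp (L * \<bar>s - t\<bar>) * \<psi> t \<le> exp ((\<kappa> * D / (1 - \<kappa>) + L) * \<bar>s - t\<bar>) * \<psi> t" for s t
    using constants \<psi>(2)[of t] by (intro mult_right_mono) (auto simp: distrib_right)
  from order_trans[OF L(2) this] show ?case using \<psi> by simp
next
  case (Suc n)
  let ?L = "\<kappa> * D / (1 - \<kappa>) + \<kappa> ^ n * L"
  have "\<kappa> * (?L + D) = \<kappa> * D / (1 - \<kappa>) + \<kappa> ^ Suc n * L"
    using constants by (simp add: field_simps)
  moreover have "0 \<le> ?L" using constants L by simp
  ultimately show ?case
    using Suc mean_transfer_cts_periodic mean_transfer_pos
      mean_transfer_log_lipschitz[of "(mean_transfer ^^ n) \<psi>" ?L] by auto
qed

text \<open>A stationary functional that is approximated by a density \<open>\<psi>\<close> in total variation is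
  approximated just as well by every iterate of \<open>\<psi>\<close>, because composing the test function with
  \<open>F\<^sub>i\<close> does not increase its supremum.\<close>

lemma approximation_invariant:
  assumes stat: "\<And>v. cts_periodic v \<Longrightarrow> I v = (1 / real m) * (\<Sum>i=1..m. I (\<lambda>t. v (F i t)))"
    and \<psi>: "cts_periodic \<psi>" "\<And>t. \<psi> t > 0"
    and L: "0 \<le> L" "\<And>s t. \<psi> s \<le> exp (L * \<bar>s - t\<bar>) * \<psi> t"
    and appr: "\<And>v B. cts_periodic v \<Longrightarrow> (\<And>t. \<bar>v t\<bar> \<le> B) \<Longrightarrow>
      \<bar>I v - integral {0..1} (\<lambda>t. v t * \<psi> t)\<bar> \<le> \<epsilon> * B"
    and v: "cts_periodic v" "\<And>t. \<bar>v t\<bar> \<le> B"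
  shows "\<bar>I v - integral {0..1} (\<lambda>t. v t * (mean_transfer ^^ n) \<psi> t)\<bar> \<le> \<epsilon> * B"
  using v
proof (induction n arbitrary: v)
  case 0
  then show ?case using appr by simp
next
  case (Suc n)
  let ?\<eta> = "(mean_transfer ^^ n) \<psi>"
  let ?v = "\<lambda>i t. v (F i t)"
  have vi: "cts_periodic (?v i)" if "i \<in> {1..m}" for i
    by (rule increasing_lift.cts_periodic_comp_lift[OF increasing[OF that] Suc.prems(1)])
  have \<eta>: "cts_periodic ?\<eta>" using mean_transfer_iterates[OF \<psi> L] by blast
  define \<Delta> where "\<Delta> i = I (?v i) - integral {0..1} (\<lambda>t. ?v i t * ?\<eta> t)" for i
  have "I v - integral {0..1} (\<lambda>t. v t * (mean_transfer ^^ Suc n) \<psi> t) = (1 / real m) * (\<Sum>i=1..m. \<Delta> i)"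
    unfolding stat[OF Suc.prems(1)] using mean_transfer_duality[OF Suc.prems(1) \<eta>]
    by (simp add: \<Delta>_def sum_subtractf right_diff_distrib)
  then have "\<bar>I v - integral {0..1} (\<lambda>t. v t * (mean_transfer ^^ Suc n) \<psi> t)\<bar>
      = (1 / real m) * \<bar>\<Sum>i=1..m. \<Delta> i\<bar>"
    by (simp only: abs_mult) simp
  also have "\<dots> \<le> (1 / real m) * (\<Sum>i=1..m. \<bar>\<Delta> i\<bar>)"
    by (intro mult_left_mono sum_abs) simp
  also have "\<dots> \<le> (1 / real m) * (\<Sum>i=1..m. \<epsilon> * B)"
    unfolding \<Delta>_def by (intro mult_left_mono sum_mono Suc.IH vi Suc.prems(2)) auto
  also have "\<dots> = \<epsilon> * B" using m_pos by simp
  finally show ?case .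
qed

text \<open>Approximate the functional by Lipschitz densities and push them forward: the iterates are
  uniformly log-Lipschitz, hence precompact, and a uniform limit represents the functional.\<close>

theorem stationary_density:
  assumes stat: "\<And>v. cts_periodic v \<Longrightarrow> I v = (1 / real m) * (\<Sum>i=1..m. I (\<lambda>t. v (F i t)))"
    and norm: "I (\<lambda>_. 1) = 1"
    and appr: "\<And>\<epsilon>. \<epsilon> > 0 \<Longrightarrow> \<exists>\<psi> L. cts_periodic \<psi> \<and> (\<forall>t. \<psi> t > 0) \<and> 0 \<le> L \<and>
      (\<forall>s t. \<psi> s \<le> exp (L * \<bar>s - t\<bar>) * \<psi> t) \<and>
      (\<forall>v B. cts_periodic v \<longrightarrow> (\<forall>t. \<bar>v t\<bar> \<le> B) \<longrightarrow> \<bar>I v - integral {0..1} (\<lambda>t. v t * \<psi> t)\<bar> \<le> \<epsilon> * B)"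
  obtains \<phi> where "cts_periodic \<phi>" "\<And>t. \<phi> t > 0"
    "\<And>v. cts_periodic v \<Longrightarrow> I v = integral {0..1} (\<lambda>t. v t * \<phi> t)"
proof -
  \<comment> \<open>The summand 1 leaves room for the transient term \<open>\<kappa>^n * L\<close>.\<close>
  define K where "K = \<kappa> * D / (1 - \<kappa>) + 1"
  have K: "K \<ge> 0" using constants by (simp add: K_def)
  have "\<exists>\<eta>. cts_periodic \<eta> \<and> (\<forall>t. \<eta> t > 0) \<and> (\<forall>s t. \<eta> s \<le> exp (K * \<bar>s - t\<bar>) * \<eta> t) \<and>
      (\<forall>v B. cts_periodic v \<longrightarrow> (\<forall>t. \<bar>v t\<bar> \<le> B) \<longrightarrow> \<bar>I v - integral {0..1} (\<lambda>t. v t * \<eta> t)\<bar> \<le> \<epsilon> * B)"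
    if \<epsilon>: "\<epsilon> > 0" for \<epsilon>
  proof -
    obtain \<psi> L where \<psi>: "cts_periodic \<psi>" "\<And>t. \<psi> t > 0" "0 \<le> L"
        "\<And>s t. \<psi> s \<le> exp (L * \<bar>s - t\<bar>) * \<psi> t"
      and ap: "\<And>v B. cts_periodic v \<Longrightarrow> (\<And>t. \<bar>v t\<bar> \<le> B) \<Longrightarrow>
        \<bar>I v - integral {0..1} (\<lambda>t. v t * \<psi> t)\<bar> \<le> \<epsilon> * B"
      using appr[OF \<epsilon>] by blast
    have "(\<lambda>n. \<kappa> ^ n * L) \<longlonglongrightarrow> 0"
      using constants by (intro tendsto_mult_left_zero LIMSEQ_realpow_zero) auto
    then have "eventually (\<lambda>n. \<kappa> ^ n * L < 1) sequentially"
      by (rule order_tendstoD) simp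
    then obtain n where n: "\<kappa> ^ n * L \<le> 1"
      by (meson eventually_sequentially less_imp_le order_refl)
    let ?\<eta> = "(mean_transfer ^^ n) \<psi>"
    have it: "cts_periodic ?\<eta>" "\<And>t. ?\<eta> t > 0"
      "\<And>s t. ?\<eta> s \<le> exp ((\<kappa> * D / (1 - \<kappa>) + \<kappa> ^ n * L) * \<bar>s - t\<bar>) * ?\<eta> t"
      using mean_transfer_iterates[OF \<psi>] by blast+
    have "?\<eta> s \<le> exp (K * \<bar>s - t\<bar>) * ?\<eta> t" for s t
    proof (rule order_trans[OF it(3) mult_right_mono])
      show "exp ((\<kappa> * D / (1 - \<kappa>) + \<kappa> ^ n * L) * \<bar>s - t\<bar>) \<le> exp (K * \<bar>s - t\<bar>)"
        using n by (simp add: K_def mult_right_mono)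
    qed (use it(2)[of t] in simp)
    then show ?thesis
      using it approximation_invariant[OF stat \<psi> ap] by (intro exI[of _ ?\<eta>]) blast
  qed
  then have "\<forall>j. \<exists>\<eta>. cts_periodic \<eta> \<and> (\<forall>t. \<eta> t > 0) \<and> (\<forall>s t. \<eta> s \<le> exp (K * \<bar>s - t\<bar>) * \<eta> t) \<and>
      (\<forall>v B. cts_periodic v \<longrightarrow> (\<forall>t. \<bar>v t\<bar> \<le> B) \<longrightarrow>
         \<bar>I v - integral {0..1} (\<lambda>t. v t * \<eta> t)\<bar> \<le> inverse (real (Suc j)) * B)"
    by simp
  from choice[OF this] obtain \<eta> where \<eta>: "\<And>j. cts_periodic (\<eta> j)" "\<And>j t. \<eta> j t > 0"
      "\<And>j s t. \<eta> j s \<le> exp (K * \<bar>s - t\<bar>) * \<eta> j t"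
    and ap: "\<And>j v B. cts_periodic v \<Longrightarrow> (\<And>t. \<bar>v t\<bar> \<le> B) \<Longrightarrow>
         \<bar>I v - integral {0..1} (\<lambda>t. v t * \<eta> j t)\<bar> \<le> inverse (real (Suc j)) * B"
    by blast
  have int\<eta>: "integral {0..1} (\<eta> j) \<le> 2" for j
  proof -
    have "inverse (real (Suc j)) \<le> 1" by (simp add: field_simps)
    then show ?thesis using ap[OF cts_periodic_const[of 1], of 1 j] norm by simp
  qed
  define M where "M = exp K * 2"
  \<comment> \<open>A function in this class is comparable to its mean over a period.\<close>
  have M: "\<eta> j x \<le> M" for j x
  proof -
    have "integral {0..1} (\<lambda>y::real. exp (- K) * \<eta> j (frac x)) \<le> integral {0..1} (\<eta> j)"
    proof (rule integral_le)
      show "exp (- K) * \<eta> j (frac x) \<le> \<eta> j y" if "y \<in> {0..1}" for y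
      proof -
        have "\<bar>frac x - y\<bar> \<le> 1" using that frac_lt_1[of x] frac_ge_0[of x] unfolding atLeastAtMost_iff by linarith
        then have "exp (K * \<bar>frac x - y\<bar>) \<le> exp K" using K by (simp add: mult_left_le)
        then have "\<eta> j (frac x) \<le> exp K * \<eta> j y"
          using \<eta>(3)[of j "frac x" y] \<eta>(2)[of j y] by (meson less_imp_le mult_right_mono order_trans)
        then show ?thesis by (simp add: exp_minus field_simps)
      qed
    qed (auto intro: integrable_cts_periodic \<eta>)
    then have "\<eta> j x \<le> exp K * integral {0..1} (\<eta> j)"
      using cts_periodic_frac[OF \<eta>(1), of j x] by (simp add: exp_minus field_simps)
    also have "\<dots> \<le> M" unfolding M_def by (intro mult_left_mono int\<eta>) simp
    finally show ?thesis .
  qed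
  have lip: "\<bar>\<eta> j x - \<eta> j y\<bar> \<le> M * (exp (K * \<bar>x - y\<bar>) - 1)" for j x y
  proof -
    have "\<eta> j x - \<eta> j y \<le> M * (exp (K * \<bar>x - y\<bar>) - 1)" for x y
    proof -
      have "\<eta> j x - \<eta> j y \<le> (exp (K * \<bar>x - y\<bar>) - 1) * \<eta> j y"
        using \<eta>(3)[of j x y] by (simp add: algebra_simps)
      also have "\<dots> \<le> (exp (K * \<bar>x - y\<bar>) - 1) * M"
        using K by (intro mult_left_mono M) auto
      finally show ?thesis by (simp add: mult.commute)
    qed
    from this[of x y] this[of y x] show ?thesis by (auto simp: abs_minus_commute abs_le_iff)
  qed
  obtain \<phi>0 k where \<phi>0: "continuous_on {0..1} \<phi>0" and k: "strict_mono (k :: nat \<Rightarrow> nat)"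
    and unif0: "\<And>e. 0 < e \<Longrightarrow> \<exists>N. \<forall>n x. n \<ge> N \<and> x \<in> {0..1} \<longrightarrow> norm (\<eta> (k n) x - \<phi>0 x) < e"
  proof (rule Arzela_Ascoli[of "{0..1}" \<eta> M])
    show "norm (\<eta> n x) \<le> M" for n x using M[of n x] \<eta>(2)[of n x] by simp
    show "\<exists>\<delta>>0. \<forall>n y. y \<in> {0..1} \<and> norm (x - y) < \<delta> \<longrightarrow> norm (\<eta> n x - \<eta> n y) < e"
      if "0 < e" for x e
    proof -
      have "((\<lambda>s. M * (exp (K * s) - 1)) \<longlongrightarrow> M * (exp (K * 0) - 1)) (at 0)"
        by (intro tendsto_intros)
      then have "eventually (\<lambda>s. M * (exp (K * s) - 1) < e) (at 0)"
        using \<open>0 < e\<close> by (intro order_tendstoD) auto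
      then obtain \<delta> where \<delta>: "\<delta> > 0" "\<And>s. s \<noteq> 0 \<Longrightarrow> \<bar>s\<bar> < \<delta> \<Longrightarrow> M * (exp (K * s) - 1) < e"
        by (auto simp: eventually_at dist_real_def)
      have "norm (\<eta> n x - \<eta> n y) < e" if "norm (x - y) < \<delta>" for n y
      proof (cases "x = y")
        case False
        then have "M * (exp (K * \<bar>x - y\<bar>) - 1) < e" using \<delta>(2)[of "\<bar>x - y\<bar>"] that by simp
        then show ?thesis using lip[of n x y] by simp
      qed (use \<open>0 < e\<close> in simp)
      then show ?thesis using \<delta>(1) by blast
    qed
  qed auto
  \<comment> \<open>Periodicity turns uniform convergence on one period into uniform convergence on the line.\<close>
  define \<phi> where "\<phi> x = \<phi>0 (frac x)" for x
  have unif: "uniform_limit UNIV (\<lambda>n. \<eta> (k n)) \<phi> sequentially"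
  proof (rule uniform_limitI)
    fix e :: real assume "0 < e"
    from unif0[OF this] obtain N where N: "\<And>n x. n \<ge> N \<Longrightarrow> x \<in> {0..1} \<Longrightarrow> norm (\<eta> (k n) x - \<phi>0 x) < e"
      by blast
    have "dist (\<eta> (k n) x) (\<phi> x) < e" if "n \<ge> N" for n x
      using N[OF that, of "frac x"] frac_lt_1[of x] cts_periodic_frac[OF \<eta>(1), of "k n" x]
      by (simp add: \<phi>_def dist_real_def less_imp_le)
    then show "\<forall>\<^sub>F n in sequentially. \<forall>x\<in>UNIV. dist (\<eta> (k n) x) (\<phi> x) < e"
      by (auto simp: eventually_sequentially)
  qed
  have lim: "(\<lambda>n. \<eta> (k n) x) \<longlonglongrightarrow> \<phi> x" for x
    using tendsto_uniform_limitI[OF unif] by simp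
  have \<phi>: "cts_periodic \<phi>"
  proof (rule cts_periodicI)
    show "continuous_on UNIV \<phi>"
      by (rule uniform_limit_theorem[OF _ unif]) (simp_all add: cts_periodic_continuous \<eta>)
    show "\<phi> (x + 1) = \<phi> x" for x by (simp add: \<phi>_def frac_def)
  qed
  have rep: "I v = integral {0..1} (\<lambda>t. v t * \<phi> t)" if v: "cts_periodic v" for v
  proof (rule LIMSEQ_unique)
    obtain B where B: "\<And>t. \<bar>v t\<bar> \<le> B" using cts_periodic_bounded[OF v] by blast
    show "(\<lambda>n. integral {0..1} (\<lambda>t. v t * \<eta> (k n) t)) \<longlonglongrightarrow> I v"
    proof (rule LIM_zero_cancel, rule tendsto_rabs_zero_cancel,
        rule tendsto_sandwich[where f = "\<lambda>_. 0" and h = "\<lambda>n. inverse (real (Suc (k n))) * B"])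
      show "(\<lambda>n. inverse (real (Suc (k n))) * B) \<longlonglongrightarrow> 0"
        using LIMSEQ_subseq_LIMSEQ[OF LIMSEQ_inverse_real_of_nat k]
        by (intro tendsto_mult_left_zero) (simp add: o_def)
      show "\<forall>\<^sub>F n in sequentially. \<bar>integral {0..1} (\<lambda>t. v t * \<eta> (k n) t) - I v\<bar> \<le> inverse (real (Suc (k n))) * B"
        using ap[OF v B] by (auto simp: abs_minus_commute)
    qed auto
    have "uniform_limit UNIV (\<lambda>n t. v t * \<eta> (k n) t) (\<lambda>t. v t * \<phi> t) sequentially"
    proof (rule uniform_lim_mult[OF uniform_limit_const unif])
      show "bounded (range v)" using B by (auto simp: bounded_iff)
      show "bounded (range \<phi>)" using cts_periodic_bounded[OF \<phi>] by (auto simp: bounded_iff)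
    qed
    then have "uniform_limit {0..1} (\<lambda>n t. v t * \<eta> (k n) t) (\<lambda>t. v t * \<phi> t) sequentially"
      by (rule uniform_limit_on_subset) simp
    then obtain J J' where J: "\<And>n. ((\<lambda>t. v t * \<eta> (k n) t) has_integral J n) {0..1}"
        and J': "((\<lambda>t. v t * \<phi> t) has_integral J') {0..1}" and "J \<longlonglongrightarrow> J'"
      by (rule uniform_limit_integral)
         (auto intro!: continuous_on_mult cts_periodic_continuous[OF v] cts_periodic_continuous[OF \<eta>(1)])
    then show "(\<lambda>n. integral {0..1} (\<lambda>t. v t * \<eta> (k n) t)) \<longlonglongrightarrow> integral {0..1} (\<lambda>t. v t * \<phi> t)"
      using integral_unique[OF J] integral_unique[OF J'] by simp
  qed
  have \<phi>_lip: "\<phi> s \<le> exp (K * \<bar>s - t\<bar>) * \<phi> t" for s t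
    by (rule LIMSEQ_le[OF lim tendsto_mult_left[OF lim]]) (use \<eta>(3) in auto)
  have \<phi>_nn: "\<phi> t \<ge> 0" for t
    by (rule LIMSEQ_le_const[OF lim]) (use \<eta>(2) less_imp_le in blast)
  \<comment> \<open>The log-Lipschitz bound spreads a zero of \<open>\<phi>\<close> to the whole line.\<close>
  have "\<phi> t > 0" for t
  proof (rule ccontr)
    assume "\<not> \<phi> t > 0"
    then have "\<phi> t = 0" using \<phi>_nn[of t] by simp
    then have "\<phi> s = 0" for s using \<phi>_lip[of s t] \<phi>_nn[of s] by simp
    then have "I (\<lambda>_. 1) = 0" using rep[OF cts_periodic_const[of 1]] by simp
    then show False using norm by simp
  qed
  then show ?thesis using that \<phi> rep by blast
qed

end

section \<open>Calculus of finitely often differentiable functions\<close>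

lemma C_real_0: "C_real 0 f \<longleftrightarrow> continuous_on UNIV f"
  by (simp add: C_real_def)

lemma C_real_Suc:
  assumes "\<And>t. (f has_real_derivative f' t) (at t)"
  shows "C_real (Suc s) f \<longleftrightarrow> C_real s f'"
proof -
  have "deriv f = f'" using assms by (auto intro: DERIV_imp_deriv)
  moreover have "f differentiable (at t)" for t
    using assms by (auto simp: real_differentiable_def)
  ultimately show ?thesis
    unfolding C_real_def All_less_Suc2 by (simp add: funpow_swap1 del: funpow.simps)
       (simp add: funpow_swap1)
qed

lemma C_real_deriv:
  assumes "C_real (Suc s) f"
  shows "(f has_real_derivative deriv f t) (at t)" "C_real s (deriv f)"
proof -
  have "f differentiable (at t)" for t
    using assms unfolding C_real_def All_less_Suc2 by simp
  then show D: "(f has_real_derivative deriv f t) (at t)" for t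
    by (simp add: DERIV_deriv_iff_real_differentiable)
  show "C_real s (deriv f)" using assms C_real_Suc[OF D] by simp
qed

lemma C_real_SucD: "C_real (Suc s) f \<Longrightarrow> C_real s f"
proof (induction s arbitrary: f)
  case 0
  then show ?case
    using C_real_deriv(1)[OF 0] by (meson C_real_0 DERIV_isCont continuous_at_imp_continuous_on)
next
  case (Suc s)
  then show ?case using C_real_Suc[OF C_real_deriv(1)[OF Suc.prems]] C_real_deriv(2) by blast
qed

lemma C_real_mono: "C_real s f \<Longrightarrow> k \<le> s \<Longrightarrow> C_real k f"
proof (induction s)
  case (Suc s)
  then show ?case by (cases "k = Suc s") (auto dest: C_real_SucD)
qed simp

lemma C_real_continuous: "C_real s f \<Longrightarrow> continuous_on UNIV f"
  using C_real_mono[of s f 0] by (simp add: C_real_0)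

lemma C_real_const: "C_real s (\<lambda>_. c)"
proof (induction s arbitrary: c)
  case (Suc s)
  show ?case by (subst C_real_Suc[where f' = "\<lambda>_. 0"]) (use Suc in auto)
qed (simp add: C_real_0)

lemma C_real_add: "C_real s f \<Longrightarrow> C_real s g \<Longrightarrow> C_real s (\<lambda>t. f t + g t)"
proof (induction s arbitrary: f g)
  case (Suc s)
  have "((\<lambda>t. f t + g t) has_real_derivative deriv f t + deriv g t) (at t)" for t
    by (rule DERIV_add[OF C_real_deriv(1)[OF Suc.prems(1)] C_real_deriv(1)[OF Suc.prems(2)]])
  from C_real_Suc[OF this] show ?case using Suc C_real_deriv(2) by simp
qed (auto simp: C_real_0 intro: continuous_intros)

lemma C_real_mult: "C_real s f \<Longrightarrow> C_real s g \<Longrightarrow> C_real s (\<lambda>t. f t * g t)"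
proof (induction s arbitrary: f g)
  case (Suc s)
  have "((\<lambda>t. f t * g t) has_real_derivative deriv f t * g t + deriv g t * f t) (at t)" for t
    by (rule DERIV_mult[OF C_real_deriv(1)[OF Suc.prems(1)] C_real_deriv(1)[OF Suc.prems(2)]])
  from C_real_Suc[OF this] show ?case
    by (simp add: C_real_add Suc.IH C_real_deriv(2)[OF Suc.prems(1)] C_real_deriv(2)[OF Suc.prems(2)]
      C_real_SucD[OF Suc.prems(1)] C_real_SucD[OF Suc.prems(2)])
qed (auto simp: C_real_0 intro: continuous_intros)

lemma C_real_comp: "C_real s f \<Longrightarrow> C_real s g \<Longrightarrow> C_real s (\<lambda>t. f (g t))"
proof (induction s arbitrary: f g)
  case 0
  then show ?case by (auto simp: C_real_0 intro: continuous_on_compose2)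
next
  case (Suc s)
  have "((\<lambda>t. f (g t)) has_real_derivative deriv f (g t) * deriv g t) (at t)" for t
    by (rule DERIV_chain2[OF C_real_deriv(1)[OF Suc.prems(1)] C_real_deriv(1)[OF Suc.prems(2)]])
  from C_real_Suc[OF this] show ?case
    by (simp add: C_real_mult Suc.IH C_real_deriv(2)[OF Suc.prems(1)] C_real_deriv(2)[OF Suc.prems(2)]
      C_real_SucD[OF Suc.prems(1)] C_real_SucD[OF Suc.prems(2)])
qed

lemma C_real_inverse:
  assumes "C_real s f" "\<And>t. f t \<noteq> 0"
  shows "C_real s (\<lambda>t. 1 / f t)"
  using assms
proof (induction s)
  case 0
  then show ?case by (auto simp: C_real_0 intro!: continuous_intros)
next
  case (Suc s)
  have D: "((\<lambda>t. 1 / f t) has_real_derivative ((- 1) * deriv f t) * ((1 / f t) * (1 / f t))) (at t)" for t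
    using C_real_deriv(1)[OF Suc.prems(1), of t] Suc.prems(2)[of t]
    by (auto intro!: derivative_eq_intros simp: field_simps)
  show ?case unfolding C_real_Suc[OF D]
    by (intro C_real_mult C_real_const C_real_deriv(2)[OF Suc.prems(1)] Suc.IH C_real_SucD[OF Suc.prems(1)] Suc.prems(2))
qed

lemma C_real_divide:
  assumes "C_real s f" "C_real s h" "\<And>t. h t \<noteq> 0"
  shows "C_real s (\<lambda>t. f t / h t)"
  using C_real_mult[OF assms(1) C_real_inverse[OF assms(2,3)]] by simp

lemma C_real_ln:
  assumes "C_real s f" "\<And>t. f t > 0"
  shows "C_real s (\<lambda>t. ln (f t))"
proof (cases s)
  case 0
  then show ?thesis using assms by (auto simp: C_real_0 less_imp_neq[THEN not_sym] intro!: continuous_intros)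
next
  case (Suc k)
  have D: "((\<lambda>t. ln (f t)) has_real_derivative deriv f t / f t) (at t)" for t
    using C_real_deriv(1)[OF assms(1)[unfolded Suc], of t] assms(2)[of t]
    by (auto intro!: derivative_eq_intros simp: field_simps)
  show ?thesis unfolding Suc C_real_Suc[OF D]
    using C_real_deriv(2)[OF assms(1)[unfolded Suc]] C_real_SucD[OF assms(1)[unfolded Suc]] assms(2)
    by (intro C_real_divide) (auto simp: less_imp_neq[THEN not_sym])
qed

lemma C_real_exp: "C_real s (exp :: real \<Rightarrow> real)"
proof (induction s)
  case (Suc s)
  show ?case by (subst C_real_Suc[where f' = exp]) (use Suc in auto)
qed (simp add: C_real_0 continuous_intros)

text \<open>The regularity of \<open>G\<close> bootstraps: the derivative \<open>1 / F' \<circ> G\<close> is as smooth as \<open>F'\<close> and \<open>G\<close> allow.\<close>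

lemma C_real_inverse_function:
  assumes deriv: "\<And>y. (G has_real_derivative 1 / F' (G y)) (at y)"
    and F': "C_real s F'" "\<And>t. F' t \<noteq> 0"
  shows "C_real (Suc s) G"
  using F'(1)
proof (induction s)
  case 0
  have "continuous_on UNIV G" using deriv by (meson DERIV_isCont continuous_at_imp_continuous_on)
  then show ?case unfolding C_real_Suc[OF deriv]
    using 0 F'(2) by (intro C_real_inverse C_real_comp[of 0 F' G]) (auto simp: C_real_0)
next
  case (Suc s)
  then show ?case unfolding C_real_Suc[OF deriv, of "Suc s"]
    using C_real_SucD[OF Suc.prems] F'(2) by (intro C_real_inverse C_real_comp[of "Suc s" F' G]) auto
qed

section \<open>Regularity of the density\<close>

text \<open>Banach's fixed point theorem for \<open>W \<mapsto> A (W \<circ> g) + B\<close> on the bounded continuous functions.\<close>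

lemma contraction_solution:
  fixes A B g :: "real \<Rightarrow> real"
  assumes cont: "continuous_on UNIV A" "continuous_on UNIV B" "continuous_on UNIV g"
    and A: "\<And>y. \<bar>A y\<bar> \<le> c" "c < 1" and B: "\<And>y. \<bar>B y\<bar> \<le> C"
  obtains W where "continuous_on UNIV W" "\<And>y. W y = A y * W (g y) + B y"
proof -
  have c: "0 \<le> c" using A(1)[of 0] by linarith
  define S where "S w y = A y * apply_bcontfun w (g y) + B y" for w :: "real \<Rightarrow>\<^sub>C real" and y
  have S: "S w \<in> bcontfun" for w
  proof (rule bcontfun_normI)
    have "continuous_on UNIV (\<lambda>y. apply_bcontfun w (g y))"
      by (rule continuous_on_compose2[OF continuous_on_apply_bcontfun[of UNIV] cont(3)]) simp
    then show "continuous_on UNIV (S w)" unfolding S_def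
      by (intro continuous_on_add continuous_on_mult cont)
    show "norm (S w y) \<le> c * norm w + C" for y
    proof -
      have "\<bar>A y * apply_bcontfun w (g y)\<bar> \<le> c * norm w"
        unfolding abs_mult using norm_bounded[of w "g y"] by (intro mult_mono A c) auto
      then show ?thesis using B[of y] unfolding S_def by (simp add: abs_le_iff)
    qed
  qed
  have "\<exists>!w. Bcontfun (S w) = w"
  proof (rule banach_fix_type[OF c A(2)], intro allI)
    fix v w :: "real \<Rightarrow>\<^sub>C real"
    show "dist (Bcontfun (S v)) (Bcontfun (S w)) \<le> c * dist v w"
    proof (rule dist_bound)
      fix y
      have "dist (S v y) (S w y) = \<bar>A y\<bar> * dist (apply_bcontfun v (g y)) (apply_bcontfun w (g y))"
      proof -
        have "S v y - S w y = A y * (apply_bcontfun v (g y) - apply_bcontfun w (g y))"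
          by (simp add: S_def right_diff_distrib)
        then show ?thesis by (simp only: dist_real_def abs_mult)
      qed
      also have "\<dots> \<le> c * dist v w"
        by (intro mult_mono A dist_bounded c) auto
      finally show "dist (apply_bcontfun (Bcontfun (S v)) y) (apply_bcontfun (Bcontfun (S w)) y) \<le> c * dist v w"
        by (simp add: Bcontfun_inverse[OF S])
    qed
  qed
  then obtain w where w: "Bcontfun (S w) = w" by blast
  have "apply_bcontfun w = S w" using Bcontfun_inverse[OF S, of w] unfolding w .
  then have "apply_bcontfun w y = A y * apply_bcontfun w (g y) + B y" for y
    unfolding S_def by (rule fun_cong)
  then show ?thesis by (rule that[OF continuous_on_apply_bcontfun])
qed

context expanding_lift
begin

text \<open>Differentiating the functional equation turns it into one with the contracting factor
  \<open>A / F' \<circ> g\<close>, which has a continuous solution \<open>W\<close>. An antiderivative of \<open>W\<close> solves the original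
  equation up to a constant, and its difference to \<open>w\<close> is constant because all orbits of \<open>g\<close>
  converge to its fixed point.\<close>

lemma functional_equation_C1:
  assumes A: "0 < A" "A \<le> 1"
    and B: "\<And>y. (B has_real_derivative B' y) (at y)" "continuous_on UNIV B'" "\<And>y. \<bar>B' y\<bar> \<le> C"
    and w: "continuous_on UNIV w" "\<And>y. w y = A * w (g y) + B y"
  obtains W where "continuous_on UNIV W" "\<And>y. (w has_real_derivative W y) (at y)"
proof -
  have c: "continuous_on UNIV (\<lambda>y. A / F' (g y))" using deriv_pos
    by (intro continuous_on_divide continuous_on_compose2[OF cont_deriv continuous_g] continuous_on_const)
       (auto simp: less_imp_neq[THEN not_sym])
  have l: "\<bar>A / F' (g y)\<bar> \<le> \<kappa>" for y
  proof -
    have "A * (1 / F' (g y)) \<le> 1 * \<kappa>"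
      using deriv_g_bounds[of "g y"] A by (intro mult_mono) auto
    then show ?thesis using A deriv_pos[of "g y"] by simp
  qed
  obtain W where W: "continuous_on UNIV W" "\<And>y. W y = A / F' (g y) * W (g y) + B' y"
    using contraction_solution[OF c B(2) continuous_g l lam(2) B(3)] by metis
  obtain V where V: "\<And>y. (V has_real_derivative W y) (at y)"
    using continuous_antiderivative[OF W(1)] by blast
  have "((\<lambda>y. V y - A * V (g y) - B y) has_real_derivative 0) (at y)" for y
  proof -
    have "((\<lambda>y. V (g y)) has_real_derivative W (g y) * (1 / F' (g y))) (at y)"
      by (rule DERIV_chain2[OF V deriv_g])
    then have "((\<lambda>y. V y - A * V (g y) - B y) has_real_derivative
        W y - A * (W (g y) * (1 / F' (g y))) - B' y) (at y)"
      by (intro DERIV_diff V DERIV_cmult B)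
    then show ?thesis using W(2)[of y] by simp
  qed
  then have const: "V y - A * V (g y) - B y = V z - A * V (g z) - B z" for y z
    by (rule constant_if_derivative_zero[where E = "\<lambda>y. V y - A * V (g y) - B y"])
  \<comment> \<open>The constant of integration drops out of differences of \<open>e\<close>, and \<open>A \<le> 1\<close> then suffices.\<close>
  define e where "e y = w y - V y" for y
  have e: "e y - e z = A * (e (g y) - e (g z))" for y z
    using const[of y z] w(2)[of y] w(2)[of z] by (simp add: e_def algebra_simps)
  have "continuous_on UNIV V" using V by (meson DERIV_isCont continuous_at_imp_continuous_on)
  then have e_cont: "isCont e y" for y
    unfolding e_def using w(1) by (intro continuous_intros) (auto simp: continuous_on_eq_continuous_at)
  obtain p where p: "g p = p"
    using banach_fix_type[of \<kappa> g] lam g_contraction by (auto simp: dist_real_def)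
  have "e y = e p" for y
  proof -
    have "\<bar>e y - e p\<bar> \<le> \<bar>e ((g ^^ n) y) - e p\<bar>" for n
    proof (induction n)
      case (Suc n)
      also have "e ((g ^^ n) y) - e p = A * (e ((g ^^ Suc n) y) - e p)"
        using e[of "(g ^^ n) y" p] by (simp add: p)
      also have "\<bar>\<dots>\<bar> \<le> 1 * \<bar>e ((g ^^ Suc n) y) - e p\<bar>"
        unfolding abs_mult using A by (intro mult_right_mono) auto
      finally show ?case by simp
    qed simp
    moreover have "(\<lambda>n. \<bar>e ((g ^^ n) y) - e p\<bar>) \<longlonglongrightarrow> \<bar>e p - e p\<bar>"
    proof (intro tendsto_rabs tendsto_diff tendsto_const isCont_tendsto_compose[OF e_cont])
      have "\<bar>(g ^^ n) y - p\<bar> \<le> \<kappa> ^ n * \<bar>y - p\<bar>" for n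
      proof (induction n)
        case (Suc n)
        have "\<bar>(g ^^ Suc n) y - p\<bar> \<le> \<kappa> * \<bar>(g ^^ n) y - p\<bar>"
          using g_contraction[of "(g ^^ n) y" p] by (simp add: p)
        also have "\<dots> \<le> \<kappa> * (\<kappa> ^ n * \<bar>y - p\<bar>)" using Suc lam by (intro mult_left_mono) auto
        finally show ?case by (simp add: mult_ac)
      qed simp
      moreover have "(\<lambda>n. \<kappa> ^ n * \<bar>y - p\<bar>) \<longlonglongrightarrow> 0"
        using lam by (intro tendsto_mult_left_zero LIMSEQ_realpow_zero) auto
      ultimately have "(\<lambda>n. (g ^^ n) y - p) \<longlonglongrightarrow> 0"
        by (intro Lim_null_comparison[of "\<lambda>n. (g ^^ n) y - p"]) auto
      then show "(\<lambda>n. (g ^^ n) y) \<longlonglongrightarrow> p" by (rule LIM_zero_cancel)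
    qed
    ultimately have "\<bar>e y - e p\<bar> \<le> \<bar>e p - e p\<bar>" by (intro LIMSEQ_le_const) auto
    then show ?thesis by simp
  qed
  then have "w = (\<lambda>y. V y + e p)" by (auto simp: e_def fun_eq_iff algebra_simps)
  then have "(w has_real_derivative W y) (at y)" for y
    using V[of y] by (auto intro!: derivative_eq_intros)
  then show ?thesis using that W(1) by blast
qed

text \<open>When \<open>\<phi>\<close> is an invariant density with constant weights, \<open>w' / \<phi>\<close> is the derivative of \<open>w\<close>
  in the coordinate \<open>\<integral> \<phi>\<close>, in which \<open>F\<close> is affine. It satisfies a functional equation of the
  same form with \<open>A / d\<close> in place of \<open>A\<close>, so one derivative after the other can be gained.\<close>

lemma functional_equation_regularity:
  assumes \<phi>: "cts_periodic \<phi>" "\<And>t. \<phi> t > 0" "\<And>t. real d * \<phi> t = F' t * \<phi> (F t)"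
    and C\<phi>: "C_real s \<phi>" and A: "0 < A" "A \<le> 1"
    and B: "C_real (Suc s) B" "\<And>y. B (y + real d) = B y"
    and w: "continuous_on UNIV w" "\<And>y. w y = A * w (g y) + B y"
  shows "C_real (Suc s) w"
  using C\<phi> A B w
proof (induction s arbitrary: A B w)
  note D = C_real_deriv
  have B'_per: "deriv B (y + real d) = deriv B y"
    if B: "C_real (Suc s) B" "\<And>y. B (y + real d) = B y" for s B y
  proof (rule DERIV_unique)
    show "((\<lambda>y. B (y + real d)) has_real_derivative deriv B (y + real d)) (at y)"
      using D(1)[OF B(1), of "y + real d"] by (simp add: DERIV_shift)
    show "((\<lambda>y. B (y + real d)) has_real_derivative deriv B y) (at y)"
      unfolding B(2) by (rule D(1)[OF B(1)])
  qed
  have C1: "\<exists>W. continuous_on UNIV W \<and> (\<forall>y. (w has_real_derivative W y) (at y))"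
    if A: "0 < A" "A \<le> 1" and B: "C_real (Suc s) B" "\<And>y. B (y + real d) = B y"
      and w: "continuous_on UNIV w" "\<And>y. w y = A * w (g y) + B y" for s A B w
  proof -
    have cB: "continuous_on UNIV (deriv B)" using C_real_continuous[OF D(2)[OF B(1)]] .
    obtain C where C: "\<And>y. \<bar>deriv B y\<bar> \<le> C"
      using continuous_periodic_bounded[OF cB, of "real d"] B'_per[where B = B and s = s, OF B] degree_pos
      by auto
    obtain W where "continuous_on UNIV W" "\<And>y. (w has_real_derivative W y) (at y)"
      using functional_equation_C1[where A = A and B = B and w = w, OF A D(1)[OF B(1)] cB C w] by metis
    then show ?thesis by blast
  qed
  {
    case 0
    from C1[where A = A and B = B and w = w, OF 0(2-)] obtain W where "continuous_on UNIV W" "\<And>y. (w has_real_derivative W y) (at y)"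
      by blast
    then show ?case using C_real_Suc[of w W 0] by (simp add: C_real_0)
  next
    case (Suc s)
    from C1[where A = A and B = B and w = w, OF Suc.prems(2-)] obtain W where W: "continuous_on UNIV W"
        "\<And>y. (w has_real_derivative W y) (at y)" by blast
    note B = Suc.prems(4,5)
    define z where "z y = W y / \<phi> y" for y
    have \<phi>nz: "\<phi> t \<noteq> 0" for t using \<phi>(2)[of t] by simp
    have Weq: "W y = A * (W (g y) * (1 / F' (g y))) + deriv B y" for y
    proof (rule DERIV_unique[OF W(2)])
      have "((\<lambda>y. A * w (g y) + B y) has_real_derivative A * (W (g y) * (1 / F' (g y))) + deriv B y) (at y)"
        by (intro DERIV_add DERIV_cmult DERIV_chain2[OF W(2) deriv_g] D(1)[OF B(1)])
      moreover have "w = (\<lambda>y. A * w (g y) + B y)" by (rule ext) (rule Suc.prems(7))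
      ultimately show "(w has_real_derivative A * (W (g y) * (1 / F' (g y))) + deriv B y) (at y)"
        by simp
    qed
    have zeq: "z y = A / real d * z (g y) + deriv B y / \<phi> y" for y
    proof -
      have "\<phi> y = real d * \<phi> (g y) / F' (g y)"
        using \<phi>(3)[of "g y"] deriv_pos[of "g y"] by (simp add: field_simps)
      then have "A * (W (g y) * (1 / F' (g y))) / \<phi> y = A / real d * z (g y)"
        using deriv_pos[of "g y"] degree_pos \<phi>nz[of "g y"] by (simp add: z_def)
      then show ?thesis unfolding z_def using Weq[of y] by (simp add: add_divide_distrib)
    qed
    have "C_real (Suc s) z"
    proof (rule Suc.IH[where A = "A / real d" and B = "\<lambda>y. deriv B y / \<phi> y", OF _ _ _ _ _ _ zeq])
      show "C_real s \<phi>" using Suc.prems(1) by (rule C_real_SucD)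
      have "1 \<le> real d" using degree_pos by simp
      then show "0 < A / real d" "A / real d \<le> 1"
        using Suc.prems(2,3) by (simp_all add: divide_le_eq)
      show "C_real (Suc s) (\<lambda>y. deriv B y / \<phi> y)"
        using D(2)[OF B(1)] Suc.prems(1) \<phi>nz by (rule C_real_divide)
      show "deriv B (y + real d) / \<phi> (y + real d) = deriv B y / \<phi> y" for y
        using B'_per[where B = B, OF B] cts_periodic_add_int[OF \<phi>(1), of y "int d"] by simp
      show "continuous_on UNIV z" unfolding z_def
        using W(1) cts_periodic_continuous[OF \<phi>(1)] \<phi>nz by (intro continuous_on_divide) auto
    qed
    then have "C_real (Suc s) (\<lambda>y. z y * \<phi> y)" using Suc.prems(1) by (rule C_real_mult)
    moreover have "(\<lambda>y. z y * \<phi> y) = W" using \<phi>nz by (auto simp: z_def)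
    ultimately show ?case using C_real_Suc[OF W(2)] by simp
  }
qed

text \<open>The logarithm turns the invariance of \<open>\<phi>\<close> into an additive equation with \<open>A = 1\<close>. Once \<open>\<phi>\<close> has \<open>s\<close>
  derivatives, \<open>ln \<phi>\<close> has \<open>s + 1\<close> of them.\<close>

theorem density_regularity:
  assumes \<phi>: "cts_periodic \<phi>" "\<And>t. \<phi> t > 0" "\<And>t. real d * \<phi> t = F' t * \<phi> (F t)"
    and F': "C_real s F'"
  shows "C_real s \<phi>"
  using F'
proof (induction s)
  case 0
  show ?case using \<phi>(1) by (simp add: C_real_0 cts_periodic_continuous)
next
  case (Suc s)
  define B where "B y = ln (real d) + (- 1) * ln (F' (g y))" for y
  have "C_real (Suc s) (\<lambda>y. ln (\<phi> y))"
  proof (rule functional_equation_regularity[OF \<phi>, where A = 1 and B = B])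
    show "C_real s \<phi>" using Suc.IH C_real_SucD[OF Suc.prems] by blast
    have "C_real (Suc s) g"
      by (rule C_real_inverse_function[of g F'])
         (use deriv_g deriv_pos C_real_SucD[OF Suc.prems] in \<open>auto simp: less_imp_neq[THEN not_sym]\<close>)
    then show "C_real (Suc s) B" unfolding B_def
      by (intro C_real_add C_real_mult C_real_const C_real_ln deriv_pos C_real_comp[of _ F' g] Suc.prems)
    show "B (y + real d) = B y" for y by (simp add: B_def g_add_degree deriv_periodic)
    show "continuous_on UNIV (\<lambda>y. ln (\<phi> y))"
      by (intro cts_periodic_continuous cts_periodic_ln \<phi>)
    show "ln (\<phi> y) = 1 * ln (\<phi> (g y)) + B y" for y
    proof -
      have "\<phi> y = real d * \<phi> (g y) / F' (g y)"
        using \<phi>(3)[of "g y"] deriv_pos[of "g y"] by (simp add: field_simps)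
      then show ?thesis using deriv_pos[of "g y"] degree_pos \<phi>(2)[of "g y"]
        by (simp add: B_def ln_div ln_mult)
    qed
  qed auto
  from C_real_comp[OF C_real_exp this] show ?case using \<phi>(2) by simp
qed

end

section \<open>The exponent of a positive continuous density\<close>

locale stationary_random_lifts = random_lifts +
  fixes \<phi> :: "real \<Rightarrow> real"
  assumes density: "cts_periodic \<phi>" and density_pos: "\<And>t. \<phi> t > 0"
    and density_integral: "integral {0..1} \<phi> = 1"
    and density_stationary: "\<And>v. cts_periodic v \<Longrightarrow>
      integral {0..1} (\<lambda>t. v t * \<phi> t) = (1 / real m) * (\<Sum>i=1..m. integral {0..1} (\<lambda>t. v (F i t) * \<phi> t))"
begin

text \<open>The Lyapunov exponent of the stationary measure, read off in the universal cover.\<close>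

definition exponent :: real where
  "exponent = (1 / real m) * (\<Sum>i=1..m. integral {0..1} (\<lambda>t. ln (F' i t) * \<phi> t))"

text \<open>Stationarity makes the averages of \<open>v\<close> and of \<open>v \<circ> F\<^sub>i\<close> cancel.\<close>

lemma exponent_coboundary:
  assumes v: "cts_periodic v" and e: "\<And>i. i \<in> {1..m} \<Longrightarrow> cts_periodic (e i)"
    and eq: "\<And>i t. i \<in> {1..m} \<Longrightarrow> ln (F' i t) = a i + v t - v (F i t) + e i t"
  shows "exponent = (1 / real m) * (\<Sum>i=1..m. a i)
    + (1 / real m) * (\<Sum>i=1..m. integral {0..1} (\<lambda>t. e i t * \<phi> t))"
proof -
  have "integral {0..1} (\<lambda>t. ln (F' i t) * \<phi> t) = a i + integral {0..1} (\<lambda>t. v t * \<phi> t)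
      - integral {0..1} (\<lambda>t. v (F i t) * \<phi> t) + integral {0..1} (\<lambda>t. e i t * \<phi> t)"
    if i: "i \<in> {1..m}" for i
  proof -
    note int = has_integral_integral[THEN iffD1, OF integrable_cts_periodic[OF cts_periodic_mult[OF _ density]]]
    have "((\<lambda>t. a i * \<phi> t) has_integral a i * integral {0..1} \<phi>) {0..1}"
      by (intro has_integral_mult_right integrable_integral integrable_cts_periodic density)
    from has_integral_add[OF has_integral_diff[OF has_integral_add[OF this int[OF v]]
          int[OF increasing_lift.cts_periodic_comp_lift[OF increasing[OF i] v]]] int[OF e[OF i]]]
    have "((\<lambda>t. ln (F' i t) * \<phi> t) has_integral (a i + integral {0..1} (\<lambda>t. v t * \<phi> t)
      - integral {0..1} (\<lambda>t. v (F i t) * \<phi> t) + integral {0..1} (\<lambda>t. e i t * \<phi> t))) {0..1}"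
      by (rule has_integral_eq_rhs[OF has_integral_eq[rotated]]) (auto simp: eq[OF i] algebra_simps density_integral)
    then show ?thesis by (rule integral_unique)
  qed
  then have "(\<Sum>i=1..m. integral {0..1} (\<lambda>t. ln (F' i t) * \<phi> t))
    = (\<Sum>i=1..m. a i + integral {0..1} (\<lambda>t. v t * \<phi> t)
      - integral {0..1} (\<lambda>t. v (F i t) * \<phi> t) + integral {0..1} (\<lambda>t. e i t * \<phi> t))"
    by (intro sum.cong) auto
  also have "\<dots> = (\<Sum>i=1..m. a i) + real m * integral {0..1} (\<lambda>t. v t * \<phi> t)
      - (\<Sum>i=1..m. integral {0..1} (\<lambda>t. v (F i t) * \<phi> t)) + (\<Sum>i=1..m. integral {0..1} (\<lambda>t. e i t * \<phi> t))"
    by (simp add: sum.distrib sum_subtractf)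
  also have "real m * integral {0..1} (\<lambda>t. v t * \<phi> t) = (\<Sum>i=1..m. integral {0..1} (\<lambda>t. v (F i t) * \<phi> t))"
    using density_stationary[OF v] m_pos by simp
  finally show ?thesis by (simp add: exponent_def distrib_left)
qed

text \<open>For an \<open>F\<^sub>i\<close>-invariant density \<open>\<phi>\<close>, conditioning on \<open>F\<^sub>i t\<close> gives its preimage \<open>t\<close> the probability
  \<open>\<phi> t / (F\<^sub>i' t * \<phi> (F\<^sub>i t))\<close>. The ratio compares the uniform probability \<open>1 / d\<^sub>i\<close> with this one.\<close>

definition weight_ratio :: "nat \<Rightarrow> real \<Rightarrow> real" where
  "weight_ratio i t = F' i t * \<phi> (F i t) / (real (d i) * \<phi> t)"

lemma weight_ratio_pos: "i \<in> {1..m} \<Longrightarrow> 0 < weight_ratio i t"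
  using increasing_lift.deriv_pos[OF increasing] increasing_lift.degree_pos[OF increasing] density_pos
  by (simp add: weight_ratio_def)

lemma weight_ratio_cts_periodic:
  assumes i: "i \<in> {1..m}" shows "cts_periodic (weight_ratio i)"
  unfolding weight_ratio_def
  using increasing_lift.degree_pos[OF increasing[OF i]] density_pos
  by (intro cts_periodic_divide cts_periodic_mult cts_periodic_const density
      increasing_lift.cts_periodic_deriv[OF increasing[OF i]]
      increasing_lift.cts_periodic_comp_lift[OF increasing[OF i]])
     (auto simp: less_imp_neq[THEN not_sym])

text \<open>After the substitution \<open>y = F\<^sub>i t\<close> the density is integrated over \<open>d\<^sub>i\<close> periods.\<close>

lemma weight_ratio_integral:
  assumes i: "i \<in> {1..m}"
  shows "integral {0..1} (\<lambda>t. weight_ratio i t * \<phi> t) = 1"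
proof -
  interpret increasing_lift "F i" "F' i" "d i" by (rule increasing[OF i])
  have "integral {0..1} (\<lambda>t. weight_ratio i t * \<phi> t)
      = integral {0..1} (\<lambda>t. (1 / real (d i)) * (\<phi> (F i t) * F' i t))"
    using density_pos by (simp add: weight_ratio_def less_imp_neq[THEN not_sym] mult.commute)
  also have "\<dots> = (1 / real (d i)) * integral {0..1} (\<lambda>t. \<phi> (F i t) * F' i t)"
    by (rule integral_mult_right)
  also have "integral {0..1} (\<lambda>t. \<phi> (F i t) * F' i t) = integral {F i 0..F i 1} \<phi>"
    by (rule integral_comp_lift) (auto intro: cts_periodic_continuous density)
  also have "F i 1 = F i 0 + real (d i)" using degree[of 0] by simp
  also have "integral {F i 0..F i 0 + real (d i)} \<phi> = real (d i)"
    by (simp add: integral_periods[OF density] density_integral)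
  finally show ?thesis using degree_pos by simp
qed

text \<open>The mean of the weight ratio \<open>w\<close> is 1, so that \<open>ln w\<close> in the coboundary identity for
  \<open>v = ln \<circ> \<phi>\<close> may be replaced by \<open>- (w - 1 - ln w)\<close>, which is nonpositive.\<close>

lemma exponent_formula:
  "exponent = (1 / real m) * (\<Sum>i=1..m. ln (real (d i)))
     - (1 / real m) * (\<Sum>i=1..m. integral {0..1} (\<lambda>t. (weight_ratio i t - 1 - ln (weight_ratio i t)) * \<phi> t))"
proof -
  have "exponent = (1 / real m) * (\<Sum>i=1..m. ln (real (d i)))
    + (1 / real m) * (\<Sum>i=1..m. integral {0..1} (\<lambda>t. ln (weight_ratio i t) * \<phi> t))"
  proof (rule exponent_coboundary)
    show "cts_periodic (\<lambda>t. ln (\<phi> t))" by (rule cts_periodic_ln[OF density density_pos])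
    show "cts_periodic (\<lambda>t. ln (weight_ratio i t))" if "i \<in> {1..m}" for i
      by (rule cts_periodic_ln[OF weight_ratio_cts_periodic[OF that] weight_ratio_pos[OF that]])
    show "ln (F' i t) = ln (real (d i)) + ln (\<phi> t) - ln (\<phi> (F i t)) + ln (weight_ratio i t)"
      if i: "i \<in> {1..m}" for i t
      using increasing_lift.deriv_pos[OF increasing[OF i], of t] increasing_lift.degree_pos[OF increasing[OF i]]
        density_pos[of t] density_pos[of "F i t"]
      by (simp add: weight_ratio_def ln_div ln_mult)
  qed
  moreover have "integral {0..1} (\<lambda>t. (weight_ratio i t - 1 - ln (weight_ratio i t)) * \<phi> t)
      = - integral {0..1} (\<lambda>t. ln (weight_ratio i t) * \<phi> t)" if i: "i \<in> {1..m}" for i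
  proof -
    note int = has_integral_integral[THEN iffD1, OF integrable_cts_periodic[OF cts_periodic_mult[OF _ density]]]
    have "cts_periodic (\<lambda>t. ln (weight_ratio i t))"
      by (rule cts_periodic_ln[OF weight_ratio_cts_periodic[OF i] weight_ratio_pos[OF i]])
    from has_integral_diff[OF has_integral_diff[OF int[OF weight_ratio_cts_periodic[OF i]]
        integrable_integral[OF integrable_cts_periodic[OF density]]] int[OF this]]
    have "((\<lambda>t. (weight_ratio i t - 1 - ln (weight_ratio i t)) * \<phi> t) has_integral
        - integral {0..1} (\<lambda>t. ln (weight_ratio i t) * \<phi> t)) {0..1}"
      by (rule has_integral_eq_rhs[OF has_integral_eq[rotated]])
         (simp_all add: left_diff_distrib density_integral weight_ratio_integral[OF i])
    then show ?thesis by (rule integral_unique)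
  qed
  ultimately show ?thesis by (simp add: sum_negf cong: sum.cong_simp)
qed

lemma deficit_nonneg:
  assumes i: "i \<in> {1..m}"
  shows "0 \<le> (weight_ratio i t - 1 - ln (weight_ratio i t)) * \<phi> t"
  using ln_le_minus_one[OF weight_ratio_pos[OF i, of t]] density_pos[of t] by simp

lemma deficit_cts_periodic:
  assumes i: "i \<in> {1..m}"
  shows "cts_periodic (\<lambda>t. (weight_ratio i t - 1 - ln (weight_ratio i t)) * \<phi> t)"
  by (intro cts_periodic_mult cts_periodic_diff cts_periodic_const density
      cts_periodic_ln weight_ratio_cts_periodic[OF i] weight_ratio_pos[OF i])

lemma deficit_integral_nonneg:
  "i \<in> {1..m} \<Longrightarrow> 0 \<le> integral {0..1} (\<lambda>t. (weight_ratio i t - 1 - ln (weight_ratio i t)) * \<phi> t)"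
  by (intro integral_nonneg integrable_cts_periodic deficit_cts_periodic deficit_nonneg)

theorem exponent_le: "exponent \<le> (1 / real m) * (\<Sum>i=1..m. ln (real (d i)))"
proof -
  have "0 \<le> (1 / real m)
      * (\<Sum>i=1..m. integral {0..1} (\<lambda>t. (weight_ratio i t - 1 - ln (weight_ratio i t)) * \<phi> t))"
    by (intro mult_nonneg_nonneg sum_nonneg deficit_integral_nonneg) auto
  then show ?thesis unfolding exponent_formula by linarith
qed

text \<open>Equality forces every one of the nonnegative continuous deficits to vanish identically, and
  \<open>ln w = w - 1\<close> holds only at \<open>w = 1\<close>.\<close>

theorem exponent_eq_imp:
  assumes eq: "exponent = (1 / real m) * (\<Sum>i=1..m. ln (real (d i)))" and i: "i \<in> {1..m}"
  shows "real (d i) * \<phi> t = F' i t * \<phi> (F i t)"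
proof -
  have "(\<Sum>i=1..m. integral {0..1} (\<lambda>t. (weight_ratio i t - 1 - ln (weight_ratio i t)) * \<phi> t)) = 0"
    using eq m_pos unfolding exponent_formula by simp
  then have "integral {0..1} (\<lambda>t. (weight_ratio i t - 1 - ln (weight_ratio i t)) * \<phi> t) = 0"
    using i deficit_integral_nonneg by (subst (asm) sum_nonneg_eq_0_iff) auto
  then have "(weight_ratio i t - 1 - ln (weight_ratio i t)) * \<phi> t = 0"
    by (rule integral_nonneg_eq_0[OF deficit_cts_periodic[OF i] deficit_nonneg[OF i]])
  then have "ln (weight_ratio i t) = weight_ratio i t - 1" using density_pos[of t] by simp
  then have "weight_ratio i t = 1" by (rule ln_eq_minus_one[OF weight_ratio_pos[OF i]])
  then show ?thesis
    using density_pos[of t] increasing_lift.degree_pos[OF increasing[OF i]]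
    by (simp add: weight_ratio_def divide_eq_eq split: if_splits)
qed

end

section \<open>Functions and measures on the circle\<close>

definition circle_rep :: "circle \<Rightarrow> real" where
  "circle_rep x = (SOME t. circle_of t = x)"

lemma circle_of_rep [simp]: "circle_of (circle_rep x) = x"
  unfolding circle_rep_def by (rule someI_ex[OF circle_of_surj])

lemma periodic_rep:
  assumes "\<And>t. v (t + 1) = v t"
  shows "v (circle_rep (circle_of t)) = v t"
proof -
  have "circle_rep (circle_of t) - t \<in> \<int>" by (simp add: circle_of_eq_iff[symmetric])
  then obtain k where "circle_rep (circle_of t) - t = of_int k" by (rule Ints_cases)
  then have "circle_rep (circle_of t) = t + of_int k" by simp
  then show ?thesis using periodic_add_int[of v t k] assms by simp
qed

lemma cts_periodic_rep: "cts_periodic v \<Longrightarrow> v (circle_rep (circle_of t)) = v t"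
  by (rule periodic_rep) (simp add: cts_periodic_def)

lemma continuous_on_circleI:
  fixes V :: "circle \<Rightarrow> 'a::topological_space"
  assumes "continuous_on UNIV (\<lambda>t. V (circle_of t))"
  shows "continuous_on UNIV V"
proof -
  have "open (V -` U)" if "open U" for U
    using assms that by (simp add: continuous_on_open_vimage open_circle_def vimage_def)
  then show ?thesis by (simp add: continuous_on_open_vimage)
qed

lemma cts_periodic_circle_of:
  assumes "continuous_on UNIV V" shows "cts_periodic (\<lambda>t. V (circle_of t))"
proof (rule cts_periodicI)
  show "continuous_on UNIV (\<lambda>t. V (circle_of t))"
    by (rule continuous_on_compose2[OF assms continuous_circle_of]) auto
  show "V (circle_of (t + 1)) = V (circle_of t)" for t
    using circle_of_add_int[of t 1] by simp
qed

lemma cts_periodic_continuous_rep: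
  assumes "cts_periodic v" shows "continuous_on UNIV (\<lambda>x. v (circle_rep x))"
  using assms by (intro continuous_on_circleI) (simp add: cts_periodic_rep cts_periodic_continuous)

lemma borel_measurable_circle: "continuous_on UNIV (V :: circle \<Rightarrow> real) \<Longrightarrow> V \<in> borel_measurable borel"
  by (rule borel_measurable_continuous_onI)

lemma circle_continuous_bounded:
  assumes "continuous_on UNIV (V :: circle \<Rightarrow> real)" shows "\<exists>B. \<forall>x. \<bar>V x\<bar> \<le> B"
  using cts_periodic_bounded[OF cts_periodic_circle_of[OF assms]] by (metis circle_of_rep)

lemma circle_of_measurable [measurable]: "circle_of \<in> borel_measurable borel"
  by (rule borel_measurable_continuous_onI[OF continuous_circle_of])

lemma sets_circle_lebesgue [simp, measurable_cong]: "sets circle_lebesgue = sets borel"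
  by (simp add: circle_lebesgue_def)

lemma space_circle_lebesgue [simp]: "space circle_lebesgue = UNIV"
  by (simp add: circle_lebesgue_def)

lemma circle_of_measurable_interval: "circle_of \<in> restrict_space lborel {0..<1} \<rightarrow>\<^sub>M borel"
  by (intro measurable_restrict_space1) simp

lemma prob_space_circle_lebesgue: "prob_space circle_lebesgue"
proof -
  have "prob_space (restrict_space lborel {0..<1::real})"
    by (intro prob_spaceI) (simp add: space_restrict_space emeasure_restrict_space)
  then show ?thesis unfolding circle_lebesgue_def
    by (rule prob_space.prob_space_distr[OF _ circle_of_measurable_interval])
qed

interpretation circle_lebesgue: prob_space circle_lebesgue
  by (rule prob_space_circle_lebesgue)

lemma integrable_circle_indicator:
  "A \<in> sets borel \<Longrightarrow> integrable circle_lebesgue (indicator A :: circle \<Rightarrow> real)"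
  by (intro integrable_real_indicator) (auto simp: less_top[symmetric])

lemma integrable_circle_continuous:
  assumes "continuous_on UNIV (V :: circle \<Rightarrow> real)" "finite_measure M" "sets M = sets borel"
  shows "integrable M V"
proof -
  obtain B where "\<And>x. \<bar>V x\<bar> \<le> B" using circle_continuous_bounded[OF assms(1)] by blast
  then show ?thesis
    using borel_measurable_circle[OF assms(1)] assms(3)
    by (intro finite_measure.integrable_const_bound[OF assms(2), of _ B])
       (auto cong: measurable_cong_sets)
qed

text \<open>Circle integrals of continuous functions become gauge integrals over a closed period; the added
  endpoint is a null set.\<close>

lemma integral_circle_lebesgue:
  assumes V: "continuous_on UNIV (V :: circle \<Rightarrow> real)"
  shows "(\<integral>x. V x \<partial>circle_lebesgue) = integral {0..1} (\<lambda>t. V (circle_of t))"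
proof -
  let ?v = "\<lambda>t. V (circle_of t)"
  have v: "cts_periodic ?v" by (rule cts_periodic_circle_of[OF V])
  have "(\<integral>x. V x \<partial>circle_lebesgue) = (\<integral>t. ?v t \<partial>restrict_space lborel {0..<1})"
    unfolding circle_lebesgue_def
    by (rule integral_distr[OF circle_of_measurable_interval borel_measurable_circle[OF V]])
  also have "\<dots> = (LINT t:{0..<1}|lborel. ?v t)"
    by (simp add: integral_restrict_space set_lebesgue_integral_def)
  also have "\<dots> = (LINT t:{0..1}|lborel. ?v t)"
  proof -
    have "AE t in lborel. indicator {0..<1} t *\<^sub>R ?v t = indicator {0..1} t *\<^sub>R ?v t"
      using AE_lborel_singleton[of "1::real"] by eventually_elim (auto simp: indicator_def)
    moreover have "?v \<in> borel_measurable borel"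
      using cts_periodic_continuous[OF v] by (rule borel_measurable_continuous_onI)
    ultimately show ?thesis unfolding set_lebesgue_integral_def
      by (intro integral_cong_AE) auto
  qed
  also have "\<dots> = integral {0..1} ?v"
    by (intro set_borel_integral_eq_integral borel_integrable_compact[unfolded set_integrable_def[symmetric]]
      borel_integrable_atLeastAtMost' cts_periodic_continuous v)
  finally show ?thesis .
qed

section \<open>Approximation by Lipschitz functions\<close>

text \<open>Lipschitz continuity is measured in the universal cover, which spares a metric on the circle.\<close>

definition circle_lipschitz :: "(circle \<Rightarrow> real) \<Rightarrow> bool" where
  "circle_lipschitz V \<longleftrightarrow> (\<exists>C. C-lipschitz_on UNIV (\<lambda>t. V (circle_of t)))"

lemma circle_lipschitz_continuous: "circle_lipschitz V \<Longrightarrow> continuous_on UNIV V"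
  unfolding circle_lipschitz_def by (intro continuous_on_circleI) (auto intro: lipschitz_on_continuous_on)

lemma circle_lipschitz_integrable: "circle_lipschitz V \<Longrightarrow> integrable circle_lebesgue V"
  by (intro integrable_circle_continuous circle_lipschitz_continuous circle_lebesgue.finite_measure_axioms) auto

definition lipschitz_approximable :: "(circle \<Rightarrow> real) \<Rightarrow> bool" where
  "lipschitz_approximable f \<longleftrightarrow> integrable circle_lebesgue f \<and>
     (\<forall>\<epsilon>>0. \<exists>V. circle_lipschitz V \<and> (\<integral>x. \<bar>f x - V x\<bar> \<partial>circle_lebesgue) < \<epsilon>)"

lemma lipschitz_approximable_lipschitz: "circle_lipschitz V \<Longrightarrow> lipschitz_approximable V"
  unfolding lipschitz_approximable_def using circle_lipschitz_integrable by (auto intro!: exI[of _ V])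

lemma lipschitz_approximable_const: "lipschitz_approximable (\<lambda>_. c)"
  by (rule lipschitz_approximable_lipschitz)
     (auto simp: circle_lipschitz_def intro!: exI[of _ 0] lipschitz_on_constant)

lemma lipschitz_approximable_add:
  assumes f: "lipschitz_approximable f" and g: "lipschitz_approximable g"
  shows "lipschitz_approximable (\<lambda>x. f x + g x)"
  unfolding lipschitz_approximable_def
proof (intro conjI allI impI)
  have int: "integrable circle_lebesgue f" "integrable circle_lebesgue g"
    using f g by (auto simp: lipschitz_approximable_def)
  then show "integrable circle_lebesgue (\<lambda>x. f x + g x)" by simp
  fix \<epsilon> :: real assume "\<epsilon> > 0"
  then have "\<epsilon> / 2 > 0" by simp
  obtain V where V: "circle_lipschitz V" "(\<integral>x. \<bar>f x - V x\<bar> \<partial>circle_lebesgue) < \<epsilon> / 2"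
    using f \<open>\<epsilon> / 2 > 0\<close> unfolding lipschitz_approximable_def by blast
  obtain W where W: "circle_lipschitz W" "(\<integral>x. \<bar>g x - W x\<bar> \<partial>circle_lebesgue) < \<epsilon> / 2"
    using g \<open>\<epsilon> / 2 > 0\<close> unfolding lipschitz_approximable_def by blast
  note [simp] = int circle_lipschitz_integrable[OF V(1)] circle_lipschitz_integrable[OF W(1)]
  have "(\<integral>x. \<bar>f x + g x - (V x + W x)\<bar> \<partial>circle_lebesgue)
      \<le> (\<integral>x. \<bar>f x - V x\<bar> + \<bar>g x - W x\<bar> \<partial>circle_lebesgue)"
    by (rule integral_mono) auto
  also have "\<dots> = (\<integral>x. \<bar>f x - V x\<bar> \<partial>circle_lebesgue) + (\<integral>x. \<bar>g x - W x\<bar> \<partial>circle_lebesgue)"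
    by (rule Bochner_Integration.integral_add) auto
  also have "\<dots> < \<epsilon>" using V(2) W(2) by simp
  finally have "(\<integral>x. \<bar>f x + g x - (V x + W x)\<bar> \<partial>circle_lebesgue) < \<epsilon>" .
  moreover have "circle_lipschitz (\<lambda>x. V x + W x)"
    using V(1) W(1) unfolding circle_lipschitz_def by (auto intro: lipschitz_on_add)
  ultimately show "\<exists>V. circle_lipschitz V \<and> (\<integral>x. \<bar>f x + g x - V x\<bar> \<partial>circle_lebesgue) < \<epsilon>"
    by (intro exI[of _ "\<lambda>x. V x + W x"]) simp
qed

lemma lipschitz_approximable_cmult:
  assumes f: "lipschitz_approximable f"
  shows "lipschitz_approximable (\<lambda>x. c * f x)"
  unfolding lipschitz_approximable_def
proof (intro conjI allI impI)
  have int: "integrable circle_lebesgue f" using f by (auto simp: lipschitz_approximable_def)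
  then show "integrable circle_lebesgue (\<lambda>x. c * f x)" by simp
  fix \<epsilon> :: real assume "\<epsilon> > 0"
  then have "\<epsilon> / (\<bar>c\<bar> + 1) > 0" by simp
  then obtain V where V: "circle_lipschitz V" "(\<integral>x. \<bar>f x - V x\<bar> \<partial>circle_lebesgue) < \<epsilon> / (\<bar>c\<bar> + 1)"
    using f unfolding lipschitz_approximable_def by blast
  have "(\<integral>x. \<bar>c * f x - c * V x\<bar> \<partial>circle_lebesgue) = \<bar>c\<bar> * (\<integral>x. \<bar>f x - V x\<bar> \<partial>circle_lebesgue)"
    by (simp add: right_diff_distrib[symmetric] abs_mult del: right_diff_distrib)
  also have "\<dots> \<le> (\<bar>c\<bar> + 1) * (\<integral>x. \<bar>f x - V x\<bar> \<partial>circle_lebesgue)"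
    by (intro mult_right_mono integral_nonneg_AE) auto
  also have "\<dots> < \<epsilon>" using V(2) by (simp add: field_simps)
  finally have "(\<integral>x. \<bar>c * f x - c * V x\<bar> \<partial>circle_lebesgue) < \<epsilon>" .
  moreover have "circle_lipschitz (\<lambda>x. c * V x)"
    using V(1) unfolding circle_lipschitz_def by (auto intro: lipschitz_on_cmult_real)
  ultimately show "\<exists>V. circle_lipschitz V \<and> (\<integral>x. \<bar>c * f x - V x\<bar> \<partial>circle_lebesgue) < \<epsilon>"
    by (intro exI[of _ "\<lambda>x. c * V x"]) simp
qed

text \<open>Dominated convergence makes the class of approximable functions closed under bounded pointwise
  limits; being a linear space, it contains all integrable functions once it contains indicators.\<close>

lemma lipschitz_approximable_limit:
  assumes s: "\<And>i. lipschitz_approximable (s i)" and f: "integrable circle_lebesgue f"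
    and w: "integrable circle_lebesgue w" "\<And>i x. \<bar>s i x\<bar> \<le> w x"
    and lim: "\<And>x. (\<lambda>i. s i x) \<longlonglongrightarrow> f x"
  shows "lipschitz_approximable f"
  unfolding lipschitz_approximable_def
proof (intro conjI allI impI f)
  fix \<epsilon> :: real assume "\<epsilon> > 0"
  have int: "integrable circle_lebesgue (s i)" for i using s by (auto simp: lipschitz_approximable_def)
  note [measurable] = borel_measurable_integrable[OF f] borel_measurable_integrable[OF int]
  have "(\<lambda>i. \<integral>x. \<bar>f x - s i x\<bar> \<partial>circle_lebesgue) \<longlonglongrightarrow> (\<integral>x. 0 \<partial>circle_lebesgue)"
  proof (rule integral_dominated_convergence[where w = "\<lambda>x. \<bar>f x\<bar> + w x"])
    show "AE x in circle_lebesgue. (\<lambda>i. \<bar>f x - s i x\<bar>) \<longlonglongrightarrow> 0"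
    proof (rule AE_I2)
      fix x
      have "(\<lambda>i. \<bar>f x - s i x\<bar>) \<longlonglongrightarrow> \<bar>f x - f x\<bar>" by (intro tendsto_intros lim)
      then show "(\<lambda>i. \<bar>f x - s i x\<bar>) \<longlonglongrightarrow> 0" by simp
    qed
    show "AE x in circle_lebesgue. norm \<bar>f x - s i x\<bar> \<le> \<bar>f x\<bar> + w x" for i
      using w(2)[of i] by (intro AE_I2) (smt (verit) real_norm_def)
  qed (use f w in auto)
  then have "eventually (\<lambda>i. (\<integral>x. \<bar>f x - s i x\<bar> \<partial>circle_lebesgue) < \<epsilon> / 2) sequentially"
    using \<open>\<epsilon> > 0\<close> by (intro order_tendstoD) auto
  then obtain i where i: "(\<integral>x. \<bar>f x - s i x\<bar> \<partial>circle_lebesgue) < \<epsilon> / 2"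
    by (auto simp: eventually_sequentially)
  have "\<epsilon> / 2 > 0" using \<open>\<epsilon> > 0\<close> by simp
  then obtain V where V: "circle_lipschitz V" "(\<integral>x. \<bar>s i x - V x\<bar> \<partial>circle_lebesgue) < \<epsilon> / 2"
    using s[of i] unfolding lipschitz_approximable_def by blast
  note [simp] = f int circle_lipschitz_integrable[OF V(1)]
  have "(\<integral>x. \<bar>f x - V x\<bar> \<partial>circle_lebesgue) \<le> (\<integral>x. \<bar>f x - s i x\<bar> + \<bar>s i x - V x\<bar> \<partial>circle_lebesgue)"
    by (rule integral_mono) auto
  also have "\<dots> = (\<integral>x. \<bar>f x - s i x\<bar> \<partial>circle_lebesgue) + (\<integral>x. \<bar>s i x - V x\<bar> \<partial>circle_lebesgue)"
    by (rule Bochner_Integration.integral_add) auto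
  also have "\<dots> < \<epsilon>" using V(2) i by simp
  finally show "\<exists>V. circle_lipschitz V \<and> (\<integral>x. \<bar>f x - V x\<bar> \<partial>circle_lebesgue) < \<epsilon>"
    using V(1) by blast
qed

text \<open>The indicator of an open set is the increasing limit of truncated multiples of the distance
  to the complement; the distance is measured in the universal cover.\<close>

lemma lipschitz_approximable_open:
  assumes U: "open U" shows "lipschitz_approximable (indicator U)"
proof (cases "U = UNIV")
  case True
  then show ?thesis using lipschitz_approximable_const[of 1] by simp
next
  case False
  define Z where "Z = - (circle_of -` U)"
  have "closed Z" using U by (simp add: Z_def open_circle_def closed_open)
  have "Z \<noteq> {}"
  proof -
    obtain x where "x \<notin> U" using False by blast
    then have "circle_rep x \<in> Z" by (simp add: Z_def)
    then show ?thesis by blast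
  qed
  have "infdist (t + 1) Z = infdist t Z" for t
  proof -
    have "Z = (\<lambda>z. z + 1) ` Z"
    proof (intro set_eqI iffI)
      fix z assume "z \<in> Z"
      then have "z - 1 \<in> Z" using circle_of_add_int[of z "-1"] by (simp add: Z_def)
      then show "z \<in> (\<lambda>z. z + 1) ` Z" by (rule image_eqI[rotated]) simp
    qed (use circle_of_add_int[of _ 1] in \<open>auto simp: Z_def\<close>)
    then have "(\<lambda>a. dist (t + 1) a) ` Z = (\<lambda>a. dist (t + 1) a) ` (\<lambda>z. z + 1) ` Z" by simp
    also have "\<dots> = (\<lambda>a. dist t a) ` Z" by (simp add: image_image dist_real_def)
    finally show ?thesis using \<open>Z \<noteq> {}\<close> by (simp add: infdist_def)
  qed
  then have rep: "infdist (circle_rep (circle_of t)) Z = infdist t Z" for t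
    by (rule periodic_rep)
  define s where "s n x = min 1 (real n * infdist (circle_rep x) Z)" for n :: nat and x
  have sl: "circle_lipschitz (s n)" for n
    unfolding circle_lipschitz_def
  proof (intro exI lipschitz_onI)
    fix t u
    have "\<bar>real n * infdist t Z - real n * infdist u Z\<bar> \<le> real n * dist t u"
      using infdist_triangle_abs[of t Z u]
      by (simp add: right_diff_distrib[symmetric] abs_mult mult_left_mono del: right_diff_distrib)
    then show "dist (s n (circle_of t)) (s n (circle_of u)) \<le> real n * dist t u"
      unfolding s_def rep dist_real_def by linarith
  qed simp
  have slim: "(\<lambda>n. s n x) \<longlonglongrightarrow> indicator U x" for x
  proof (cases "x \<in> U")
    case True
    then have "circle_rep x \<notin> Z" by (simp add: Z_def)
    then have pos: "infdist (circle_rep x) Z > 0"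
      by (rule infdist_pos_not_in_closed[OF \<open>closed Z\<close> \<open>Z \<noteq> {}\<close>])
    obtain N where N: "1 < real N * infdist (circle_rep x) Z"
      using reals_Archimedean3[OF pos] by auto
    have "s n x = 1" if "n \<ge> N" for n
    proof -
      have "real N * infdist (circle_rep x) Z \<le> real n * infdist (circle_rep x) Z"
        using that pos by (intro mult_right_mono) auto
      then show ?thesis using N by (simp add: s_def)
    qed
    then show ?thesis using True
      by (intro tendsto_eventually) (auto simp: eventually_sequentially)
  next
    case False
    then have "infdist (circle_rep x) Z = 0" by (simp add: Z_def)
    then show ?thesis using False by (simp add: s_def)
  qed
  have sb: "\<bar>s n x\<bar> \<le> 1" for n x
  proof -
    have "0 \<le> real n * infdist (circle_rep x) Z" by (simp add: infdist_nonneg)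
    then show ?thesis unfolding s_def by linarith
  qed
  show ?thesis
    by (rule lipschitz_approximable_limit[where s = s and w = "\<lambda>_. 1",
        OF lipschitz_approximable_lipschitz[OF sl] _ _ sb slim])
       (use U in \<open>auto intro!: integrable_circle_indicator\<close>)
qed

text \<open>The sets with approximable indicator form a Dynkin system containing the open sets, which are
  stable under intersection and generate the Borel sets.\<close>

lemma lipschitz_approximable_indicator:
  assumes "A \<in> sets (borel :: circle measure)" shows "lipschitz_approximable (indicator A)"
proof -
  have "Int_stable {S :: circle set. open S}" "{S :: circle set. open S} \<subseteq> Pow UNIV"
    "A \<in> sigma_sets UNIV {S :: circle set. open S}"
    using assms by (auto simp: borel_def Int_stable_def)
  then show ?thesis
  proof (induction rule: sigma_sets_induct_disjoint)
    case (basic A)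
    then show ?case by (simp add: lipschitz_approximable_open)
  next
    case empty
    then show ?case using lipschitz_approximable_const[of 0] by simp
  next
    case (compl A)
    have "lipschitz_approximable (\<lambda>x. 1 + (- 1) * indicator A x)"
      by (intro lipschitz_approximable_add lipschitz_approximable_const lipschitz_approximable_cmult compl)
    moreover have "(\<lambda>x. 1 + (- 1) * indicator A x) = (indicator (UNIV - A) :: circle \<Rightarrow> real)"
      by (auto simp: indicator_def fun_eq_iff)
    ultimately show ?case by simp
  next
    case (union A)
    have sum: "(\<Sum>i<n. indicator (A i) x) = (indicator (\<Union>i<n. A i) x :: real)" for n x
      using union(1) by (subst indicator_UN_disjoint) (auto simp: disjoint_family_on_def)
    have meas: "A i \<in> sets borel" for i using union(2) by (auto simp: borel_def)
    have "lipschitz_approximable (\<lambda>x. \<Sum>i<n. indicator (A i) x)" for n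
    proof (induction n)
      case 0
      then show ?case using lipschitz_approximable_const[of 0] by simp
    next
      case (Suc n)
      then show ?case using lipschitz_approximable_add[OF Suc union(3)[of n]] by simp
    qed
    note 1 = this
    have 2: "(\<lambda>n. \<Sum>i<n. indicator (A i) x) \<longlonglongrightarrow> (indicator (\<Union>i. A i) x :: real)" for x
      unfolding sum by (rule LIMSEQ_indicator_UN)
    have 3: "\<bar>\<Sum>i<n. indicator (A i) x\<bar> \<le> (1 :: real)" for n x
      unfolding sum by (simp add: indicator_def)
    show ?case
      by (rule lipschitz_approximable_limit[where w = "\<lambda>_. 1", OF 1 _ _ 3 2])
         (use meas in \<open>auto intro!: integrable_circle_indicator\<close>)
  qed
qed

lemma integrable_lipschitz_approximable:
  assumes "integrable circle_lebesgue f" shows "lipschitz_approximable f"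
  using assms
proof (induction rule: integrable_induct)
  case (base A c)
  then show ?case
    using lipschitz_approximable_cmult[OF lipschitz_approximable_indicator, of A c] by (simp add: mult.commute)
next
  case (add f g)
  then show ?case by (simp add: lipschitz_approximable_add)
next
  case (lim f s)
  show ?case
    by (rule lipschitz_approximable_limit[of s f "\<lambda>x. 2 * \<bar>f x\<bar>"]) (use lim in auto)
qed

section \<open>Stationary measures\<close>

text \<open>The skew product \<open>walk_shift f\<close> preserves the product of the Bernoulli measure and \<open>\<mu>\<close>. Integrating a
  function of the second coordinate before and after one step of it gives the two sides.\<close>

lemma stationary_integral:
  assumes m: "1 \<le> m" and f: "\<And>i. i \<in> {1..m} \<Longrightarrow> f i \<in> borel_measurable borel"
    and st: "stationary m f \<mu>" and V: "V \<in> borel_measurable borel" "\<And>x. \<bar>V x\<bar> \<le> (B::real)"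
  shows "(\<integral>x. V x \<partial>\<mu>) = (1 / real m) * (\<Sum>i=1..m. \<integral>x. V (f i x) \<partial>\<mu>)"
proof -
  let ?N = "uniform_count_measure {1..m} :: nat measure"
  let ?S = "iid_uniform m"
  let ?P = "?S \<Otimes>\<^sub>M \<mu>"
  let ?T = "walk_shift f"
  have setsmu [measurable_cong]: "sets \<mu> = sets borel" using st by (simp add: stationary_def)
  interpret mu: prob_space \<mu> using st by (simp add: stationary_def)
  interpret N: prob_space ?N using m by (intro prob_space_uniform_count_measure) auto
  interpret Sq: sequence_space ?N by unfold_locales
  have S_def: "?S = PiM UNIV (\<lambda>_. ?N)" by (simp add: iid_uniform_def)
  interpret S: prob_space ?S unfolding S_def by (rule Sq.P.prob_space_axioms)
  interpret P: pair_prob_space ?S \<mu> by unfold_locales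
  have T [measurable]: "?T \<in> ?P \<rightarrow>\<^sub>M ?P" and inv: "distr ?P ?P ?T = ?P"
    using walk_shift_invariant[OF m f st] by auto
  have [measurable]: "V \<in> borel_measurable \<mu>" using V(1) by (simp cong: measurable_cong_sets add: setsmu)
  have [measurable]: "(\<lambda>p. V (snd p)) \<in> borel_measurable ?P" by measurable
  have int: "integrable ?P (\<lambda>p. V (snd p))" "integrable ?P (\<lambda>p. V (snd (?T p)))"
    by (rule P.integrable_const_bound[of _ B]; use V in simp)+
  have "(\<integral>x. V x \<partial>\<mu>) = (\<integral>\<omega>. \<integral>x. V (snd (\<omega>, x)) \<partial>\<mu> \<partial>?S)" by (simp add: S.prob_space)
  also have "\<dots> = (\<integral>p. V (snd p) \<partial>?P)" using int(1) by (rule P.integral_fst')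
  also have "\<dots> = (\<integral>p. V (snd p) \<partial>distr ?P ?P ?T)" by (simp add: inv)
  also have "\<dots> = (\<integral>p. V (snd (?T p)) \<partial>?P)" by (rule integral_distr) measurable
  also have "\<dots> = (\<integral>\<omega>. \<integral>x. V (snd (?T (\<omega>, x))) \<partial>\<mu> \<partial>?S)"
    using int(2) by (rule P.integral_fst'[symmetric])
  also have "\<dots> = (\<integral>\<omega>. (\<lambda>s. \<integral>x. V (f s x) \<partial>\<mu>) (\<omega> 0) \<partial>?S)" by (simp add: walk_shift_def)
  also have "\<dots> = (\<integral>s. (\<integral>x. V (f s x) \<partial>\<mu>) \<partial>distr ?S ?N (\<lambda>\<omega>. \<omega> 0))"
  proof (rule integral_distr[symmetric])
    show "(\<lambda>\<omega>. \<omega> 0) \<in> ?S \<rightarrow>\<^sub>M ?N"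
      unfolding S_def by (rule measurable_component_singleton) simp
    show "(\<lambda>s. \<integral>x. V (f s x) \<partial>\<mu>) \<in> borel_measurable ?N"
      by (simp add: uniform_count_measure_def point_measure_def measurable_def)
  qed
  also have "distr ?S ?N (\<lambda>\<omega>. \<omega> 0) = ?N"
    unfolding S_def by (rule Sq.PiM_component) simp
  also have "(\<integral>s. (\<integral>x. V (f s x) \<partial>\<mu>) \<partial>?N) = (1 / real m) * (\<Sum>i=1..m. \<integral>x. V (f i x) \<partial>\<mu>)"
    by (simp add: integral_uniform_count_measure)
  finally show ?thesis .
qed

text \<open>A Lipschitz function close in mean to the Radon-Nikodym density is cut off at \<open>0\<close>, which only brings
  it closer to that nonnegative density, and raised by \<open>\<epsilon> / 2\<close> to keep it away from \<open>0\<close>.\<close>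

lemma ac_measure_approximable:
  assumes ac: "absolutely_continuous circle_lebesgue \<mu>" and mu: "prob_space \<mu>" "sets \<mu> = sets borel"
    and \<epsilon>: "\<epsilon> > 0"
  shows "\<exists>\<psi> L. cts_periodic \<psi> \<and> (\<forall>t. \<psi> t > 0) \<and> 0 \<le> L \<and>
      (\<forall>s t. \<psi> s \<le> exp (L * \<bar>s - t\<bar>) * \<psi> t) \<and>
      (\<forall>v B. cts_periodic v \<longrightarrow> (\<forall>t. \<bar>v t\<bar> \<le> B) \<longrightarrow>
         \<bar>(\<integral>x. v (circle_rep x) \<partial>\<mu>) - integral {0..1} (\<lambda>t. v t * \<psi> t)\<bar> \<le> \<epsilon> * B)"
proof -
  interpret mu: prob_space \<mu> by fact
  have sets: "sets \<mu> = sets circle_lebesgue" using mu(2) by simp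
  obtain R where R [measurable]: "R \<in> borel_measurable circle_lebesgue"
      and R_ae: "AE x in circle_lebesgue. RN_deriv circle_lebesgue \<mu> x = ennreal (R x)"
      and R_nn: "\<And>x. 0 \<le> R x"
    using circle_lebesgue.real_RN_deriv[OF mu.finite_measure_axioms ac sets] by metis
  have dens: "\<mu> = density circle_lebesgue R"
  proof -
    have "\<mu> = density circle_lebesgue (RN_deriv circle_lebesgue \<mu>)"
      using circle_lebesgue.density_RN_deriv[OF ac sets] by simp
    also have "\<dots> = density circle_lebesgue R" using R_ae by (intro density_cong) auto
    finally show ?thesis .
  qed
  have R_int: "integrable circle_lebesgue R"
  proof (rule integrableI_nonneg)
    have "(\<integral>\<^sup>+x. ennreal (R x) \<partial>circle_lebesgue) = emeasure (density circle_lebesgue R) UNIV"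
      by (simp add: emeasure_density)
    also have "\<dots> = 1" using mu.emeasure_space_1 dens by (metis space_density space_circle_lebesgue)
    finally show "(\<integral>\<^sup>+x. ennreal (R x) \<partial>circle_lebesgue) < \<infinity>" by simp
  qed (use R_nn in auto)
  have "\<epsilon> / 2 > 0" using \<epsilon> by simp
  then obtain V where V: "circle_lipschitz V" "(\<integral>x. \<bar>R x - V x\<bar> \<partial>circle_lebesgue) < \<epsilon> / 2"
    using integrable_lipschitz_approximable[OF R_int] unfolding lipschitz_approximable_def by blast
  from V(1) obtain C where C: "C-lipschitz_on UNIV (\<lambda>t. V (circle_of t))"
    unfolding circle_lipschitz_def by blast
  define W where "W x = max 0 (V x) + \<epsilon> / 2" for x
  define \<psi> where "\<psi> t = W (circle_of t)" for t
  have cV: "continuous_on UNIV V" by (rule circle_lipschitz_continuous[OF V(1)])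
  have cW: "continuous_on UNIV W" unfolding W_def by (intro continuous_intros cV)
  have \<psi>: "cts_periodic \<psi>" unfolding \<psi>_def by (rule cts_periodic_circle_of[OF cW])
  have low: "\<epsilon> / 2 \<le> \<psi> t" for t by (simp add: \<psi>_def W_def)
  have "\<bar>\<psi> s - \<psi> t\<bar> \<le> C * \<bar>s - t\<bar>" for s t
    using lipschitz_onD[OF C, of s t] by (simp add: \<psi>_def W_def dist_real_def)
  from lipschitz_imp_log_lipschitz[OF \<open>\<epsilon> / 2 > 0\<close> low this lipschitz_on_nonneg[OF C]]
  have lip: "\<psi> s \<le> exp (C / (\<epsilon> / 2) * \<bar>s - t\<bar>) * \<psi> t" for s t .
  have W_int: "integrable circle_lebesgue W"
    by (intro integrable_circle_continuous cW circle_lebesgue.finite_measure_axioms) simp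
  have RW: "(\<integral>x. \<bar>R x - W x\<bar> \<partial>circle_lebesgue) \<le> \<epsilon>"
  proof -
    have "(\<integral>x. \<bar>R x - W x\<bar> \<partial>circle_lebesgue) \<le> (\<integral>x. \<bar>R x - V x\<bar> + \<epsilon> / 2 \<partial>circle_lebesgue)"
    proof (rule integral_mono)
      show "\<bar>R x - W x\<bar> \<le> \<bar>R x - V x\<bar> + \<epsilon> / 2" for x
        using R_nn[of x] \<epsilon> by (simp add: W_def)
    qed (use R_int W_int circle_lipschitz_integrable[OF V(1)] in auto)
    also have "\<dots> = (\<integral>x. \<bar>R x - V x\<bar> \<partial>circle_lebesgue) + \<epsilon> / 2"
      using R_int circle_lipschitz_integrable[OF V(1)]
      by (subst Bochner_Integration.integral_add) (auto simp: circle_lebesgue.prob_space[simplified])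
    finally show ?thesis using V(2) by simp
  qed
  have "\<bar>(\<integral>x. v (circle_rep x) \<partial>\<mu>) - integral {0..1} (\<lambda>t. v t * \<psi> t)\<bar> \<le> \<epsilon> * B"
    if v: "cts_periodic v" and B: "\<And>t. \<bar>v t\<bar> \<le> B" for v B
  proof -
    let ?v = "\<lambda>x. v (circle_rep x)"
    have cv: "continuous_on UNIV ?v" by (rule cts_periodic_continuous_rep[OF v])
    have [measurable]: "?v \<in> borel_measurable circle_lebesgue"
      using borel_measurable_circle[OF cv] by (simp cong: measurable_cong_sets)
    have vR: "integrable circle_lebesgue (\<lambda>x. ?v x * R x)"
    proof (rule Bochner_Integration.integrable_bound[of _ "\<lambda>x. B * R x"])
      show "AE x in circle_lebesgue. norm (?v x * R x) \<le> norm (B * R x)"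
      proof (rule AE_I2)
        fix x
        have "\<bar>?v x\<bar> \<le> \<bar>B\<bar>" using B[of "circle_rep x"] by linarith
        then show "norm (?v x * R x) \<le> norm (B * R x)" by (simp add: abs_mult mult_right_mono)
      qed
    qed (use R_int in auto)
    have vW: "integrable circle_lebesgue (\<lambda>x. ?v x * W x)"
      by (intro integrable_circle_continuous continuous_on_mult cv cW circle_lebesgue.finite_measure_axioms) simp
    have 1: "(\<integral>x. ?v x \<partial>\<mu>) = (\<integral>x. ?v x * R x \<partial>circle_lebesgue)"
      unfolding dens by (subst integral_density) (auto simp: R_nn mult.commute)
    have 2: "integral {0..1} (\<lambda>t. v t * \<psi> t) = (\<integral>x. ?v x * W x \<partial>circle_lebesgue)"
      by (subst integral_circle_lebesgue)
         (auto intro!: continuous_on_mult cv cW simp: cts_periodic_rep[OF v] \<psi>_def)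
    have "\<bar>(\<integral>x. ?v x * R x \<partial>circle_lebesgue) - (\<integral>x. ?v x * W x \<partial>circle_lebesgue)\<bar>
        = \<bar>\<integral>x. ?v x * (R x - W x) \<partial>circle_lebesgue\<bar>"
      using vR vW by (simp add: right_diff_distrib)
    also have "\<dots> \<le> (\<integral>x. \<bar>?v x * (R x - W x)\<bar> \<partial>circle_lebesgue)"
      by (rule integral_abs_bound)
    also have "\<dots> \<le> (\<integral>x. B * \<bar>R x - W x\<bar> \<partial>circle_lebesgue)"
    proof (rule integral_mono)
      show "integrable circle_lebesgue (\<lambda>x. \<bar>?v x * (R x - W x)\<bar>)"
        using vR vW by (intro integrable_abs) (simp add: right_diff_distrib)
      show "integrable circle_lebesgue (\<lambda>x. B * \<bar>R x - W x\<bar>)" using R_int W_int by simp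
      show "\<bar>?v x * (R x - W x)\<bar> \<le> B * \<bar>R x - W x\<bar>" for x
        unfolding abs_mult using B by (rule mult_right_mono) simp
    qed
    also have "\<dots> = B * (\<integral>x. \<bar>R x - W x\<bar> \<partial>circle_lebesgue)" by simp
    also have "\<dots> \<le> B * \<epsilon>" using RW B[of 0] by (intro mult_left_mono) auto
    finally show ?thesis unfolding 1 2 by (simp add: mult.commute)
  qed
  moreover have "0 \<le> C / (\<epsilon> / 2)" using lipschitz_on_nonneg[OF C] \<epsilon> by simp
  moreover have "\<psi> t > 0" for t using low[of t] \<epsilon> by linarith
  ultimately show ?thesis using \<psi> lip by blast
qed

section \<open>Lifts of expanding circle maps\<close>

lemma expanding_lift_mono:
  assumes "expanding_lift F F' d \<kappa> D" "\<kappa> \<le> \<kappa>'" "\<kappa>' < 1" "D \<le> D'"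
  shows "expanding_lift F F' d \<kappa>' D'"
proof -
  interpret expanding_lift F F' d \<kappa> D by fact
  show ?thesis
  proof
    show "0 < \<kappa>'" "\<kappa>' < 1" "0 \<le> D'" using lam assms D_nonneg by auto
    show "1 / \<kappa>' \<le> F' t" for t
      using expand[of t] frac_le[of 1 1 \<kappa> \<kappa>'] lam assms(2) by simp
    show "F' s \<le> exp (D' * \<bar>s - t\<bar>) * F' t" for s t
    proof (rule order_trans[OF distortion mult_right_mono])
      show "exp (D * \<bar>s - t\<bar>) \<le> exp (D' * \<bar>s - t\<bar>)" using assms(4) by (simp add: mult_right_mono)
    qed (use deriv_pos less_imp_le in blast)
  qed
qed

text \<open>The derivative of a lift has no zeros, hence constant sign, and its mean over a period is the
  positive degree. By periodicity the derivative stays away from \<open>1\<close>, and the bounded second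
  derivative yields the distortion constant; this is where \<open>r \<ge> 2\<close> enters.\<close>

lemma expanding_circle_map_lift:
  assumes r: "r \<ge> 2" and f: "C_circle r f" and e: "expanding f" and d: "circle_degree f = int d" "d > 0"
  obtains F F' \<kappa> D where "is_lift F f" "C_real r F" "\<And>t. circle_deriv f (circle_of t) = F' t"
    "expanding_lift F F' d \<kappa> D"
proof -
  obtain F where F: "is_lift F f" "C_real r F" using f by (auto simp: C_circle_def)
  obtain s where s: "r = Suc (Suc s)" using r by (metis add_2_eq_Suc le_Suc_ex)
  define F' where "F' = deriv F"
  note D1 = C_real_deriv[OF F(2)[unfolded s], folded F'_def]
  have fd: "circle_deriv f (circle_of t) = F' t" for t
    by (rule circle_deriv_eq[OF F(1) D1(1)])
  have abs: "\<bar>F' t\<bar> > 1" for t using e fd by (metis expanding_def)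
  have deg: "F (t + 1) = F t + real d" for t using is_lift_degree[OF F(1)] d by simp
  have cF': "continuous_on UNIV F'" by (rule C_real_continuous[OF D1(2)])
  have gt: "F' t > 1" for t
  proof (rule ccontr)
    assume "\<not> F' t > 1"
    then have neg: "F' t \<le> 0" using abs[of t] by linarith
    obtain z where z: "F 1 - F 0 = (1 - 0) * F' z"
      using MVT2[of 0 1 F F'] D1(1) by auto
    then have "F' z \<ge> 0" using deg[of 0] by simp
    then obtain y where "F' y = 0"
      using neg IVT'[of F' t 0 z] IVT2'[of F' t 0 z] continuous_on_subset[OF cF' subset_UNIV]
      by (cases "t \<le> z") auto
    then show False using abs[of y] by simp
  qed
  interpret increasing_lift F F' d
  proof
    show "0 < F' t" for t using gt[of t] by linarith
  qed (use D1 cF' deg d in auto)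
  have "\<exists>b>0. \<forall>t. b \<le> F' t - 1"
    using gt by (intro cts_periodic_positive_lower_bound cts_periodic_diff cts_periodic_const cts_periodic_deriv) auto
  then obtain b where b: "b > 0" "\<And>t. b \<le> F' t - 1" by blast
  note D2 = C_real_deriv[OF D1(2)]
  have "deriv F' (t + 1) = deriv F' t" for t
  proof (rule DERIV_unique)
    show "((\<lambda>t. F' (t + 1)) has_real_derivative deriv F' (t + 1)) (at t)"
      using D2(1)[of "t + 1"] by (simp add: DERIV_shift)
    show "((\<lambda>t. F' (t + 1)) has_real_derivative deriv F' t) (at t)"
      unfolding deriv_periodic by (rule D2(1))
  qed
  then have "cts_periodic (deriv F')" by (intro cts_periodicI C_real_continuous[OF D2(2)])
  then obtain C where C: "\<And>t. \<bar>deriv F' t\<bar> \<le> C" using cts_periodic_bounded by blast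
  have "0 \<le> C" using C[of 0] by linarith
  have lip: "\<bar>F' s - F' t\<bar> \<le> C * \<bar>s - t\<bar>" for s t
  proof -
    have "norm (F' s - F' t) \<le> C * norm (s - t)"
      by (rule field_differentiable_bound[of UNIV F' "deriv F'"]) (use D2(1) C in auto)
    then show ?thesis by simp
  qed
  have "expanding_lift F F' d (1 / (1 + b)) (C / 1)"
  proof
    show "0 < 1 / (1 + b)" "1 / (1 + b) < 1" using b(1) by auto
    show "1 / (1 / (1 + b)) \<le> F' t" for t using b(2)[of t] by simp
    show "0 \<le> C / 1" using \<open>0 \<le> C\<close> by simp
    show "F' s \<le> exp (C / 1 * \<bar>s - t\<bar>) * F' t" for s t
      by (rule lipschitz_imp_log_lipschitz[OF _ _ lip \<open>0 \<le> C\<close>]) (use gt less_imp_le in auto)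
  qed
  then show ?thesis using that F fd by blast
qed

lemma lift_rep:
  assumes "is_lift F f" "cts_periodic v"
  shows "v (circle_rep (f x)) = v (F (circle_rep x))"
proof -
  have "f x = circle_of (F (circle_rep x))"
    using assms(1) unfolding is_lift_def by (metis circle_of_rep)
  then show ?thesis using cts_periodic_rep[OF assms(2)] by simp
qed

text \<open>The absolutely continuous stationary measure is transported to the universal cover, where the
  functional \<open>I\<close> carries all that is needed of it. The finitely many lifts share the largest of their
  constants.\<close>

theorem SRB_density:
  assumes r: "r \<ge> 2" and m: "m \<ge> 1"
    and f: "\<And>i. i \<in> {1..m} \<Longrightarrow> C_circle r (f i)"
    and e: "\<And>i. i \<in> {1..m} \<Longrightarrow> expanding (f i)"
    and d: "\<And>i. i \<in> {1..m} \<Longrightarrow> circle_degree (f i) = int (d i)" "\<And>i. i \<in> {1..m} \<Longrightarrow> d i > 0"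
    and st: "stationary_SRB m f \<mu>"
  obtains F F' \<kappa> D \<phi> where
    "\<forall>i\<in>{1..m}. is_lift (F i) (f i) \<and> C_real r (F i)"
    "stationary_random_lifts m F F' d \<kappa> D \<phi>"
    "lyapunov_exponent m f \<mu> = stationary_random_lifts.exponent m F' \<phi>"
proof -
  have "\<forall>i\<in>{1..m}. \<exists>F F' \<kappa> D. is_lift F (f i) \<and> C_real r F \<and>
      (\<forall>t. circle_deriv (f i) (circle_of t) = F' t) \<and> expanding_lift F F' (d i) \<kappa> D"
  proof
    fix i assume i: "i \<in> {1..m}"
    show "\<exists>F F' \<kappa> D. is_lift F (f i) \<and> C_real r F \<and>
        (\<forall>t. circle_deriv (f i) (circle_of t) = F' t) \<and> expanding_lift F F' (d i) \<kappa> D"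
      by (rule expanding_circle_map_lift[OF r f[OF i] e[OF i] d(1)[OF i] d(2)[OF i]]) blast
  qed
  then obtain F F' \<kappa> D where F: "\<And>i. i \<in> {1..m} \<Longrightarrow> is_lift (F i) (f i)"
      "\<And>i. i \<in> {1..m} \<Longrightarrow> C_real r (F i)"
      "\<And>i t. i \<in> {1..m} \<Longrightarrow> circle_deriv (f i) (circle_of t) = F' i t"
      "\<And>i. i \<in> {1..m} \<Longrightarrow> expanding_lift (F i) (F' i) (d i) (\<kappa> i) (D i)"
    by metis
  define \<kappa>0 D0 where "\<kappa>0 = Max (\<kappa> ` {1..m})" and "D0 = Max (D ` {1..m})"
  have "\<kappa>0 < 1"
    unfolding \<kappa>0_def using m expanding_lift.lam(2)[OF F(4)] by (subst Max_less_iff) auto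
  have lifts: "expanding_lift (F i) (F' i) (d i) \<kappa>0 D0" if i: "i \<in> {1..m}" for i
    by (rule expanding_lift_mono[OF F(4)[OF i] _ \<open>\<kappa>0 < 1\<close>]) (use i in \<open>auto simp: \<kappa>0_def D0_def\<close>)
  interpret random_lifts m F F' d \<kappa>0 D0
    by (rule random_lifts.intro) (use m lifts in auto)
  have st': "stationary m f \<mu>" and ac: "absolutely_continuous circle_lebesgue \<mu>"
    using st by (auto simp: stationary_SRB_def)
  have mu: "prob_space \<mu>" "sets \<mu> = sets borel" using st' by (auto simp: stationary_def)
  interpret mu: prob_space \<mu> by fact
  have fm: "f i \<in> borel_measurable borel" if "i \<in> {1..m}" for i
    using C_circle_measurable[OF f[OF that]] r by simp
  define I where "I v = (\<integral>x. v (circle_rep x) \<partial>\<mu>)" for v :: "real \<Rightarrow> real"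
  have stat: "I v = (1 / real m) * (\<Sum>i=1..m. I (\<lambda>t. v (F i t)))" if v: "cts_periodic v" for v
  proof -
    obtain B where "\<And>t. \<bar>v t\<bar> \<le> B" using cts_periodic_bounded[OF v] by blast
    then have "I v = (1 / real m) * (\<Sum>i=1..m. \<integral>x. v (circle_rep (f i x)) \<partial>\<mu>)"
      unfolding I_def
      by (intro stationary_integral[OF m fm st', where B = B] borel_measurable_circle cts_periodic_continuous_rep v)
    also have "(\<Sum>i=1..m. \<integral>x. v (circle_rep (f i x)) \<partial>\<mu>) = (\<Sum>i=1..m. I (\<lambda>t. v (F i t)))"
      unfolding I_def by (intro sum.cong refl) (simp add: lift_rep[OF F(1) v])
    finally show ?thesis .
  qed
  obtain \<phi> where \<phi>: "cts_periodic \<phi>" "\<And>t. \<phi> t > 0"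
    and I: "\<And>v. cts_periodic v \<Longrightarrow> I v = integral {0..1} (\<lambda>t. v t * \<phi> t)"
  proof (rule stationary_density[OF stat])
    show "I (\<lambda>_. 1) = 1" by (simp add: I_def mu.prob_space)
  qed (use ac_measure_approximable[OF ac mu, folded I_def] in auto)
  have "stationary_random_lifts m F F' d \<kappa>0 D0 \<phi>"
  proof (intro stationary_random_lifts.intro random_lifts_axioms stationary_random_lifts_axioms.intro)
    show "integral {0..1} \<phi> = 1"
      using I[OF cts_periodic_const[of 1]] by (simp add: I_def mu.prob_space)
    show "integral {0..1} (\<lambda>t. v t * \<phi> t) = (1 / real m) * (\<Sum>i=1..m. integral {0..1} (\<lambda>t. v (F i t) * \<phi> t))"
      if v: "cts_periodic v" for v
      using stat[OF v] I[OF v] I[OF increasing_lift.cts_periodic_comp_lift[OF increasing v]]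
      by (simp cong: sum.cong_simp)
  qed (use \<phi> in auto)
  then interpret stationary_random_lifts m F F' d \<kappa>0 D0 \<phi> .
  have "(\<integral>x. ln \<bar>circle_deriv (f i) x\<bar> \<partial>\<mu>) = integral {0..1} (\<lambda>t. ln (F' i t) * \<phi> t)"
    if i: "i \<in> {1..m}" for i
  proof -
    interpret increasing_lift "F i" "F' i" "d i" by (rule increasing[OF i])
    have "ln \<bar>circle_deriv (f i) x\<bar> = ln (F' i (circle_rep x))" for x
      using F(3)[OF i, of "circle_rep x"] deriv_pos[of "circle_rep x"] by simp
    then have "(\<integral>x. ln \<bar>circle_deriv (f i) x\<bar> \<partial>\<mu>) = I (\<lambda>t. ln (F' i t))" by (simp add: I_def)
    also have "\<dots> = integral {0..1} (\<lambda>t. ln (F' i t) * \<phi> t)"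
      by (intro I cts_periodic_ln cts_periodic_deriv deriv_pos)
    finally show ?thesis .
  qed
  then have "lyapunov_exponent m f \<mu> = exponent"
    by (simp add: lyapunov_exponent_def exponent_def)
  then show ?thesis using that F(1,2) \<open>stationary_random_lifts m F F' d \<kappa>0 D0 \<phi>\<close> by blast
qed

section \<open>Conjugacy to affine maps\<close>

lemma circle_of_add: "circle_of (s + t) = circle_of s + circle_of t"
  by transfer (simp add: circle_rel_def)

lemma circle_scale_of: "circle_scale k (circle_of t) = circle_of (of_int k * t)"
  by transfer (simp add: circle_rel_def)

lemma (in increasing_lift) degree_one_diffeo:
  assumes d: "d = 1" and C: "C_real (Suc s) F"
  obtains h where "h \<in> Diff_circle (Suc s)" "is_lift F h" "is_lift g (inv h)"
proof -
  define h where "h x = circle_of (F (circle_rep x))" for x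
  define h' where "h' x = circle_of (g (circle_rep x))" for x
  have hF: "h (circle_of t) = circle_of (F t)" for t
    unfolding h_def using degree d circle_of_add_int[of _ 1]
    by (intro periodic_rep[of "\<lambda>t. circle_of (F t)"]) simp
  have hg: "h' (circle_of t) = circle_of (g t)" for t
    unfolding h'_def using g_add_degree d circle_of_add_int[of _ 1]
    by (intro periodic_rep[of "\<lambda>t. circle_of (g t)"]) simp
  have "h (h' x) = x" "h' (h x) = x" for x
    using hF[of "g (circle_rep x)"] hg[of "circle_rep x"] hg[of "F (circle_rep x)"] hF[of "circle_rep x"]
    by simp_all
  then have bij: "bij h" and inv: "inv h = h'"
    by (metis bij_iff, metis inv_equality)
  have lift: "is_lift F h" "is_lift g h'"
    using hF hg continuous_lift continuous_g by (auto simp: is_lift_def)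
  have "C_real s F'" using C_real_Suc[OF deriv] C by blast
  then have "C_real (Suc s) g"
    using deriv_pos by (intro C_real_inverse_function[of g F'] deriv_g) (auto simp: less_imp_neq[THEN not_sym])
  then have "h \<in> Diff_circle (Suc s)"
    using bij lift C by (auto simp: Diff_circle_def C_circle_def inv)
  then show ?thesis using that lift by (simp add: inv)
qed

text \<open>The primitive \<open>H\<close> of the density is the coordinate in which the density becomes constant. There
  the relation \<open>d\<^sub>i \<phi> = F\<^sub>i' (\<phi> \<circ> F\<^sub>i)\<close> says that every map has constant derivative \<open>d\<^sub>i\<close>. The
  functional equation of the first map makes \<open>H\<close> smooth.\<close>

theorem (in stationary_random_lifts) conjugacy_of_equality:
  assumes eq: "exponent = (1 / real m) * (\<Sum>i=1..m. ln (real (d i)))"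
    and F: "\<And>i. i \<in> {1..m} \<Longrightarrow> is_lift (F i) (f i)" "\<And>i. i \<in> {1..m} \<Longrightarrow> C_real (Suc s) (F i)"
  obtains h \<rho> where "h \<in> Diff_circle (Suc s)"
    "\<And>i x. i \<in> {1..m} \<Longrightarrow> h (f i (inv h x)) = circle_scale (int (d i)) x + \<rho> i"
proof -
  note inv = exponent_eq_imp[OF eq]
  have one: "1 \<in> {1..m}" using m_pos by simp
  have "C_real s (F' 1)"
    using C_real_Suc[OF increasing_lift.deriv[OF increasing[OF one]]] F(2)[OF one] by blast
  then have C\<phi>: "C_real s \<phi>"
    by (rule expanding_lift.density_regularity[OF lift[OF one] density density_pos inv[OF one]])
  obtain H where H: "\<And>t. (H has_real_derivative \<phi> t) (at t)"
    using continuous_antiderivative cts_periodic_continuous[OF density] by blast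
  have H1: "H (t + 1) = H t + real 1" for t
    using integral_antiderivative[OF H, of t "t + 1"] integral_period[OF density, of t] density_integral by simp
  interpret H: increasing_lift H \<phi> 1
    by unfold_locales (use H H1 density_pos cts_periodic_continuous[OF density] in auto)
  have CH: "C_real (Suc s) H" using C_real_Suc[OF H] C\<phi> by simp
  obtain h where h: "h \<in> Diff_circle (Suc s)" "is_lift H h" "is_lift H.g (inv h)"
    using H.degree_one_diffeo[OF refl CH] by blast
  have const: "H (F i t) - real (d i) * H t = H (F i 0) - real (d i) * H 0" if i: "i \<in> {1..m}" for i t
  proof (rule constant_if_derivative_zero[where E = "\<lambda>t. H (F i t) - real (d i) * H t"])
    fix t
    have "((\<lambda>t. H (F i t) - real (d i) * H t) has_real_derivative \<phi> (F i t) * F' i t - real (d i) * \<phi> t) (at t)"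
      by (intro DERIV_diff DERIV_cmult H DERIV_chain2[OF H increasing_lift.deriv[OF increasing[OF i]]])
    then show "((\<lambda>t. H (F i t) - real (d i) * H t) has_real_derivative 0) (at t)"
      using inv[OF i, of t] by (simp add: mult.commute)
  qed
  have aff: "H (F i t) = real (d i) * H t + (H (F i 0) - real (d i) * H 0)" if "i \<in> {1..m}" for i t
    using const[OF that, of t] by linarith
  have "h (f i (inv h x)) = circle_scale (int (d i)) x + circle_of (H (F i 0) - real (d i) * H 0)"
    if i: "i \<in> {1..m}" for i x
  proof -
    obtain y where y: "x = circle_of y" using circle_of_surj by metis
    have lifts: "h (circle_of t) = circle_of (H t)" "inv h (circle_of t) = circle_of (H.g t)"
      "f i (circle_of t) = circle_of (F i t)" for t
      using h(2,3) F(1)[OF i] by (auto simp: is_lift_def)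
    have "h (f i (inv h x)) = circle_of (H (F i (H.g y)))" by (simp only: lifts y)
    also have "H (F i (H.g y)) = real (d i) * y + (H (F i 0) - real (d i) * H 0)"
      by (subst aff[OF i]) simp
    also have "circle_of \<dots> = circle_scale (int (d i)) x + circle_of (H (F i 0) - real (d i) * H 0)"
      by (simp only: circle_of_add y circle_scale_of of_int_of_nat_eq)
    finally show ?thesis .
  qed
  then show ?thesis using that[of h "\<lambda>i. circle_of (H (F i 0) - real (d i) * H 0)"] h(1) by blast
qed

text \<open>Both \<open>H \<circ> F\<^sub>i\<close> and \<open>d\<^sub>i H + c\<close> lift \<open>h \<circ> f\<^sub>i\<close>, so their derivatives agree, and taking logarithms
  exhibits \<open>ln F\<^sub>i' - ln d\<^sub>i\<close> as a coboundary. The absolute value admits conjugacies that reverse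
  orientation.\<close>

theorem (in stationary_random_lifts) equality_of_conjugacy:
  assumes h: "h \<in> Diff_circle r" and r: "1 \<le> r"
    and F: "\<And>i. i \<in> {1..m} \<Longrightarrow> is_lift (F i) (f i)"
    and conj: "\<And>i x. i \<in> {1..m} \<Longrightarrow> h (f i (inv h x)) = circle_scale (int (d i)) x + \<rho> i"
  shows "exponent = (1 / real m) * (\<Sum>i=1..m. ln (real (d i)))"
proof -
  obtain s where s: "r = Suc s" using r by (cases r) auto
  obtain H where H: "is_lift H h" "C_real r H" using h by (auto simp: Diff_circle_def C_circle_def)
  obtain G where G: "is_lift G (inv h)" "C_real r G" using h by (auto simp: Diff_circle_def C_circle_def)
  define H' where "H' = deriv H"
  note DH = C_real_deriv[OF H(2)[unfolded s], folded H'_def]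
  note DG = C_real_deriv(1)[OF G(2)[unfolded s]]
  have inv_h: "inv h (h x) = x" for x using h by (simp add: Diff_circle_def bij_is_inj)
  have H'_nz: "H' t \<noteq> 0" for t
  proof -
    have "inv h \<circ> h = id" using inv_h by auto
    then obtain n where n: "\<And>t. (G \<circ> H) t = id t + of_int n"
      using is_lift_unique[OF is_lift_id] is_lift_comp[OF G(1) H(1)] by metis
    have "((\<lambda>t. G (H t)) has_real_derivative deriv G (H t) * H' t) (at t)"
      by (rule DERIV_chain2[OF DG DH(1)])
    moreover have "((\<lambda>t. G (H t)) has_real_derivative 1) (at t)"
      using n by (auto intro!: derivative_eq_intros simp: fun_eq_iff)
    ultimately have "deriv G (H t) * H' t = 1" by (rule DERIV_unique)
    then show ?thesis by auto
  qed
  have H'_per: "cts_periodic H'"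
  proof (rule cts_periodicI)
    show "continuous_on UNIV H'" by (rule C_real_continuous[OF DH(2)])
    show "H' (t + 1) = H' t" for t
    proof (rule DERIV_unique)
      show "((\<lambda>t. H (t + 1)) has_real_derivative H' (t + 1)) (at t)"
        using DH(1)[of "t + 1"] by (simp add: DERIV_shift)
      show "((\<lambda>t. H (t + 1)) has_real_derivative H' t) (at t)"
        unfolding is_lift_degree[OF H(1)] using DH(1)[of t] by (auto intro!: derivative_eq_intros)
    qed
  qed
  have inv: "real (d i) * H' t = H' (F i t) * F' i t" if i: "i \<in> {1..m}" for i t
  proof -
    obtain c where c: "\<rho> i = circle_of c" using circle_of_surj by metis
    have 1: "is_lift (H \<circ> F i) (h \<circ> f i)" by (rule is_lift_comp[OF H(1) F[OF i]])
    have 2: "is_lift (\<lambda>t. real (d i) * H t + c) (h \<circ> f i)"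
      unfolding is_lift_def
    proof (intro conjI allI)
      show "continuous_on UNIV (\<lambda>t. real (d i) * H t + c)"
        using H(1) by (auto simp: is_lift_def intro!: continuous_intros)
      fix t
      have "(h \<circ> f i) (circle_of t) = circle_scale (int (d i)) (h (circle_of t)) + \<rho> i"
        using conj[OF i, of "h (circle_of t)"] by (simp add: inv_h)
      then show "(h \<circ> f i) (circle_of t) = circle_of (real (d i) * H t + c)"
        using H(1) by (simp add: is_lift_def c circle_scale_of circle_of_add)
    qed
    obtain n where n: "\<And>t. real (d i) * H t + c = (H \<circ> F i) t + of_int n"
      using is_lift_unique[OF 1 2] by blast
    have "((\<lambda>t. H (F i t)) has_real_derivative H' (F i t) * F' i t) (at t)"
      by (rule DERIV_chain2[OF DH(1) increasing_lift.deriv[OF increasing[OF i]]])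
    moreover have "((\<lambda>t. real (d i) * H t + c - of_int n) has_real_derivative real (d i) * H' t) (at t)"
      using DH(1)[of t] by (auto intro!: derivative_eq_intros)
    moreover have "(\<lambda>t. H (F i t)) = (\<lambda>t. real (d i) * H t + c - of_int n)"
      using n by (auto simp: fun_eq_iff)
    ultimately show ?thesis using DERIV_unique by metis
  qed
  have "exponent = (1 / real m) * (\<Sum>i=1..m. ln (real (d i)))
    + (1 / real m) * (\<Sum>i=1..m. integral {0..1} (\<lambda>t. 0 * \<phi> t))"
  proof (rule exponent_coboundary[where v = "\<lambda>t. ln \<bar>H' t\<bar>"])
    have "cts_periodic (\<lambda>t. \<bar>H' t\<bar>)"
      using H'_per by (auto simp: cts_periodic_def intro: continuous_intros)
    then show "cts_periodic (\<lambda>t. ln \<bar>H' t\<bar>)" by (rule cts_periodic_ln) (simp add: H'_nz)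
    show "ln (F' i t) = ln (real (d i)) + ln \<bar>H' t\<bar> - ln \<bar>H' (F i t)\<bar> + 0" if i: "i \<in> {1..m}" for i t
    proof -
      interpret increasing_lift "F i" "F' i" "d i" by (rule increasing[OF i])
      have "real (d i) * \<bar>H' t\<bar> = \<bar>H' (F i t)\<bar> * F' i t"
        using arg_cong[OF inv[OF i, of t], of abs] deriv_pos[of t] by (simp add: abs_mult)
      then have "ln (real (d i)) + ln \<bar>H' t\<bar> = ln \<bar>H' (F i t)\<bar> + ln (F' i t)"
        using degree_pos deriv_pos[of t] H'_nz by (metis ln_mult_pos of_nat_0_less_iff zero_less_abs_iff)
      then show ?thesis by simp
    qed
  qed (rule cts_periodic_const)
  then show ?thesis by simp
qed

theorem theorem1p1:
  fixes r m :: nat and f :: "nat \<Rightarrow> circle \<Rightarrow> circle" and d :: "nat \<Rightarrow> int"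
    and \<mu>_SRB :: "circle measure"
  assumes "r \<ge> 2" and "m \<ge> 1"
    and "\<And>i. i \<in> {1..m} \<Longrightarrow> C_circle r (f i)"
    and "\<And>i. i \<in> {1..m} \<Longrightarrow> expanding (f i)"
    and "\<And>i. i \<in> {1..m} \<Longrightarrow> circle_degree (f i) = d i"
    and "\<And>i. i \<in> {1..m} \<Longrightarrow> d i \<ge> 2"
    and "stationary_SRB m f \<mu>_SRB"
  shows "lyapunov_exponent m f \<mu>_SRB \<le> (1 / real m) * (\<Sum>i = 1..m. ln \<bar>real_of_int (d i)\<bar>)
    \<and> (lyapunov_exponent m f \<mu>_SRB = (1 / real m) * (\<Sum>i = 1..m. ln \<bar>real_of_int (d i)\<bar>)
        \<longleftrightarrow> (\<exists>h \<in> Diff_circle r. \<exists>\<rho> :: nat \<Rightarrow> circle. \<forall>i \<in> {1..m}. \<forall>x.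
               (h \<circ> f i \<circ> inv h) x = circle_scale (d i) x + \<rho> i))"
proof -
  define n where "n i = nat (d i)" for i
  have n: "d i = int (n i)" "n i > 0" if "i \<in> {1..m}" for i
    using assms(6)[OF that] by (auto simp: n_def)
  have deg: "circle_degree (f i) = int (n i)" if "i \<in> {1..m}" for i
    using assms(5)[OF that] n(1)[OF that] by simp
  obtain F F' \<kappa> D \<phi> where lifts: "\<forall>i\<in>{1..m}. is_lift (F i) (f i) \<and> C_real r (F i)"
    and S: "stationary_random_lifts m F F' n \<kappa> D \<phi>"
    and L: "lyapunov_exponent m f \<mu>_SRB = stationary_random_lifts.exponent m F' \<phi>"
    using SRB_density[where d = n, OF assms(1-4) deg n(2) assms(7)] by blast
  have F: "is_lift (F i) (f i)" "C_real r (F i)" if "i \<in> {1..m}" for i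
    using lifts that by auto
  interpret stationary_random_lifts m F F' n \<kappa> D \<phi> by (rule S)
  obtain s where s: "r = Suc s" using assms(1) by (cases r) auto
  have sum: "(\<Sum>i = 1..m. ln \<bar>real_of_int (d i)\<bar>) = (\<Sum>i=1..m. ln (real (n i)))"
    by (intro sum.cong refl) (simp add: n(1))
  show ?thesis unfolding L sum
  proof (intro conjI iffI exponent_le)
    assume "exponent = (1 / real m) * (\<Sum>i=1..m. ln (real (n i)))"
    from conjugacy_of_equality[OF this F(1) F(2)[unfolded s]] obtain h \<rho> where
      "h \<in> Diff_circle (Suc s)" "\<And>i x. i \<in> {1..m} \<Longrightarrow> h (f i (inv h x)) = circle_scale (int (n i)) x + \<rho> i"
      by metis
    then show "\<exists>h \<in> Diff_circle r. \<exists>\<rho>. \<forall>i \<in> {1..m}. \<forall>x. (h \<circ> f i \<circ> inv h) x = circle_scale (d i) x + \<rho> i"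
      using n(1) s by (intro bexI[of _ h] exI[of _ \<rho>]) auto
  next
    assume "\<exists>h \<in> Diff_circle r. \<exists>\<rho>. \<forall>i \<in> {1..m}. \<forall>x. (h \<circ> f i \<circ> inv h) x = circle_scale (d i) x + \<rho> i"
    then obtain h \<rho> where h: "h \<in> Diff_circle r"
      "\<And>i x. i \<in> {1..m} \<Longrightarrow> h (f i (inv h x)) = circle_scale (int (n i)) x + \<rho> i"
      using n(1) by auto
    show "exponent = (1 / real m) * (\<Sum>i=1..m. ln (real (n i)))"
      by (rule equality_of_conjugacy[OF h(1) _ F(1) h(2)]) (use assms(1) in auto)
  qed
qed

end
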